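(* Let $T$ be either $\left(-\frac4{11},-\frac1{44}\right)$ or $\left(-\frac1{44},\frac7{22}\right)$, and let $h$ be absolutely monotone with $h^{(4)}>0$ (on $(-1,1)$). Then for every $T$-avoiding code $C\subset\mathbb{S}^{21}$ with $|C|=2025$, $$E_h(C)\ \ge\ \mathcal{E}_h(22,2025;T)=2025\left(330\,h\!\left(-\tfrac4{11}\right)+1232\,h\!\left(-\tfrac1{44}\right)+462\,h\!\left(\tfrac7{22}\right)\right).$$ Consequently, the code $C_{2025}$ is universally optimal in the class of such $T$-avoiding spherical codes on $\mathbb{S}^{21}$. If equality $E_h(C)=\mathcal{E}_h(22,2025;T)$ is attained for any other code $C$, then $C$ has to be a spherical $3$-design with the same inner products and distance distribution as $C_{2025}$, namely $I(C)=\{-\frac4{11},-\frac1{44},\frac7{22}\}$ and distance distribution $(330,1232,462)$.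
   Context: A spherical code is a finite set $C\subset\mathbb{S}^{n-1}$; $I(C)=\{x\cdot y: x,y\in C,\ x\ne y\}$. For $T\subset[-1,1)$, $C$ is $T$-avoiding if $I(C)\cap T=\varnothing$. A spherical $\tau$-design is a spherical code $C$ such that the average over $C$ of every polynomial in $n$ variables of total degree at most $\tau$ equals its average over $\mathbb{S}^{n-1}$ with respect to normalized surface measure. A potential is a function $h:[-1,1)\to(-\infty,+\infty)$, continuous on $[-1,1)$; it is absolutely monotone if $h^{(j)}\ge0$ for all $j\ge1$ (on $(-1,1)$). The $h$-energy is $E_h(C)=\sum_{x\neq y\in C}h(x\cdot y)$ (sum over ordered pairs). $\mathcal{E}_h(n,N;T)$ is the minimum of $E_h(C)$ over all $T$-avoiding spherical codes $C\subset\mathbb{S}^{n-1}$ with $|C|=N$. For $T$ open, a code $C\subset\mathbb{S}^{n-1}$ is $T$-avoiding universally optimal if it is $T$-avoiding and, for every absolutely monotone $h$, it minimizes $E_h$ among all $T$-avoiding codes on $\mathbb{S}^{n-1}$ of cardinality $|C|$. The distance distribution of a distance-invariant code $C$ (one for which $A_t=|\{y\in C: x\cdot y=t\}|$ is independent of $x\in C$ for each $t\in I(C)$) is the tuple $(A_t)$ listed in increasing order of $t\in I(C)$. The code $C_{2025}$: let $L\subset\mathbb{S}^{23}$ be the set of the $196560$ minimal vectors of the Leech lattice rescaled to unit length. Fix $x\in L$; let $C_{1/2}\subset\mathbb{S}^{22}$ be the set of vectors $(y-\frac12x)/\sqrt{1-\frac14}$ with $y\in L$, $x\cdot y=\frac12$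 (in the unit sphere of $x^\perp\cong\mathbb{R}^{23}$); this is the tight spherical $7$-design with $4600$ points. Let $\widetilde w\in\mathbb{S}^{22}$ be a global minimum of the potential $u\mapsto\sum_{y\in C_{1/2}}h(u\cdot y)$ of $C_{1/2}$; the inner products of $\widetilde w$ with points of $C_{1/2}$ are $-\frac{\sqrt5}5,-\frac{\sqrt5}{15},\frac{\sqrt5}{15},\frac{\sqrt5}5$, occurring $275,2025,2025,275$ times. With $\alpha=\frac{\sqrt5}{15}$, $C_{2025}$ is the set of vectors $(y-\alpha\widetilde w)/\sqrt{1-\alpha^2}$ with $y\in C_{1/2}$, $y\cdot\widetilde w=\alpha$, regarded as a subset of the unit sphere $\mathbb{S}^{21}$ of the orthogonal complement of $\widetilde w$ in $\mathbb{R}^{23}$. It is a spherical $4$-design with $2025$ points, with the inner products and distance distribution listed in the claim. *)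

theory Defs
  imports "HOL-Analysis.Analysis" "HOL-Number_Theory.Number_Theory"
begin

section \<open>Spherical codes and designs\<close>

definition spherical_code :: "'a::euclidean_space set \<Rightarrow> bool" where
  "spherical_code C \<longleftrightarrow> finite C \<and> C \<subseteq> sphere 0 1"

definition inner_products :: "'a::euclidean_space set \<Rightarrow> real set" where
  "inner_products C = {x \<bullet> y | x y. x \<in> C \<and> y \<in> C \<and> x \<noteq> y}"

definition avoiding :: "real set \<Rightarrow> 'a::euclidean_space set \<Rightarrow> bool" where
  "avoiding T C \<longleftrightarrow> inner_products C \<inter> T = {}"

text \<open>Polynomial functions in the coordinates of total degree at most \<open>d\<close>; the summation index
  \<open>e\<close> is the tuple of exponents of a monomial.\<close>

definition poly_fun_upto :: "nat \<Rightarrow> (real^'n \<Rightarrow> real) \<Rightarrow> bool" where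
  "poly_fun_upto d p \<longleftrightarrow>
     (\<exists>c :: ('n \<Rightarrow> nat) \<Rightarrow> real.
        p = (\<lambda>x. \<Sum>e | (\<Sum>i\<in>UNIV. e i) \<le> d. c e * (\<Prod>i\<in>UNIV. (x $ i) ^ e i)))"

text \<open>Normalized surface measure of the unit sphere, as the normalized cone measure: the measure of
  \<open>A\<close> is the proportion of the unit ball lying over \<open>A\<close>, i.e. the image of the uniform
  distribution on the ball under radial projection.\<close>

definition sphere_measure :: "(real^'n) measure" where
  "sphere_measure = distr (uniform_measure lborel (ball 0 1)) borel (\<lambda>x. x /\<^sub>R norm x)"

definition spherical_design :: "nat \<Rightarrow> (real^'n) set \<Rightarrow> bool" where
  "spherical_design d C \<longleftrightarrow> spherical_code C \<and>
     (\<forall>p. poly_fun_upto d p \<longrightarrow>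
        (\<Sum>x\<in>C. p x) / real (card C) = integral\<^sup>L sphere_measure p)"

text \<open>For nonempty \<open>C\<close> this contains distance invariance: the same list \<open>ds\<close> of frequencies, in
  increasing order of the inner products, is obtained from every point.\<close>

definition has_distance_distribution :: "'a::euclidean_space set \<Rightarrow> nat list \<Rightarrow> bool" where
  "has_distance_distribution C ds \<longleftrightarrow>
     (\<forall>x\<in>C. map (\<lambda>t. card {y \<in> C. x \<bullet> y = t}) (sorted_list_of_set (inner_products C)) = ds)"

section \<open>Potentials and energy\<close>

text \<open>A potential is a function on \<open>[-1,1)\<close>; values of \<open>h\<close> elsewhere are never used.\<close>

definition absolutely_monotone :: "(real \<Rightarrow> real) \<Rightarrow> bool" where
  "absolutely_monotone h \<longleftrightarrow>
     continuous_on {-1..<1} h \<and>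
     (\<forall>j. \<forall>t\<in>{-1<..<1}. (deriv ^^ j) h differentiable (at t)) \<and>
     (\<forall>j\<ge>1. \<forall>t\<in>{-1<..<1}. (deriv ^^ j) h t \<ge> 0)"

definition energy :: "(real \<Rightarrow> real) \<Rightarrow> 'a::euclidean_space set \<Rightarrow> real" where
  "energy h C = (\<Sum>x\<in>C. \<Sum>y\<in>C - {x}. h (x \<bullet> y))"

text \<open>\<open>min_energy TYPE('n) h N T\<close> is the minimal \<open>h\<close>-energy over \<open>T\<close>-avoiding codes of
  \<open>N\<close> points on the unit sphere of \<open>real^'n\<close>; \<open>LEAST\<close> denotes an attained minimum.\<close>

definition min_energy :: "'n::finite itself \<Rightarrow> (real \<Rightarrow> real) \<Rightarrow> nat \<Rightarrow> real set \<Rightarrow> real" where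
  "min_energy _ h N T =
     (LEAST e. \<exists>C :: (real^'n) set.
        spherical_code C \<and> avoiding T C \<and> card C = N \<and> e = energy h C)"

definition avoiding_universally_optimal :: "real set \<Rightarrow> 'a::euclidean_space set \<Rightarrow> bool" where
  "avoiding_universally_optimal T C \<longleftrightarrow>
     spherical_code C \<and> avoiding T C \<and>
     (\<forall>h. absolutely_monotone h \<longrightarrow>
        (\<forall>D :: 'a set. spherical_code D \<and> avoiding T D \<and> card D = card C \<longrightarrow>
           energy h C \<le> energy h D))"

definition potential :: "(real \<Rightarrow> real) \<Rightarrow> 'a::euclidean_space set \<Rightarrow> 'a \<Rightarrow> real" where
  "potential h C u = (\<Sum>y\<in>C. h (u \<bullet> y))"

section \<open>The Leech lattice\<close>

text \<open>The coordinates are labelled by the projective line over the field with 23 elements, the label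
  \<open>23 :: 24\<close> being the point at infinity. The extended binary Golay code is spanned by the
  all-ones word and the cyclic shifts of the word supported on 0 and the quadratic non-residues
  modulo 23 (an extended quadratic residue code); words are identified with their supports.\<close>

definition golay_generators :: "24 set set" where
  "golay_generators = insert UNIV
     {(\<lambda>n. of_nat ((n + i) mod 23)) ` {0, 5, 7, 10, 11, 14, 15, 17, 19, 20, 21, 22} | i. i < 23}"

inductive_set golay :: "24 set set" where
  golay_empty: "{} \<in> golay"
| golay_add: "S \<in> golay \<Longrightarrow> G \<in> golay_generators \<Longrightarrow> sym_diff S G \<in> golay"

definition leech_lattice :: "(real^24) set" where
  "leech_lattice = {v. \<exists>(z :: 24 \<Rightarrow> int) (m :: int).
     (\<forall>i. v $ i = of_int (z i) / sqrt 8) \<and>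
     (\<forall>i. [z i = m] (mod 2)) \<and>
     [(\<Sum>i\<in>UNIV. z i) = 4 * m] (mod 8) \<and>
     (\<forall>k. {i. [z i = k] (mod 4)} \<in> golay)}"

definition minimal_vectors :: "'a::euclidean_space set \<Rightarrow> 'a set" where
  "minimal_vectors \<Lambda> = {v \<in> \<Lambda> - {0}. \<forall>u\<in>\<Lambda> - {0}. norm v \<le> norm u}"

definition leech_code :: "(real^24) set" where
  "leech_code = (\<lambda>v. v /\<^sub>R norm v) ` minimal_vectors leech_lattice"

section \<open>The code with 2025 points\<close>

definition derived_code :: "'a::euclidean_space set \<Rightarrow> 'a \<Rightarrow> real \<Rightarrow> 'a set" where
  "derived_code C x a = {(y - a *\<^sub>R x) /\<^sub>R sqrt (1 - a\<^sup>2) | y. y \<in> C \<and> x \<bullet> y = a}"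

definition half_code :: "real^24 \<Rightarrow> (real^24) set" where
  "half_code x = derived_code leech_code x (1/2)"

text \<open>Global minima of the potential of a code \<open>C\<close> on the unit sphere of the orthogonal complement
  of \<open>x\<close>. No single \<open>h\<close> is distinguished (and for polynomials of low degree the potential of a
  design is constant), so \<open>w\<close> is to be a minimum for all absolutely monotone \<open>h\<close> at once.
  The potential involves only \<open>h\<close> on \<open>[-1,1)\<close> for points outside \<open>C\<close>. At the points of \<open>C\<close> it
  would be its limit in \<open>(-\<infinity>,\<infinity>]\<close>, so comparing outside \<open>C\<close> is no restriction.\<close>

definition universal_minimum :: "'a::euclidean_space set \<Rightarrow> 'a \<Rightarrow> 'a \<Rightarrow> bool" where
  "universal_minimum C x w \<longleftrightarrow>
     (let S = {u \<in> sphere 0 1. x \<bullet> u = 0} - C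
      in w \<in> S \<and> (\<forall>h. absolutely_monotone h \<longrightarrow> (\<forall>u\<in>S. potential h C w \<le> potential h C u)))"

text \<open>The code lies in the orthogonal complement of \<open>x\<close> and \<open>w\<close>, which is identified with
  \<open>real^22\<close> by a linear isometry \<open>f\<close>.\<close>

definition is_C2025 :: "(real^22) set \<Rightarrow> bool" where
  "is_C2025 C \<longleftrightarrow>
     (\<exists>x w (f :: real^22 \<Rightarrow> real^24).
        x \<in> leech_code \<and> universal_minimum (half_code x) x w \<and>
        linear f \<and> (\<forall>v. norm (f v) = norm v) \<and> range f = {v. x \<bullet> v = 0 \<and> w \<bullet> v = 0} \<and>
        f ` C = derived_code (half_code x) w (sqrt 5 / 15))"

end

theory Submission
  imports Defs "HOL-Probability.Probability_Measure"
begin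

text \<open>
Everything rests on linear programming. The Gegenbauer kernels are positive definite, so if a
polynomial with positive Gegenbauer coefficients vanishes at all inner products of a code that
attains the resulting bound on the cardinality, then the code is a design. This applies three times.
The Leech configuration has \<open>196560\<close> points (a count from the Golay code), so all its points
see the same distance distribution. The \<open>4600\<close> points at inner product \<open>1/2\<close> from one of them
form a \<open>7\<close>-design in dimension \<open>23\<close>. The \<open>2025\<close>-point code in dimension \<open>22\<close> then has
the required moments.

For a \<open>7\<close>-design, interpolating \<open>h\<close> doubly at the nodes \<open>\<plusminus>\<surd>5/5\<close>, \<open>\<plusminus>\<surd>5/15\<close> shows that the
universal minima of the potential are exactly the points having only these inner products with the
code. Such a point is the projection of a minimal vector at inner product \<open>1/4\<close> from the first one.

The energy bound interpolates \<open>h\<close> at \<open>-4/11, -1/44, 7/22\<close>, repeating the node \<open>7/22\<close> or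
\<open>-4/11\<close> that is not an endpoint of \<open>T\<close>: the remainder is nonnegative off \<open>T\<close>, and the Newton
basis polynomials have positive Gegenbauer coefficients.
\<close>

section \<open>Positive definiteness of Gegenbauer polynomials\<close>

text \<open>Of each code only the cardinality and the list of possible inner products enter;
  distance distributions are solved from moments afterwards. The numbers 330, 1232, 462 are the
  weights of a quadrature rule: together with weight 1 at the node 1 and the nodes -4/11, -1/44,
  7/22 they integrate cubics exactly against 2025 times the distribution of one coordinate on the
  sphere in dimension 22. Hence the bound for cubic potentials is an identity, and any energy splits
  into the claimed value, a Gegenbauer excess and an interpolation remainder, whose signs and zeros
  settle both the inequality and the case of equality. Two obstacles shape the rest. A potential is
  only continuous at -1, yet competing codes may contain antipodal points, so the sign of the
  interpolation error has to be carried to that endpoint without derivatives there. And the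
  definition of the 2025-point code asks for a minimum of all potentials at once, so such a point
  must be exhibited, while one strictly monotone test potential, \<open>exp\<close>, pins down the
  inner products of every such point.\<close>

text \<open>
Polynomials are represented by their coefficients as functions of the exponent tuple. The form
\<open>fischer k\<close> is the pairing \<open>p(\<partial>) q\<close> on degree \<open>k\<close>, for which multiplication by a
variable is adjoint to the derivative, and multiplication by \<open>|u|\<^sup>2\<close> to the Laplacian.
\<close>

definition mul_var :: "'n \<Rightarrow> (('n \<Rightarrow> nat) \<Rightarrow> real) \<Rightarrow> ('n \<Rightarrow> nat) \<Rightarrow> real" where
  "mul_var i p e = (if e i = 0 then 0 else p (e(i := e i - 1)))"

definition part_deriv :: "'n \<Rightarrow> (('n \<Rightarrow> nat) \<Rightarrow> real) \<Rightarrow> ('n \<Rightarrow> nat) \<Rightarrow> real" where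
  "part_deriv i p e = real (e i + 1) * p (e(i := e i + 1))"

definition fischer :: "nat \<Rightarrow> (('n::finite \<Rightarrow> nat) \<Rightarrow> real) \<Rightarrow> (('n \<Rightarrow> nat) \<Rightarrow> real) \<Rightarrow> real" where
  "fischer k p q = (\<Sum>e | sum e UNIV = k. (\<Prod>i\<in>UNIV. fact (e i)) * p e * q e)"

definition homog :: "nat \<Rightarrow> (('n::finite \<Rightarrow> nat) \<Rightarrow> real) \<Rightarrow> bool" where
  "homog k p \<longleftrightarrow> (\<forall>e. p e \<noteq> 0 \<longrightarrow> sum e UNIV = k)"

definition laplacian :: "(('n::finite \<Rightarrow> nat) \<Rightarrow> real) \<Rightarrow> ('n \<Rightarrow> nat) \<Rightarrow> real" where
  "laplacian p e = (\<Sum>i\<in>UNIV. part_deriv i (part_deriv i p) e)"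

definition mul_sq :: "(('n::finite \<Rightarrow> nat) \<Rightarrow> real) \<Rightarrow> ('n \<Rightarrow> nat) \<Rightarrow> real" where
  "mul_sq p e = (\<Sum>i\<in>UNIV. mul_var i (mul_var i p) e)"

definition mul_lin :: "real^'n \<Rightarrow> (('n::finite \<Rightarrow> nat) \<Rightarrow> real) \<Rightarrow> ('n \<Rightarrow> nat) \<Rightarrow> real" where
  "mul_lin x p e = (\<Sum>i\<in>UNIV. x $ i * mul_var i p e)"

primrec lin_pow :: "real^'n \<Rightarrow> nat \<Rightarrow> ('n::finite \<Rightarrow> nat) \<Rightarrow> real" where
  "lin_pow x 0 = (\<lambda>e. if e = (\<lambda>_. 0) then 1 else 0)"
| "lin_pow x (Suc k) = mul_lin x (lin_pow x k)"

section \<open>Calculus with the Fischer form\<close>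

lemma finite_exponents: "finite {e :: 'n::finite \<Rightarrow> nat. sum e UNIV = k}"
proof (rule finite_subset)
  show "{e :: 'n \<Rightarrow> nat. sum e UNIV = k} \<subseteq> (\<Pi>\<^sub>E i\<in>UNIV. {..k})"
    by (auto simp: PiE_UNIV_domain intro: member_le_sum)
qed (auto intro: finite_PiE)

lemma fischer_sum_left:
  "fischer k (\<lambda>e. \<Sum>x\<in>A. c x * p x e) q = (\<Sum>x\<in>A. c x * fischer k (p x) q)"
proof -
  have "(\<Prod>i\<in>UNIV. fact (e i)) * (\<Sum>x\<in>A. c x * p x e) * q e
      = (\<Sum>x\<in>A. c x * ((\<Prod>i\<in>UNIV. fact (e i)) * p x e * q e))" for e
    by (simp add: sum_distrib_left sum_distrib_right mult_ac)
  then show ?thesis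
    unfolding fischer_def sum_distrib_left by (simp only: sum.swap[of _ A])
qed

lemma fischer_commute: "fischer k p q = fischer k q p"
  unfolding fischer_def by (rule sum.cong) (simp_all add: mult_ac)

lemma fischer_self_nonneg: "fischer k p p \<ge> 0"
  unfolding fischer_def mult.assoc
  by (intro sum_nonneg mult_nonneg_nonneg[of "prod _ _"] prod_nonneg) auto

lemma sum_exponent_upd:
  fixes e :: "'n::finite \<Rightarrow> nat"
  shows "sum (e(i := m)) UNIV + e i = sum e UNIV + m"
proof -
  have "sum (e(i := m)) (UNIV - {i}) = sum e (UNIV - {i})" by (rule sum.cong) auto
  then show ?thesis by (simp add: sum.remove[of UNIV i])
qed

lemma prod_fact_upd:
  fixes e :: "'n::finite \<Rightarrow> nat"
  shows "(\<Prod>j\<in>UNIV. fact ((e(i := Suc (e i))) j) :: real) = real (Suc (e i)) * (\<Prod>j\<in>UNIV. fact (e j))"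
proof -
  have "(\<Prod>j\<in>UNIV - {i}. fact ((e(i := Suc (e i))) j) :: real) = (\<Prod>j\<in>UNIV - {i}. fact (e j))"
    by (rule prod.cong) auto
  then show ?thesis by (simp add: prod.remove[of UNIV i] algebra_simps)
qed

text \<open>The factorial weights are made for this: raising the \<open>i\<close>-th exponent
  multiplies the weight by the new exponent, which is the factor that \<open>part_deriv\<close>
  produces. Terms with \<open>e i = 0\<close> vanish on the left; the others are reindexed by
  lowering that exponent.\<close>

lemma fischer_mul_var: "fischer (Suc k) (mul_var i p) q = fischer k p (part_deriv i q)"
proof -
  let ?w = "\<lambda>e. (\<Prod>j\<in>UNIV. fact (e j) :: real)"
  have "fischer (Suc k) (mul_var i p) q
      = (\<Sum>e | sum e UNIV = Suc k \<and> e i \<noteq> 0. ?w e * p (e(i := e i - 1)) * q e)"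
    unfolding fischer_def
    by (rule sum.mono_neutral_cong_right) (auto simp: mul_var_def finite_exponents)
  also have "\<dots> = (\<Sum>e | sum e UNIV = k. ?w e * p e * part_deriv i q e)"
  proof (rule sum.reindex_bij_witness[of _ "\<lambda>e. e(i := Suc (e i))" "\<lambda>e. e(i := e i - 1)"], goal_cases)
    case (2 e) then show ?case using sum_exponent_upd[of e i "e i - 1"] by auto
  next
    case (4 e) then show ?case using sum_exponent_upd[of e i "Suc (e i)"] by auto
  next
    case (5 e)
    define e' where "e' = e(i := e i - 1)"
    have e: "e = e'(i := Suc (e' i))" using 5 by (auto simp: e'_def)
    show ?case unfolding e'_def[symmetric] part_deriv_def
      unfolding e prod_fact_upd by (simp add: algebra_simps)
  qed auto
  finally show ?thesis by (simp add: fischer_def)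
qed

lemma fischer_mul_sq: "fischer (Suc (Suc k)) (mul_sq p) q = fischer k p (laplacian q)"
proof -
  have "fischer (Suc (Suc k)) (mul_sq p) q = (\<Sum>i\<in>UNIV. fischer (Suc (Suc k)) (mul_var i (mul_var i p)) q)"
    using fischer_sum_left[where k = "Suc (Suc k)" and A = UNIV and c = "\<lambda>_. 1" and p = "\<lambda>i. mul_var i (mul_var i p)" and q = q]
    by (simp add: mul_sq_def[abs_def])
  also have "\<dots> = (\<Sum>i\<in>UNIV. fischer k p (part_deriv i (part_deriv i q)))"
    by (simp add: fischer_mul_var)
  also have "\<dots> = fischer k p (laplacian q)"
    using fischer_sum_left[where k = k and A = UNIV and c = "\<lambda>_. 1" and p = "\<lambda>i. part_deriv i (part_deriv i q)" and q = p]
    by (simp add: laplacian_def[abs_def] fischer_commute[of k p])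
  finally show ?thesis .
qed

lemma fischer_mul_lin: "fischer (Suc k) (mul_lin x p) q = (\<Sum>i\<in>UNIV. x $ i * fischer k p (part_deriv i q))"
  unfolding mul_lin_def[abs_def] by (simp add: fischer_sum_left fischer_mul_var)

lemma fischer_cmult_left: "fischer k (\<lambda>e. a * p e) q = a * fischer k p q"
  by (simp add: fischer_def sum_distrib_left algebra_simps)

lemma fischer_cmult_right: "fischer k p (\<lambda>e. a * q e) = a * fischer k p q"
  by (simp add: fischer_def sum_distrib_left algebra_simps)

text \<open>The canonical commutation relation of the Weyl algebra, read off
  coefficientwise.\<close>

lemma part_deriv_mul_var:
  "part_deriv i (mul_var j p) e = mul_var j (part_deriv i p) e + (if i = j then p e else 0)"
  by (auto simp: part_deriv_def mul_var_def fun_upd_twist fun_upd_idem algebra_simps of_nat_diff)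

lemma part_deriv_cmult: "part_deriv i (\<lambda>e. a * p e) e = a * part_deriv i p e"
  by (simp add: part_deriv_def)

lemma mul_var_cmult: "mul_var i (\<lambda>e. a * p e) e = a * mul_var i p e"
  by (simp add: mul_var_def)

lemma mul_lin_cmult: "mul_lin x (\<lambda>e. a * p e) e = a * mul_lin x p e"
  by (simp add: mul_lin_def mul_var_cmult sum_distrib_left algebra_simps)

lemma part_deriv_mul_lin:
  "part_deriv i (mul_lin x p) e = mul_lin x (part_deriv i p) e + x $ i * p e"
proof -
  have "part_deriv i (mul_lin x p) e = (\<Sum>j\<in>UNIV. x $ j * part_deriv i (mul_var j p) e)"
    by (simp add: part_deriv_def mul_lin_def sum_distrib_left algebra_simps)
  also have "\<dots> = (\<Sum>j\<in>UNIV. x $ j * mul_var j (part_deriv i p) e + (if i = j then x $ j * p e else 0))"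
    by (rule sum.cong) (auto simp: part_deriv_mul_var algebra_simps)
  finally show ?thesis by (simp add: sum.distrib mul_lin_def)
qed

lemma part_deriv_lin_pow_0: "part_deriv i (lin_pow x 0) = (\<lambda>e. 0)"
  by (auto simp: part_deriv_def fun_eq_iff) 

lemma part_deriv_lin_pow:
  "part_deriv i (lin_pow x (Suc k)) = (\<lambda>e. real (Suc k) * x $ i * lin_pow x k e)"
proof (induction k)
  case 0
  have "mul_lin x (\<lambda>e. 0) e = 0" for e by (simp add: mul_lin_def mul_var_def)
  then show ?case
    by (simp add: fun_eq_iff part_deriv_mul_lin part_deriv_lin_pow_0 del: lin_pow.simps(1))
next
  case (Suc k)
  show ?case
    by (subst lin_pow.simps, rule ext, subst part_deriv_mul_lin, subst Suc, subst mul_lin_cmult)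
       (simp add: algebra_simps)
qed

lemma laplacian_lin_pow:
  "laplacian (lin_pow x (Suc (Suc k))) = (\<lambda>e. real (Suc (Suc k)) * real (Suc k) * (x \<bullet> x) * lin_pow x k e)"
proof
  fix e
  have "part_deriv i (part_deriv i (lin_pow x (Suc (Suc k)))) e
     = real (Suc (Suc k)) * real (Suc k) * (x $ i * x $ i) * lin_pow x k e" for i
    by (subst part_deriv_lin_pow, subst part_deriv_cmult, subst part_deriv_lin_pow) (simp add: algebra_simps)
  then show "laplacian (lin_pow x (Suc (Suc k))) e
     = real (Suc (Suc k)) * real (Suc k) * (x \<bullet> x) * lin_pow x k e"
    by (simp only: laplacian_def inner_vec_def inner_real_def sum_distrib_left sum_distrib_right)
qed

lemma laplacian_lin_pow_low: "k < 2 \<Longrightarrow> laplacian (lin_pow x k) = (\<lambda>e. 0)"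
proof -
  assume "k < 2"
  then consider "k = 0" | "k = Suc 0" by linarith
  then show ?thesis
  proof cases
    case 1 then show ?thesis
      by (auto simp: laplacian_def fun_eq_iff part_deriv_lin_pow_0 simp del: lin_pow.simps)
         (simp add: part_deriv_def)
  next
    case 2 then show ?thesis
      by (auto simp: laplacian_def fun_eq_iff part_deriv_lin_pow part_deriv_cmult
           part_deriv_lin_pow_0 simp del: lin_pow.simps)
  qed
qed

lemma fischer_lin_pow: "fischer k (lin_pow x k) (lin_pow y k) = fact k * (x \<bullet> y) ^ k"
proof (induction k)
  case 0
  have "{e :: 'a \<Rightarrow> nat. \<forall>i. e i = 0} = {\<lambda>_. 0}" by auto
  then show ?case by (simp add: fischer_def)
next
  case (Suc k)
  have "fischer (Suc k) (lin_pow x (Suc k)) (lin_pow y (Suc k))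
      = (\<Sum>i\<in>UNIV. x $ i * fischer k (lin_pow x k) (part_deriv i (lin_pow y (Suc k))))"
    by (simp add: fischer_mul_lin del: lin_pow.simps(2) add: lin_pow.simps(2)[of x])
  also have "\<dots> = (\<Sum>i\<in>UNIV. x $ i * (real (Suc k) * y $ i * fischer k (lin_pow y k) (lin_pow x k)))"
    by (subst fischer_commute, subst part_deriv_lin_pow, subst fischer_cmult_left) (rule refl)
  also have "\<dots> = real (Suc k) * (x \<bullet> y) * (fact k * (x \<bullet> y) ^ k)"
    by (simp add: fischer_commute[of k "lin_pow y k"] Suc inner_vec_def sum_distrib_left sum_distrib_right
        algebra_simps)
  finally show ?case by (simp add: algebra_simps)
qed

text \<open>The commutator of the Laplacian with multiplication by \<open>|u|\<^sup>2\<close> is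
  four times the Euler operator plus twice the dimension. Each variable contributes
  \<open>4 * e i + 2\<close>, and homogeneity turns the sum of the exponents into
  \<open>d\<close>.\<close>

lemma laplacian_mul_sq:
  fixes p :: "('n::finite \<Rightarrow> nat) \<Rightarrow> real"
  assumes "homog d p"
  shows "laplacian (mul_sq p) e = mul_sq (laplacian p) e + (4 * real d + 2 * real CARD('n)) * p e"
proof -
  have lin1: "part_deriv i (part_deriv i (mul_sq p)) e = (\<Sum>j\<in>UNIV. part_deriv i (part_deriv i (mul_var j (mul_var j p))) e)" for i
    by (simp add: part_deriv_def mul_sq_def sum_distrib_left)
  have lin2: "mul_var j (mul_var j (laplacian p)) e = (\<Sum>i\<in>UNIV. mul_var j (mul_var j (part_deriv i (part_deriv i p))) e)" for j
    by (simp add: mul_var_def laplacian_def)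
  have comm: "part_deriv i (part_deriv i (mul_var j (mul_var j p))) e
      = mul_var j (mul_var j (part_deriv i (part_deriv i p))) e + (if i = j then (4 * real (e i) + 2) * p e else 0)" for i j
  proof (cases "i = j")
    case True
    \<comment> \<open>For exponents 0 and 1 the double multiplication on the right falls into the
      default value 0 of \<open>mul_var\<close>, and the commutator term alone accounts for the left
      side.\<close>
    consider "e i = 0" | "e i = 1" | n where "e i = Suc (Suc n)"
      by (metis One_nat_def not0_implies_Suc)
    then show ?thesis
      by cases (auto simp: True part_deriv_def mul_var_def fun_upd_idem algebra_simps)
  qed (auto simp: part_deriv_def mul_var_def fun_upd_twist)
  have "laplacian (mul_sq p) e = (\<Sum>i\<in>UNIV. \<Sum>j\<in>UNIV. mul_var j (mul_var j (part_deriv i (part_deriv i p))) e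
      + (if i = j then (4 * real (e i) + 2) * p e else 0))"
    by (simp add: laplacian_def lin1 comm)
  also have "\<dots> = mul_sq (laplacian p) e + (\<Sum>i\<in>UNIV. (4 * real (e i) + 2) * p e)"
    by (simp add: mul_sq_def lin2 sum.distrib) (subst sum.swap, rule refl)
  also have "(\<Sum>i\<in>UNIV. (4 * real (e i) + 2) * p e) = (4 * real (sum e UNIV) + 2 * real CARD('n)) * p e"
    by (simp add: sum_distrib_right[symmetric] sum.distrib sum_distrib_left)
  also have "\<dots> = (4 * real d + 2 * real CARD('n)) * p e"
    using assms by (cases "p e = 0") (auto simp: homog_def)
  finally show ?thesis .
qed

lemma homog_mul_var: assumes "homog d p" shows "homog (Suc d) (mul_var i p)"
  unfolding homog_def
proof (intro allI impI)
  fix e assume "mul_var i p e \<noteq> 0"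
  then have "e i \<noteq> 0" "p (e(i := e i - 1)) \<noteq> 0" by (auto simp: mul_var_def split: if_splits)
  then show "sum e UNIV = Suc d"
    using assms sum_exponent_upd[of e i "e i - 1"] by (auto simp: homog_def)
qed

lemma homog_sum: assumes "\<And>i. i \<in> A \<Longrightarrow> homog d (p i)" shows "homog d (\<lambda>e. \<Sum>i\<in>A. c i * p i e)"
  unfolding homog_def
proof (intro allI impI)
  fix e assume "(\<Sum>i\<in>A. c i * p i e) \<noteq> 0"
  then obtain i where "i \<in> A" "c i * p i e \<noteq> 0" by (rule sum.not_neutral_contains_not_neutral)
  then show "sum e UNIV = d" using assms by (auto simp: homog_def)
qed

lemma homog_lin_pow: "homog k (lin_pow x k)"
proof (induction k)
  case 0 show ?case by (auto simp: homog_def)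
next
  case (Suc k)
  then show ?case
    unfolding lin_pow.simps mul_lin_def[abs_def] by (intro homog_sum homog_mul_var)
qed

lemma homog_mul_sq: "homog d p \<Longrightarrow> homog (Suc (Suc d)) (mul_sq p)"
  using homog_sum[OF homog_mul_var[OF homog_mul_var], where c = "\<lambda>_. 1"]
  by (simp add: mul_sq_def[abs_def])

lemma homog_mul_sq_pow: "homog (2 * j + k) ((mul_sq ^^ j) (lin_pow x k))"
  by (induction j) (auto simp: homog_lin_pow homog_mul_sq)

lemma mul_sq_cmult: "mul_sq (\<lambda>e. a * p e) = (\<lambda>e. a * mul_sq p e)"
  by (auto simp: mul_sq_def mul_var_def sum_distrib_left fun_eq_iff intro!: sum.cong)

lemma mul_sq_add: "mul_sq (\<lambda>e. p e + q e) = (\<lambda>e. mul_sq p e + mul_sq q e)"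
  by (auto simp: mul_sq_def mul_var_def sum.distrib[symmetric] fun_eq_iff intro!: sum.cong)

text \<open>The truncated subtractions \<open>k - 2\<close> and \<open>j - 1\<close> are harmless,
  because the terms containing them carry the factors \<open>k (k - 1)\<close> and
  \<open>j\<close>.\<close>

lemma laplacian_mul_sq_pow:
  fixes x :: "real^'n"
  assumes "norm x = 1"
  shows "laplacian ((mul_sq ^^ j) (lin_pow x k)) = (\<lambda>e.
     real k * (real k - 1) * (mul_sq ^^ j) (lin_pow x (k - 2)) e
     + 2 * real j * (2 * real j - 2 + 2 * real k + real CARD('n)) * (mul_sq ^^ (j - 1)) (lin_pow x k) e)"
proof (induction j)
  case 0
  show ?case
  proof (cases "k < 2")
    case True then show ?thesis by (cases k) (auto simp: laplacian_lin_pow_low simp del: lin_pow.simps)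
  next
    case False
    then obtain m where "k = Suc (Suc m)" by (metis add_2_eq_Suc le_Suc_ex not_less)
    then show ?thesis using assms
      by (simp add: laplacian_lin_pow norm_eq_1 algebra_simps del: lin_pow.simps)
  qed
next
  case (Suc j)
  have 1: "laplacian (mul_sq ((mul_sq ^^ j) (lin_pow x k))) e = mul_sq (laplacian ((mul_sq ^^ j) (lin_pow x k))) e
     + (4 * real (2 * j + k) + 2 * real CARD('n)) * (mul_sq ^^ j) (lin_pow x k) e" for e
    by (rule laplacian_mul_sq[OF homog_mul_sq_pow])
  show ?case
  proof
    fix e
    have 2: "mul_sq (laplacian ((mul_sq ^^ j) (lin_pow x k))) e
       = real k * (real k - 1) * (mul_sq ^^ Suc j) (lin_pow x (k - 2)) e
       + 2 * real j * (2 * real j - 2 + 2 * real k + real CARD('n)) * mul_sq ((mul_sq ^^ (j - 1)) (lin_pow x k)) e"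
      by (simp add: Suc mul_sq_add mul_sq_cmult)
    show "laplacian ((mul_sq ^^ Suc j) (lin_pow x k)) e
       = real k * (real k - 1) * (mul_sq ^^ Suc j) (lin_pow x (k - 2)) e
       + 2 * real (Suc j) * (2 * real (Suc j) - 2 + 2 * real k + real CARD('n)) * (mul_sq ^^ (Suc j - 1)) (lin_pow x k) e"
      unfolding funpow.simps o_apply 1 2 by (cases j) (simp_all add: algebra_simps)
  qed
qed

text \<open>Coefficients of the monic Gegenbauer polynomial of degree \<open>k\<close> on the sphere
  in dimension \<open>n\<close>. The recursion is the condition that consecutive terms in the
  Laplacian of \<open>zonal\<close> cancel.\<close>

primrec gegen_coeff :: "nat \<Rightarrow> nat \<Rightarrow> nat \<Rightarrow> real" where
  "gegen_coeff n k 0 = 1"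
| "gegen_coeff n k (Suc j) = - gegen_coeff n k j * (real k - 2 * real j) * (real k - 2 * real j - 1)
     / (2 * (real j + 1) * (2 * real k - 2 * real j - 4 + real n))"

definition gegenbauer :: "nat \<Rightarrow> nat \<Rightarrow> real \<Rightarrow> real" where
  "gegenbauer n k t = (\<Sum>j\<le>k div 2. gegen_coeff n k j * t ^ (k - 2 * j))"

text \<open>For a unit vector \<open>x\<close> this is the harmonic part of \<open>(x \<bullet> u) ^ k\<close>.\<close>

definition zonal :: "real^'n \<Rightarrow> nat \<Rightarrow> ('n::finite \<Rightarrow> nat) \<Rightarrow> real" where
  "zonal x k e = (\<Sum>j\<le>k div 2. gegen_coeff CARD('n) k j * (mul_sq ^^ j) (lin_pow x (k - 2 * j)) e)"

lemma laplacian_sum: "laplacian (\<lambda>e. \<Sum>j\<in>A. c j * p j e) e = (\<Sum>j\<in>A. c j * laplacian (p j) e)"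
  unfolding laplacian_def part_deriv_def sum_distrib_left
  by (subst sum.swap) (simp add: algebra_simps)

text \<open>A telescoping sum: the Laplacian of the \<open>j\<close>-th term is
  \<open>A j + B j\<close>, and the recursion for the coefficients says
  \<open>B (Suc j) = - A j\<close>. The two ends vanish by themselves: \<open>B 0\<close> has the
  factor \<open>j = 0\<close>, and \<open>A m\<close> has the factors \<open>k - 2 m\<close> and
  \<open>k - 2 m - 1\<close>, one of which is zero.\<close>

lemma laplacian_zonal:
  fixes x :: "real^'n::finite"
  assumes "norm x = 1"
  shows "laplacian (zonal x k) = (\<lambda>e. 0)"
proof
  fix e
  define m where "m = k div 2"
  let ?b = "gegen_coeff CARD('n) k"
  define A where "A j = ?b j * (real k - 2 * real j) * (real k - 2 * real j - 1)
     * (mul_sq ^^ j) (lin_pow x (k - 2 * Suc j)) e" for j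
  define B where "B j = ?b j * (2 * real j * (2 * real j - 2 + 2 * real (k - 2 * j) + real CARD('n)))
     * (mul_sq ^^ (j - 1)) (lin_pow x (k - 2 * j)) e" for j
  have le: "2 * j \<le> k" if "j \<le> m" for j using that by (auto simp: m_def)
  have "laplacian (zonal x k) e
      = (\<Sum>j\<le>m. ?b j * laplacian ((mul_sq ^^ j) (lin_pow x (k - 2 * j))) e)"
    by (simp add: zonal_def[abs_def] laplacian_sum m_def)
  also have "\<dots> = (\<Sum>j\<le>m. A j + B j)"
  proof (rule sum.cong)
    fix j assume "j \<in> {..m}"
    then have "real (k - 2 * j) = real k - 2 * real j" using le[of j] by (simp add: of_nat_diff)
    moreover have "k - 2 * j - 2 = k - 2 * Suc j" by simp
    ultimately show "?b j * laplacian ((mul_sq ^^ j) (lin_pow x (k - 2 * j))) e = A j + B j"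
      unfolding A_def B_def laplacian_mul_sq_pow[OF assms] by (simp add: algebra_simps)
  qed simp
  also have "\<dots> = (\<Sum>j\<le>m. A j) + (\<Sum>j\<in>{..m}. B j)" by (simp add: sum.distrib)
  also have "(\<Sum>j\<in>{..m}. B j) = B 0 + (\<Sum>j<m. B (Suc j))"
    by (rule sum.atMost_shift)
  also have "(\<Sum>j<m. B (Suc j)) = (\<Sum>j<m. - A j)"
  proof (rule sum.cong)
    fix j assume "j \<in> {..<m}"
    then have le': "2 * Suc j \<le> k" by (intro le) auto
    then have k: "real (k - 2 * Suc j) = real k - 2 * real j - 2" by (subst of_nat_diff) auto
    define d where "d = 2 * real k - 2 * real j - 4 + real CARD('n)"
    have "real CARD('n) > 0" by simp
    moreover have "real k \<ge> 2 * real j + 2" using of_nat_mono[OF le', where 'a = real] by simp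
    ultimately have "d > 0" unfolding d_def by linarith
    then have "?b (Suc j) * (2 * real (Suc j) * d) = - ?b j * (real k - 2 * real j) * (real k - 2 * real j - 1)"
    proof -
      have *: "?b (Suc j) = - ?b j * (real k - 2 * real j) * (real k - 2 * real j - 1) / (2 * (real j + 1) * d)"
        by (simp only: gegen_coeff.simps d_def)
      have "2 * (real j + 1) * d \<noteq> 0" using \<open>d > 0\<close> by simp
      from nonzero_eq_divide_eq[THEN iffD1, OF this *]
      have "?b (Suc j) * (2 * (real j + 1) * d) = - ?b j * (real k - 2 * real j) * (real k - 2 * real j - 1)" .
      then show ?thesis by (simp add: add.commute)
    qed
    moreover have "2 * real (Suc j) - 2 + 2 * real (k - 2 * Suc j) + real CARD('n) = d"
      by (subst k) (simp add: d_def)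
    ultimately show "B (Suc j) = - A j" unfolding A_def B_def by simp
  qed simp
  also have "B 0 = 0" by (simp add: B_def)
  also have "(\<Sum>j\<le>m. A j) + (0 + (\<Sum>j<m. - A j)) = A m"
    by (simp add: sum_negf lessThan_Suc_atMost[symmetric])
  also have "A m = 0"
  proof -
    consider "k = 2 * m" | "k = 2 * m + 1" unfolding m_def by linarith
    then show ?thesis by cases (auto simp: A_def)
  qed
  finally show "laplacian (zonal x k) e = 0" .
qed

lemma fischer_mul_sq_pow_lin_pow:
  assumes "norm x = 1" "2 * j \<le> k"
  shows "fischer k ((mul_sq ^^ j) (lin_pow y (k - 2 * j))) (lin_pow x k) = fact k * (x \<bullet> y) ^ (k - 2 * j)"
  using assms(2)
proof (induction j arbitrary: k)
  case 0 then show ?case by (simp add: fischer_lin_pow inner_commute)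
next
  case (Suc j)
  then obtain k' where k: "k = Suc (Suc k')"
    by (intro that[of "k - 2"]) auto
  have "fischer k ((mul_sq ^^ Suc j) (lin_pow y (k - 2 * Suc j))) (lin_pow x k)
     = fischer k' ((mul_sq ^^ j) (lin_pow y (k' - 2 * j))) (laplacian (lin_pow x k))"
    by (simp add: k fischer_mul_sq del: lin_pow.simps)
  also have "\<dots> = real k * real (Suc k') * fischer k' ((mul_sq ^^ j) (lin_pow y (k' - 2 * j))) (lin_pow x k')"
    using assms(1)
    by (simp add: k laplacian_lin_pow fischer_cmult_right norm_eq_1 del: lin_pow.simps of_nat_Suc)
  also have "\<dots> = fact k * (x \<bullet> y) ^ (k - 2 * Suc j)"
    using Suc by (simp add: k algebra_simps)
  finally show ?case .
qed

lemma fischer_zonal: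
  fixes x y :: "real^'n::finite"
  assumes x: "norm x = 1" and y: "norm y = 1"
  shows "fischer k (zonal x k) (zonal y k) = fact k * gegenbauer CARD('n) k (x \<bullet> y)"
proof -
  let ?b = "gegen_coeff CARD('n) k"
  have "fischer k (zonal x k) (zonal y k)
     = (\<Sum>j\<le>k div 2. ?b j * fischer k ((mul_sq ^^ j) (lin_pow x (k - 2 * j))) (zonal y k))"
    unfolding zonal_def[of x, abs_def] by (rule fischer_sum_left)
  \<comment> \<open>Every term with \<open>j > 0\<close> is a multiple of
    \<open>|u|\<^sup>2\<close>; moving that factor across the pairing applies the Laplacian to the
    harmonic \<open>zonal y k\<close>. Only the pure power \<open>lin_pow x k\<close>
    survives.\<close>
  also have "\<dots> = (\<Sum>j\<in>{0}. ?b j * fischer k ((mul_sq ^^ j) (lin_pow x (k - 2 * j))) (zonal y k))"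
  proof (rule sum.mono_neutral_right)
    show "\<forall>j\<in>{..k div 2} - {0}. ?b j * fischer k ((mul_sq ^^ j) (lin_pow x (k - 2 * j))) (zonal y k) = 0"
    proof
      fix j assume j: "j \<in> {..k div 2} - {0}"
      then obtain i where i: "j = Suc i" by (cases j) auto
      from j i have "k \<ge> 2" by auto
      then obtain k' where k: "k = Suc (Suc k')" by (intro that[of "k - 2"]) auto
      have "fischer k ((mul_sq ^^ j) (lin_pow x (k - 2 * j))) (zonal y k) = 0"
        unfolding i funpow.simps o_apply
        by (subst (1) k, subst fischer_mul_sq, subst laplacian_zonal[OF y]) (simp add: fischer_def)
      then show "?b j * fischer k ((mul_sq ^^ j) (lin_pow x (k - 2 * j))) (zonal y k) = 0" by simp
    qed
  qed auto
  also have "\<dots> = fischer k (zonal y k) (lin_pow x k)" by (simp add: fischer_commute)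
  also have "\<dots> = (\<Sum>j\<le>k div 2. ?b j * fischer k ((mul_sq ^^ j) (lin_pow y (k - 2 * j))) (lin_pow x k))"
    unfolding zonal_def[abs_def] by (rule fischer_sum_left)
  also have "\<dots> = (\<Sum>j\<le>k div 2. ?b j * (fact k * (x \<bullet> y) ^ (k - 2 * j)))"
    by (intro sum.cong refl) (subst fischer_mul_sq_pow_lin_pow[OF x], auto)
  finally show ?thesis by (simp add: gegenbauer_def sum_distrib_left algebra_simps)
qed

text \<open>The kernel is a Gram kernel: up to the factor \<open>fact k\<close>, the double sum is
  the Fischer square of the combination \<open>Z\<close> of zonal harmonics.\<close>

theorem gegenbauer_positive_definite:
  fixes S :: "(real^'n::finite) set"
  assumes "S \<subseteq> sphere 0 1"
  shows "(\<Sum>x\<in>S. \<Sum>y\<in>S. c x * c y * gegenbauer CARD('n) k (x \<bullet> y)) \<ge> 0"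
proof -
  define Z where "Z e = (\<Sum>x\<in>S. c x * zonal x k e)" for e
  have "fischer k Z Z = (\<Sum>x\<in>S. c x * fischer k Z (zonal x k))"
    by (subst (1) Z_def[abs_def], subst fischer_sum_left) (simp add: fischer_commute)
  also have "\<dots> = (\<Sum>x\<in>S. \<Sum>y\<in>S. c x * c y * fischer k (zonal y k) (zonal x k))"
    unfolding Z_def[abs_def] fischer_sum_left by (simp add: sum_distrib_left mult.assoc)
  also have "\<dots> = (\<Sum>x\<in>S. \<Sum>y\<in>S. fact k * (c x * c y * gegenbauer CARD('n) k (x \<bullet> y)))"
  proof (intro sum.cong refl)
    fix x y assume "x \<in> S" "y \<in> S"
    then have "norm x = 1" "norm y = 1" using assms by (auto simp: subset_iff)
    then show "c x * c y * fischer k (zonal y k) (zonal x k) = fact k * (c x * c y * gegenbauer CARD('n) k (x \<bullet> y))"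
      by (simp add: fischer_zonal inner_commute)
  qed
  also have "\<dots> = fact k * (\<Sum>x\<in>S. \<Sum>y\<in>S. c x * c y * gegenbauer CARD('n) k (x \<bullet> y))"
    by (simp add: sum_distrib_left)
  finally have "fact k * (\<Sum>x\<in>S. \<Sum>y\<in>S. c x * c y * gegenbauer CARD('n) k (x \<bullet> y)) \<ge> 0"
    using fischer_self_nonneg[of k Z] by simp
  then show ?thesis by (auto simp: zero_le_mult_iff) (metis fact_gt_zero not_le)
qed

corollary gegenbauer_sum_nonneg:
  fixes C :: "(real^'n::finite) set"
  assumes "C \<subseteq> sphere 0 1"
  shows "(\<Sum>x\<in>C. \<Sum>y\<in>C. gegenbauer CARD('n) k (x \<bullet> y)) \<ge> 0"
  using gegenbauer_positive_definite[OF assms, of "\<lambda>_. 1" k] by simp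

lemma linear_term_zero:
  fixes s q :: real
  assumes "\<And>r. 2 * r * s + r\<^sup>2 * q \<ge> 0"
  shows "s = 0"
proof (rule ccontr)
  assume "s \<noteq> 0"
  define r where "r = - s / (1 + \<bar>q\<bar>)"
  have "r\<^sup>2 * q \<le> r\<^sup>2 * (1 + \<bar>q\<bar>)" by (intro mult_left_mono) auto
  also have "\<dots> = s\<^sup>2 / (1 + \<bar>q\<bar>)" by (simp add: r_def power2_eq_square)
  finally have "2 * r * s + r\<^sup>2 * q \<le> 2 * r * s + s\<^sup>2 / (1 + \<bar>q\<bar>)" by simp
  also have "\<dots> = - (s\<^sup>2 / (1 + \<bar>q\<bar>))" by (simp add: r_def power2_eq_square)
  also have "\<dots> < 0" using \<open>s \<noteq> 0\<close> by simp
  finally show False using assms[of r] by simp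
qed

text \<open>The uniform weight on \<open>C\<close> is perturbed by an extra weight \<open>r\<close>
  at \<open>u\<close>. The positive semidefinite form becomes a quadratic polynomial in
  \<open>r\<close> without constant term, so its linear coefficient vanishes. Since \<open>u\<close>
  may or may not lie in \<open>C\<close>, the two weights are added as functions on
  \<open>insert u C\<close>.\<close>

corollary gegenbauer_sum_zero:
  fixes C :: "(real^'n::finite) set"
  assumes C: "finite C" "C \<subseteq> sphere 0 1" and u: "norm u = 1"
    and zero: "(\<Sum>x\<in>C. \<Sum>y\<in>C. gegenbauer CARD('n) k (x \<bullet> y)) = 0"
  shows "(\<Sum>x\<in>C. gegenbauer CARD('n) k (x \<bullet> u)) = 0"
proof (rule linear_term_zero[where q = "gegenbauer CARD('n) k 1"])
  fix r :: real
  let ?G = "\<lambda>x y. gegenbauer CARD('n) k (x \<bullet> y)"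
  let ?i = "\<lambda>x. if x \<in> C then 1 else (0::real)" and ?d = "\<lambda>x. if x = u then r else 0"
  define S where "S = insert u C"
  have fin: "finite S" and uS: "u \<in> S" and CS: "C \<subseteq> S" using C by (auto simp: S_def)
  have 1: "(\<Sum>x\<in>S. ?i x * f x) = (\<Sum>x\<in>C. f x)" for f
    using fin CS by (intro sum.mono_neutral_cong_right) auto
  have 2: "(\<Sum>x\<in>S. ?d x * f x) = r * f u" for f
  proof -
    have "(\<Sum>x\<in>S. ?d x * f x) = (\<Sum>x\<in>S. if x = u then r * f u else 0)"
      by (rule sum.cong) auto
    then show ?thesis using fin uS by (simp add: sum.delta')
  qed
  have "0 \<le> (\<Sum>x\<in>S. \<Sum>y\<in>S. (?i x + ?d x) * (?i y + ?d y) * ?G x y)"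
    using C u by (intro gegenbauer_positive_definite) (auto simp: S_def)
  also have "\<dots> = (\<Sum>x\<in>S. (?i x + ?d x) * (\<Sum>y\<in>S. ?i y * ?G x y + ?d y * ?G x y))"
    by (simp only: sum_distrib_left mult.assoc distrib_right)
  also have "\<dots> = (\<Sum>x\<in>S. (?i x + ?d x) * ((\<Sum>y\<in>C. ?G x y) + r * ?G x u))"
    by (simp only: sum.distrib 1 2)
  also have "\<dots> = (\<Sum>x\<in>S. ?i x * ((\<Sum>y\<in>C. ?G x y) + r * ?G x u)) + (\<Sum>x\<in>S. ?d x * ((\<Sum>y\<in>C. ?G x y) + r * ?G x u))"
    by (simp only: distrib_right sum.distrib)
  also have "\<dots> = 2 * r * (\<Sum>x\<in>C. ?G x u) + r\<^sup>2 * ?G u u"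
  proof -
    have 3: "(\<Sum>x\<in>C. r * ?G x u) = r * (\<Sum>x\<in>C. ?G x u)" by (rule sum_distrib_left[symmetric])
    have 4: "(\<Sum>y\<in>C. ?G u y) = (\<Sum>x\<in>C. ?G x u)" by (simp only: inner_commute)
    show ?thesis unfolding 1 2 sum.distrib 3 4 zero by (simp add: power2_eq_square algebra_simps)
  qed
  finally show "0 \<le> 2 * r * (\<Sum>x\<in>C. ?G x u) + r\<^sup>2 * gegenbauer CARD('n) k 1"
    using u by (simp add: norm_eq_1)
qed

section \<open>Interpolation of absolutely monotone functions\<close>

text \<open>
The quotient \<open>(h t - h a) / (t - a)\<close> equals \<open>\<integral>\<^sub>0\<^sup>1 h' (a + s (t - a)) ds\<close> inside the interval, so it
inherits nonnegative derivatives from \<open>h\<close>, and Newton interpolation never leaves the class. At the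
endpoint \<open>-1\<close> only \<open>D 0\<close> is controlled, and signs there come from the mean value theorem.
\<close>

definition derivative_sequence :: "(nat \<Rightarrow> real \<Rightarrow> real) \<Rightarrow> bool" where
  "derivative_sequence D \<longleftrightarrow> continuous_on {-1..<1} (D 0) \<and>
     (\<forall>j. \<forall>t\<in>{-1<..<1}. (D j has_real_derivative D (Suc j) t) (at t))"

text \<open>For \<open>j = 0\<close> the quotient itself is kept instead of the integral: at -1
  nothing is known about \<open>D 1\<close>, whereas the quotient still makes sense there.\<close>

definition quotient_sequence :: "real \<Rightarrow> (nat \<Rightarrow> real \<Rightarrow> real) \<Rightarrow> nat \<Rightarrow> real \<Rightarrow> real" where
  "quotient_sequence a D j t =
     (if j = 0 then (if t = a then D 1 a else (D 0 t - D 0 a) / (t - a))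
      else integral {0..1} (\<lambda>s. s ^ j * D (Suc j) (a + s * (t - a))))"

lemma segment_in_interval:
  fixes a s t :: real
  assumes "a \<in> {-1<..<1}" "t \<in> {-1<..<1}" "s \<in> {0..1}"
  shows "a + s * (t - a) \<in> {-1<..<1}"
proof -
  have "(1 - s) *\<^sub>R a + s *\<^sub>R t \<in> {-1<..<1}"
    using assms by (intro convexD) auto
  then show ?thesis by (simp add: algebra_simps)
qed

lemma derivative_sequence_continuous:
  assumes "derivative_sequence D"
  shows "continuous_on {-1<..<1} (D j)"
proof (intro continuous_at_imp_continuous_on ballI)
  fix t :: real assume "t \<in> {-1<..<1}"
  then have "(D j has_real_derivative D (Suc j) t) (at t)" using assms by (simp add: derivative_sequence_def)
  then show "isCont (D j) t" by (rule DERIV_isCont)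
qed

lemma continuous_on_segment_integrand:
  assumes D: "derivative_sequence D" and a: "a \<in> {-1<..<1}"
  shows "continuous_on ({-1<..<1} \<times> {0..1}) (\<lambda>(t, s). s ^ i * D j (a + s * (t - a)))"
proof -
  have "continuous_on ({-1<..<1} \<times> {0..1}) (\<lambda>p. D j (a + snd p * (fst p - a)))"
    by (rule continuous_on_compose2[OF derivative_sequence_continuous[OF D]])
       (use segment_in_interval[OF a] in \<open>auto intro!: continuous_intros\<close>)
  then show ?thesis
    by (auto simp: case_prod_beta intro!: continuous_intros)
qed

lemma continuous_on_segment_integrand':
  assumes D: "derivative_sequence D" and a: "a \<in> {-1<..<1}" and t: "t \<in> {-1<..<1}"
  shows "continuous_on {0..1} (\<lambda>s. s ^ i * D j (a + s * (t - a)))"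
proof -
  have "continuous_on {0..1} (\<lambda>s. D j (a + s * (t - a)))"
    by (rule continuous_on_compose2[OF derivative_sequence_continuous[OF D]])
       (use segment_in_interval[OF a t] in \<open>auto intro!: continuous_intros\<close>)
  then show ?thesis by (auto intro!: continuous_intros)
qed

lemma has_derivative_segment_integral:
  assumes D: "derivative_sequence D" and a: "a \<in> {-1<..<1}" and t: "t \<in> {-1<..<1}"
  shows "((\<lambda>t. integral {0..1} (\<lambda>s. s ^ j * D (Suc j) (a + s * (t - a)))) has_real_derivative
     integral {0..1} (\<lambda>s. s ^ Suc j * D (Suc (Suc j)) (a + s * (t - a)))) (at t)"
proof -
  have "((\<lambda>t. integral (cbox 0 1) (\<lambda>s. s ^ j * D (Suc j) (a + s * (t - a)))) has_real_derivative
     integral (cbox 0 1) (\<lambda>s. s ^ Suc j * D (Suc (Suc j)) (a + s * (t - a)))) (at t within {-1<..<1})"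
  proof (rule leibniz_rule_field_derivative[where fx = "\<lambda>t s. s ^ Suc j * D (Suc (Suc j)) (a + s * (t - a))"])
    fix x s :: real assume x: "x \<in> {-1<..<1}" and s: "s \<in> cbox 0 1"
    have "a + s * (x - a) \<in> {-1<..<1}" using segment_in_interval[OF a x] s by simp
    then have "(D (Suc j) has_real_derivative D (Suc (Suc j)) (a + s * (x - a))) (at (a + s * (x - a)))"
      using D by (auto simp: derivative_sequence_def)
    then have der: "((\<lambda>x. D (Suc j) (a + s * (x - a))) has_real_derivative D (Suc (Suc j)) (a + s * (x - a)) * s) (at x)"
      by (rule DERIV_chain2[where g = "\<lambda>x. a + s * (x - a)"]) (auto intro!: derivative_eq_intros)
    have eq: "s ^ Suc j * D (Suc (Suc j)) (a + s * (x - a)) = s ^ j * (D (Suc (Suc j)) (a + s * (x - a)) * s)"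
      by simp
    show "((\<lambda>x. s ^ j * D (Suc j) (a + s * (x - a))) has_real_derivative
        s ^ Suc j * D (Suc (Suc j)) (a + s * (x - a))) (at x within {-1<..<1})"
      unfolding eq by (rule has_field_derivative_at_within[OF DERIV_cmult[OF der]])
  next
    fix x :: real assume "x \<in> {-1<..<1}"
    then show "(\<lambda>s. s ^ j * D (Suc j) (a + s * (x - a))) integrable_on cbox 0 1"
      using continuous_on_segment_integrand'[OF D a] by (intro integrable_continuous) simp
  qed (use t continuous_on_segment_integrand[OF D a, of "Suc j" "Suc (Suc j)"] in auto)
  then show ?thesis by (simp only: cbox_interval at_within_open[OF t open_greaterThanLessThan])
qed

lemma quotient_sequence_0:
  assumes D: "derivative_sequence D" and a: "a \<in> {-1<..<1}" and t: "t \<in> {-1<..<1}"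
  shows "quotient_sequence a D 0 t = integral {0..1} (\<lambda>s. s ^ 0 * D (Suc 0) (a + s * (t - a)))"
proof (cases "t = a")
  case True then show ?thesis by (simp add: quotient_sequence_def)
next
  case False
  have "((\<lambda>s. D 1 (a + s * (t - a))) has_integral
      D 0 (a + 1 * (t - a)) / (t - a) - D 0 (a + 0 * (t - a)) / (t - a)) {0..1}"
  proof (rule fundamental_theorem_of_calculus)
    fix s :: real assume "s \<in> {0..1}"
    then have "a + s * (t - a) \<in> {-1<..<1}" using segment_in_interval[OF a t] by simp
    then have "(D 0 has_real_derivative D 1 (a + s * (t - a))) (at (a + s * (t - a)))"
      using D by (auto simp: derivative_sequence_def)
    then have der: "((\<lambda>s. D 0 (a + s * (t - a))) has_real_derivative D 1 (a + s * (t - a)) * (t - a)) (at s)"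
      by (rule DERIV_chain2[where g = "\<lambda>s. a + s * (t - a)"]) (auto intro!: derivative_eq_intros)
    have eq: "D 1 (a + s * (t - a)) * (t - a) / (t - a) = D 1 (a + s * (t - a))"
      using False by (intro nonzero_mult_div_cancel_right) simp
    show "((\<lambda>s. D 0 (a + s * (t - a)) / (t - a)) has_vector_derivative D 1 (a + s * (t - a))) (at s within {0..1})"
      using DERIV_cdivide[OF der, of "t - a"]
      unfolding eq has_real_derivative_iff_has_vector_derivative by (rule has_vector_derivative_at_within)
  qed simp
  then have "integral {0..1} (\<lambda>s. D 1 (a + s * (t - a))) = (D 0 t - D 0 a) / (t - a)"
    by (simp add: integral_unique diff_divide_distrib)
  then show ?thesis using False by (simp add: quotient_sequence_def)
qed

lemma quotient_sequence_eq_integral: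
  assumes "derivative_sequence D" "a \<in> {-1<..<1}" "t \<in> {-1<..<1}"
  shows "quotient_sequence a D j t = integral {0..1} (\<lambda>s. s ^ j * D (Suc j) (a + s * (t - a)))"
  using quotient_sequence_0[OF assms] by (cases "j = 0") (auto simp: quotient_sequence_def)

lemma derivative_sequence_quotient:
  assumes D: "derivative_sequence D" and a: "a \<in> {-1<..<1}"
  shows "derivative_sequence (quotient_sequence a D)"
proof -
  have der: "(quotient_sequence a D j has_real_derivative quotient_sequence a D (Suc j) t) (at t)"
    if t: "t \<in> {-1<..<1}" for j t
  proof -
    have "(quotient_sequence a D j has_real_derivative
       integral {0..1} (\<lambda>s. s ^ Suc j * D (Suc (Suc j)) (a + s * (t - a)))) (at t)"
      by (rule has_field_derivative_transform_within_open[OF has_derivative_segment_integral[OF D a t] open_greaterThanLessThan t])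
         (simp add: quotient_sequence_eq_integral[OF D a])
    then show ?thesis using t by (simp add: quotient_sequence_eq_integral[OF D a])
  qed
  have "continuous_on {-1..<1} (quotient_sequence a D 0)"
    unfolding continuous_on_eq_continuous_within
  proof
    fix t :: real assume t: "t \<in> {-1..<1}"
    show "continuous (at t within {-1..<1}) (quotient_sequence a D 0)"
    proof (cases "t = -1")
      case False
      then have "isCont (quotient_sequence a D 0) t" using t by (intro DERIV_isCont[OF der]) auto
      then show ?thesis by (rule continuous_at_imp_continuous_at_within)
    next
      case True
      have "continuous (at t within {-1..<1}) (D 0)"
        using D t by (auto simp: derivative_sequence_def continuous_on_eq_continuous_within)
      then have "continuous (at t within {-1..<1}) (\<lambda>t. (D 0 t - D 0 a) / (t - a))"
        using True a by (auto intro!: continuous_intros)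
      \<comment> \<open>Within distance \<open>a + 1\<close> of -1 the node \<open>a\<close> is not
        met, so the exceptional value at \<open>a\<close> plays no part in the limit.\<close>
      then show ?thesis
        by (rule continuous_transform_within[of _ _ _ "a + 1"])
           (use True a in \<open>auto simp: quotient_sequence_def dist_real_def\<close>)
    qed
  qed
  with der show ?thesis by (auto simp: derivative_sequence_def)
qed

text \<open>The substitute for the integral formula at \<open>t = -1\<close>: the mean value theorem
  uses continuity at the endpoint and derivatives only inside.\<close>

lemma mean_value_slope:
  assumes D: "derivative_sequence D" and a: "a \<in> {-1<..<1}" and t: "t \<in> {-1..<1}"
  obtains z where "z \<in> {-1<..<1}" "quotient_sequence a D 0 t = D 1 z"
proof (cases "t = a")
  case True then show ?thesis using a by (intro that[of a]) (auto simp: quotient_sequence_def)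
next
  case False
  have "\<exists>l z. min a t < z \<and> z < max a t \<and> DERIV (D 0) z :> l \<and>
       D 0 (max a t) - D 0 (min a t) = (max a t - min a t) * l"
  proof (rule MVT)
    show "continuous_on {min a t..max a t} (D 0)"
      using D a t by (auto simp: derivative_sequence_def elim!: continuous_on_subset)
    fix x assume "min a t < x" "x < max a t"
    then have "x \<in> {-1<..<1}" using a t by auto
    then have "(D 0 has_real_derivative D 1 x) (at x)" using D by (simp add: derivative_sequence_def)
    then show "D 0 differentiable at x" unfolding real_differentiable_def by (rule exI)
  qed (use False in auto)
  then obtain l z where z: "min a t < z" "z < max a t" "DERIV (D 0) z :> l"
      "D 0 (max a t) - D 0 (min a t) = (max a t - min a t) * l" by blast
  have zI: "z \<in> {-1<..<1}" using z a t by auto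
  then have "l = D 1 z" using D z(3) by (auto simp: derivative_sequence_def intro: DERIV_unique)
  then have "quotient_sequence a D 0 t = D 1 z"
    using z(4) False by (auto simp: quotient_sequence_def max_def min_def field_simps split: if_splits)
  with zI show ?thesis by (rule that)
qed

lemma quotient_sequence_nonneg:
  assumes D: "derivative_sequence D" and a: "a \<in> {-1<..<1}" and t: "t \<in> {-1<..<1}"
    and nn: "\<And>t. t \<in> {-1<..<1} \<Longrightarrow> D (Suc j) t \<ge> 0"
  shows "quotient_sequence a D j t \<ge> 0"
  unfolding quotient_sequence_eq_integral[OF D a t]
  by (intro integral_nonneg integrable_continuous_interval continuous_on_segment_integrand'[OF D a t]
      mult_nonneg_nonneg nn segment_in_interval[OF a t]) auto

lemma quotient_sequence_pos:
  assumes D: "derivative_sequence D" and a: "a \<in> {-1<..<1}" and t: "t \<in> {-1<..<1}"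
    and pos: "\<And>t. t \<in> {-1<..<1} \<Longrightarrow> D (Suc j) t > 0"
  shows "quotient_sequence a D j t > 0"
proof -
  have "quotient_sequence a D j t \<ge> 0"
    using quotient_sequence_nonneg[OF D a t] pos by (simp add: less_imp_le)
  moreover have "quotient_sequence a D j t \<noteq> 0"
  proof
    assume "quotient_sequence a D j t = 0"
    then have "\<forall>s\<in>{0..1}. s ^ j * D (Suc j) (a + s * (t - a)) = 0"
      unfolding quotient_sequence_eq_integral[OF D a t]
      using pos segment_in_interval[OF a t]
      by (subst (asm) integral_eq_0_iff[OF continuous_on_segment_integrand'[OF D a t]])
         (auto simp: less_imp_le)
    \<comment> \<open>At \<open>s = 1\<close> the factor \<open>s ^ j\<close> is 1 and the argument
      of \<open>D (Suc j)\<close> is \<open>t\<close>.\<close>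
    from bspec[OF this, of 1] show False using pos[OF t] by simp
  qed
  ultimately show ?thesis by simp
qed

lemma quotient_sequence_endpoint_nonneg:
  assumes "derivative_sequence D" "a \<in> {-1<..<1}" "t \<in> {-1..<1}"
    and "\<And>t. t \<in> {-1<..<1} \<Longrightarrow> D 1 t \<ge> 0"
  shows "quotient_sequence a D 0 t \<ge> 0"
proof -
  obtain z where "z \<in> {-1<..<1}" "quotient_sequence a D 0 t = D 1 z"
    using assms(1-3) by (rule mean_value_slope)
  then show ?thesis using assms(4)[of z] by simp
qed

lemma quotient_sequence_endpoint_pos:
  assumes "derivative_sequence D" "a \<in> {-1<..<1}" "t \<in> {-1..<1}"
    and "\<And>t. t \<in> {-1<..<1} \<Longrightarrow> D 1 t > 0"
  shows "quotient_sequence a D 0 t > 0"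
proof -
  obtain z where "z \<in> {-1<..<1}" "quotient_sequence a D 0 t = D 1 z"
    using assms(1-3) by (rule mean_value_slope)
  then show ?thesis using assms(4)[of z] by simp
qed

lemma quotient_sequence_mult: "D 0 t = D 0 a + (t - a) * quotient_sequence a D 0 t"
  by (simp add: quotient_sequence_def)

text \<open>\<open>newton_rest as D 0 t\<close> is the divided difference of \<open>D 0\<close> at
  the nodes \<open>as\<close> and \<open>t\<close>. A node occurring twice gives Hermite
  interpolation there, since \<open>quotient_sequence\<close> takes the derivative on the
  diagonal.\<close>

primrec newton_rest :: "real list \<Rightarrow> (nat \<Rightarrow> real \<Rightarrow> real) \<Rightarrow> nat \<Rightarrow> real \<Rightarrow> real" where
  "newton_rest [] D = D"
| "newton_rest (a # as) D = newton_rest as (quotient_sequence a D)"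

primrec newton_poly :: "real list \<Rightarrow> (nat \<Rightarrow> real \<Rightarrow> real) \<Rightarrow> real poly" where
  "newton_poly [] D = 0"
| "newton_poly (a # as) D = [:D 0 a:] + [:-a, 1:] * newton_poly as (quotient_sequence a D)"

lemma newton_interpolation:
  "D 0 t = poly (newton_poly as D) t + (\<Prod>a\<leftarrow>as. t - a) * newton_rest as D 0 t"
proof (induction as arbitrary: D)
  case (Cons a as)
  show ?case
    by (subst quotient_sequence_mult[of D t a], subst Cons) (simp add: algebra_simps)
qed simp

lemma degree_newton_poly: "degree (newton_poly as D) \<le> length as - 1"
proof (induction as arbitrary: D)
  case (Cons a as)
  show ?case
  proof (cases as)
    case Nil then show ?thesis by simp
  next
    case (Cons b bs)
    have "degree ([:-a, 1:] * newton_poly as (quotient_sequence a D)) \<le> degree [:-a, 1:] + degree (newton_poly as (quotient_sequence a D))"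
      by (rule degree_mult_le)
    also have "\<dots> \<le> length as" using Cons.IH[of "quotient_sequence a D"] Cons by simp
    finally show ?thesis unfolding newton_poly.simps by (intro degree_add_le) simp_all
  qed
qed simp

definition monotone_sequence :: "(nat \<Rightarrow> real \<Rightarrow> real) \<Rightarrow> bool" where
  "monotone_sequence D \<longleftrightarrow> derivative_sequence D \<and> (\<forall>j\<ge>1. \<forall>t\<in>{-1<..<1}. D j t \<ge> 0)"

lemma monotone_sequence_quotient:
  assumes "monotone_sequence D" "a \<in> {-1<..<1}"
  shows "monotone_sequence (quotient_sequence a D)"
  using assms by (auto simp: monotone_sequence_def intro!: derivative_sequence_quotient quotient_sequence_nonneg)

lemma newton_rest_nonneg:
  assumes "monotone_sequence D" "set as \<subseteq> {-1<..<1}" "as \<noteq> []" "t \<in> {-1..<1}"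
  shows "newton_rest as D 0 t \<ge> 0"
  using assms
proof (induction as arbitrary: D)
  case (Cons a as)
  show ?case
  proof (cases "as = []")
    case True
    then show ?thesis using Cons.prems
      by (auto simp: monotone_sequence_def intro!: quotient_sequence_endpoint_nonneg)
  next
    case False
    then show ?thesis using Cons.prems by (auto intro!: Cons.IH monotone_sequence_quotient)
  qed
qed simp

lemma newton_rest_pos:
  assumes "monotone_sequence D" "set as \<subseteq> {-1<..<1}" "as \<noteq> []" "t \<in> {-1..<1}"
    and "\<And>t. t \<in> {-1<..<1} \<Longrightarrow> D (length as) t > 0"
  shows "newton_rest as D 0 t > 0"
  using assms
proof (induction as arbitrary: D)
  case (Cons a as)
  show ?case
  proof (cases "as = []")
    case True
    then show ?thesis using Cons.prems
      by (auto simp: monotone_sequence_def intro!: quotient_sequence_endpoint_pos)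
  next
    case False
    have "quotient_sequence a D (length as) t > 0" if "t \<in> {-1<..<1}" for t
      using that Cons.prems by (intro quotient_sequence_pos) (auto simp: monotone_sequence_def)
    then show ?thesis using False Cons.prems by (auto intro!: Cons.IH monotone_sequence_quotient)
  qed
qed simp

lemma monotone_sequence_deriv:
  assumes "absolutely_monotone h"
  shows "monotone_sequence (\<lambda>j. (deriv ^^ j) h)"
  using assms unfolding absolutely_monotone_def monotone_sequence_def derivative_sequence_def
  by (auto simp: DERIV_deriv_iff_real_differentiable)

text \<open>The test potential: all its derivatives are strictly positive, so equality of potentials
  forces the interpolation error to vanish pointwise.\<close>

lemma absolutely_monotone_exp: "absolutely_monotone exp"
proof -
  have "deriv exp = (exp :: real \<Rightarrow> real)"
    by (rule ext, rule DERIV_imp_deriv, rule DERIV_exp)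
  then have "(deriv ^^ j) exp = (exp :: real \<Rightarrow> real)" for j
    by (induction j) simp_all
  moreover have "exp differentiable (at t)" for t :: real
    unfolding real_differentiable_def by (blast intro: DERIV_exp)
  ultimately show ?thesis
    by (simp add: absolutely_monotone_def continuous_on_exp)
qed

lemma monotone_sequence_exp: "monotone_sequence (\<lambda>j. exp)"
  by (simp add: monotone_sequence_def derivative_sequence_def continuous_on_exp)

section \<open>Moments of the surface measure\<close>

lemma distr_lborel_orthogonal:
  fixes f :: "real^'n::{finite,wellorder} \<Rightarrow> real^'n::{finite,wellorder}"
  assumes f: "orthogonal_transformation f"
  shows "distr lborel borel f = lborel"
proof (rule lborel_eqI[symmetric])
  fix l u :: "real^'n::{finite,wellorder}" assume le: "\<And>b. b \<in> Basis \<Longrightarrow> l \<bullet> b \<le> u \<bullet> b"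
  let ?g = "inv_into UNIV f"
  have bij: "bij f" using f by (rule orthogonal_transformation_bij)
  have g: "orthogonal_transformation ?g" using f by (rule orthogonal_transformation_inv)
  have meas: "f \<in> borel_measurable borel"
    using f by (intro borel_measurable_continuous_onI linear_continuous_on
        orthogonal_transformation_linear linear_conv_bounded_linear[THEN iffD1])
  have img: "f -` box l u = ?g ` box l u" using bij by (simp add: bij_vimage_eq_inv_image)
  have lm: "?g ` box l u \<in> lmeasurable"
    using g by (intro measurable_orthogonal_image) auto
  have "emeasure (distr lborel borel f) (box l u) = emeasure lborel (f -` box l u)"
    using meas by (simp add: emeasure_distr)
  also have "\<dots> = emeasure lebesgue (f -` box l u)"
    using measurable_sets[OF meas, of "box l u"] by (simp add: emeasure_completion)
  also have "\<dots> = ennreal (measure lebesgue (?g ` box l u))"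
    using lm by (simp add: img emeasure_eq_measure2)
  also have "measure lebesgue (?g ` box l u) = measure lebesgue (box l u)"
    using g by (intro measure_orthogonal_image) auto
  also have "ennreal (measure lebesgue (box l u)) = (\<Prod>b\<in>Basis. (u - l) \<bullet> b)"
    using le by (simp add: measure_lborel_box)
  finally show "emeasure (distr lborel borel f) (box l u) = (\<Prod>b\<in>Basis. (u - l) \<bullet> b)" .
qed simp

lemma emeasure_unit_ball: "emeasure lborel (ball (0::real^'n) 1) \<noteq> 0" "emeasure lborel (ball (0::real^'n) 1) \<noteq> \<infinity>"
proof -
  have "measure lborel (ball (0::real^'n) 1) > 0" by (rule content_ball_pos) simp
  then show "emeasure lborel (ball (0::real^'n) 1) \<noteq> 0" by (auto simp: measure_def)
  show "emeasure lborel (ball (0::real^'n) 1) \<noteq> \<infinity>"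
    using emeasure_bounded_finite[of "ball (0::real^'n) 1"] by auto
qed

lemma prob_space_sphere_measure: "prob_space (sphere_measure :: (real^'n) measure)"
proof -
  interpret prob_space "uniform_measure lborel (ball (0::real^'n) 1)"
    using emeasure_unit_ball by (intro prob_space_uniform_measure) auto
  show ?thesis unfolding sphere_measure_def by (intro prob_space_distr) simp
qed

lemma sets_sphere_measure [simp]: "sets sphere_measure = sets borel"
  by (simp add: sphere_measure_def)

lemma space_sphere_measure [simp]: "space sphere_measure = UNIV"
  by (simp add: sphere_measure_def)

lemma measurable_sphere_measure [simp]: "measurable sphere_measure N = measurable borel N"
  by (rule measurable_cong_sets) simp_all

text \<open>An orthogonal map preserves the uniform distribution on the ball and commutes with the
  radial projection.\<close>

lemma distr_sphere_measure_orthogonal: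
  fixes f :: "real^'n::{finite,wellorder} \<Rightarrow> real^'n::{finite,wellorder}"
  assumes f: "orthogonal_transformation f"
  shows "distr sphere_measure borel f = sphere_measure"
proof -
  let ?B = "ball (0::real^'n::{finite,wellorder}) 1" and ?U = "uniform_measure lborel (ball (0::real^'n::{finite,wellorder}) 1)"
  let ?N = "\<lambda>x::real^'n::{finite,wellorder}. x /\<^sub>R norm x"
  have lin: "linear f" and norm: "\<And>x. norm (f x) = norm x"
    using f by (auto simp: orthogonal_transformation)
  have meas: "f \<in> borel_measurable borel"
    using lin by (intro borel_measurable_continuous_onI linear_continuous_on linear_conv_bounded_linear[THEN iffD1])
  have U: "distr ?U borel f = ?U"
  proof (rule measure_eqI)
    fix A assume "A \<in> sets (distr ?U borel f)"
    then have A: "A \<in> sets borel" by simp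
    have fA: "f -` A \<in> sets borel" using measurable_sets[OF meas A] by simp
    have "emeasure (distr ?U borel f) A = emeasure ?U (f -` A)"
      using A meas by (simp add: emeasure_distr)
    also have "\<dots> = emeasure lborel (?B \<inter> f -` A) / emeasure lborel ?B"
      using fA by simp
    also have "?B \<inter> f -` A = f -` (?B \<inter> A)" by (auto simp: norm)
    also have "emeasure lborel (f -` (?B \<inter> A)) = emeasure (distr lborel borel f) (?B \<inter> A)"
      using A meas by (subst emeasure_distr) auto
    also have "\<dots> = emeasure lborel (?B \<inter> A)" by (simp add: distr_lborel_orthogonal[OF f])
    also have "\<dots> / emeasure lborel ?B = emeasure ?U A" using A by simp
    finally show "emeasure (distr ?U borel f) A = emeasure ?U A" .
  qed simp
  have comm: "f \<circ> ?N = ?N \<circ> f" by (auto simp: norm linear_scale[OF lin] fun_eq_iff)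
  have "distr sphere_measure borel f = distr ?U borel (f \<circ> ?N)"
    unfolding sphere_measure_def using meas by (subst distr_distr) auto
  also have "\<dots> = distr (distr ?U borel f) borel ?N"
    unfolding comm using meas by (subst distr_distr) auto
  also have "\<dots> = sphere_measure" by (simp add: U sphere_measure_def)
  finally show ?thesis .
qed

lemma integral_sphere_measure_orthogonal:
  fixes f :: "real^'n::{finite,wellorder} \<Rightarrow> real^'n::{finite,wellorder}" and g :: "real^'n::{finite,wellorder} \<Rightarrow> real"
  assumes f: "orthogonal_transformation f" and g: "g \<in> borel_measurable borel"
  shows "(\<integral>x. g (f x) \<partial>sphere_measure) = (\<integral>x. g x \<partial>sphere_measure)"
proof -
  have "f \<in> borel_measurable borel"
    using f by (intro borel_measurable_continuous_onI linear_continuous_on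
        orthogonal_transformation_linear linear_conv_bounded_linear[THEN iffD1])
  then have "(\<integral>x. g (f x) \<partial>sphere_measure) = (\<integral>x. g x \<partial>distr sphere_measure borel f)"
    using g by (subst integral_distr) auto
  then show ?thesis by (simp add: distr_sphere_measure_orthogonal[OF f])
qed

lemma AE_sphere_measure: "AE x in (sphere_measure :: (real^'n) measure). norm x = 1"
proof -
  have "AE x in lborel. x \<noteq> (0::real^'n)" by (rule AE_lborel_singleton)
  then have "AE x in uniform_measure lborel (ball (0::real^'n) 1). x \<noteq> 0"
    using emeasure_unit_ball by (subst AE_uniform_measure) (auto elim: eventually_mono simp: less_top[symmetric])
  then have "AE x in uniform_measure lborel (ball (0::real^'n) 1). norm (x /\<^sub>R norm x) = 1"
    by (rule eventually_mono) simp
  then show ?thesis unfolding sphere_measure_def by (subst AE_distr_iff) auto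
qed

lemma borel_measurable_vec_nth_component [measurable]: "(\<lambda>x :: real^'n. x $ i) \<in> borel_measurable borel"
  by (intro borel_measurable_continuous_onI continuous_intros)

lemma integrable_sphere_measure:
  fixes g :: "real^'n \<Rightarrow> real"
  assumes "g \<in> borel_measurable borel" and "\<And>x. norm x = 1 \<Longrightarrow> \<bar>g x\<bar> \<le> B"
  shows "integrable sphere_measure g"
proof -
  interpret prob_space "sphere_measure :: (real^'n) measure" by (rule prob_space_sphere_measure)
  show ?thesis
    by (rule integrable_const_bound[where B = B])
       (use assms AE_sphere_measure in \<open>auto elim!: eventually_mono\<close>)
qed

text \<open>Three kinds of symmetry yield all moments up to degree 3: the antipodal map kills odd
  degrees, a sign change of one coordinate kills mixed second moments, and a transposition of
  coordinates equates the pure ones.\<close>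

lemma orthogonal_transformation_flip:
  "orthogonal_transformation (\<lambda>x :: real^'n. \<chi> k. if k = i then - x $ k else x $ k)"
  unfolding orthogonal_transformation_def
  by (auto intro!: linearI sum.cong simp: vec_eq_iff inner_vec_def)

lemma orthogonal_transformation_swap:
  "orthogonal_transformation (\<lambda>x :: real^'n. \<chi> k. x $ (Transposition.transpose i j k))"
  unfolding orthogonal_transformation_def
proof (intro conjI allI)
  fix v w :: "real^'n"
  have "bij (Transposition.transpose i j)" by simp
  then show "(\<chi> k. v $ (Transposition.transpose i j k)) \<bullet> (\<chi> k. w $ (Transposition.transpose i j k)) = v \<bullet> w"
    unfolding inner_vec_def by (simp add: sum.reindex_bij_betw[where g = "\<lambda>k. v $ k * w $ k"])
qed (auto intro!: linearI simp: vec_eq_iff)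

lemma sphere_measure_odd:
  fixes g :: "real^'n::{finite,wellorder} \<Rightarrow> real"
  assumes "orthogonal_transformation f" "g \<in> borel_measurable borel" "\<And>x. g (f x) = - g x"
  shows "(\<integral>x. g x \<partial>sphere_measure) = 0"
  using integral_sphere_measure_orthogonal[OF assms(1,2)] assms(3) by simp

lemma sphere_measure_linear: "(\<integral>x. x $ i \<partial>(sphere_measure :: (real^'n::{finite,wellorder}) measure)) = 0"
  by (rule sphere_measure_odd[OF orthogonal_transformation_neg[THEN iffD2, OF orthogonal_transformation_id]]) auto

lemma sphere_measure_cubic: "(\<integral>x. x $ i * (x $ j * x $ k) \<partial>(sphere_measure :: (real^'n::{finite,wellorder}) measure)) = 0"
  by (rule sphere_measure_odd[OF orthogonal_transformation_neg[THEN iffD2, OF orthogonal_transformation_id]]) auto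

lemma sphere_measure_quadratic:
  "(\<integral>x. x $ i * x $ j \<partial>(sphere_measure :: (real^'n::{finite,wellorder}) measure)) = (if i = j then 1 / CARD('n) else 0)"
proof (cases "i = j")
  case False
  then show ?thesis
    by (simp, intro sphere_measure_odd[OF orthogonal_transformation_flip[of i]]) auto
next
  case True
  interpret prob_space "sphere_measure :: (real^'n::{finite,wellorder}) measure" by (rule prob_space_sphere_measure)
  let ?I = "\<lambda>k. \<integral>x. x $ k * x $ k \<partial>(sphere_measure :: (real^'n::{finite,wellorder}) measure)"
  have eq: "?I k = ?I i" for k
    using integral_sphere_measure_orthogonal[OF orthogonal_transformation_swap[of i k], of "\<lambda>x. x $ i * x $ i"]
    by simp
  have int: "integrable sphere_measure (\<lambda>x :: real^'n::{finite,wellorder}. x $ k * x $ k)" for k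
  proof (rule integrable_sphere_measure[where B = 1])
    fix x :: "real^'n::{finite,wellorder}" assume "norm x = 1"
    then show "\<bar>x $ k * x $ k\<bar> \<le> 1"
      using component_le_norm_cart[of x k] mult_le_one[of "\<bar>x $ k\<bar>" "\<bar>x $ k\<bar>"] by (simp add: abs_mult)
  qed simp
  \<comment> \<open>The common value of the pure second moments follows from their sum, the integral
    of \<open>|x|\<^sup>2\<close>, which is 1 almost everywhere.\<close>
  have "real CARD('n) * ?I i = (\<Sum>k\<in>(UNIV :: 'n set). ?I i)" by simp
  also have "\<dots> = (\<Sum>k\<in>UNIV. ?I k)" by (intro sum.cong refl eq[symmetric])
  also have "\<dots> = (\<integral>x. (\<Sum>k\<in>UNIV. x $ k * x $ k) \<partial>(sphere_measure :: (real^'n::{finite,wellorder}) measure))"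
    using int by simp
  also have "\<dots> = (\<integral>x. 1 \<partial>(sphere_measure :: (real^'n::{finite,wellorder}) measure))"
    by (rule integral_cong_AE)
       (use AE_sphere_measure in \<open>auto elim!: eventually_mono simp: norm_eq_1 inner_vec_def\<close>)
  also have "\<dots> = 1" using prob_space by simp
  finally show ?thesis using True by (simp add: field_simps)
qed

lemma monomial_split:
  fixes e :: "'n::finite \<Rightarrow> nat"
  assumes "sum e UNIV = Suc k"
  obtains i e' where "sum e' UNIV = k"
    "\<And>x :: real^'n. (\<Prod>j\<in>UNIV. (x $ j) ^ e j) = x $ i * (\<Prod>j\<in>UNIV. (x $ j) ^ e' j)"
proof -
  have "sum e UNIV \<noteq> 0" using assms by simp
  then obtain i where i: "e i \<noteq> 0" by (rule sum.not_neutral_contains_not_neutral)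
  define e' where "e' = e(i := e i - 1)"
  have rest: "j \<noteq> i \<Longrightarrow> e' j = e j" for j by (simp add: e'_def)
  have ei: "e i = Suc (e' i)" using i by (simp add: e'_def)
  have "sum e (UNIV - {i}) = sum e' (UNIV - {i})" by (rule sum.cong) (auto simp: rest)
  then have "sum e' UNIV = k"
    using assms ei by (simp add: sum.remove[of UNIV i])
  moreover have "(\<Prod>j\<in>UNIV. (x $ j) ^ e j) = x $ i * (\<Prod>j\<in>UNIV. (x $ j) ^ e' j)" for x :: "real^'n"
  proof -
    have "(\<Prod>j\<in>UNIV - {i}. (x $ j) ^ e j) = (\<Prod>j\<in>UNIV - {i}. (x $ j) ^ e' j)"
      by (rule prod.cong) (auto simp: rest)
    then show ?thesis by (simp add: prod.remove[of UNIV i] ei)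
  qed
  ultimately show ?thesis by (rule that)
qed

text \<open>Polarization: the power sums in single directions determine the sums of all monomials of
  degree at most 3, and these are compared with the moments of the surface measure.\<close>

lemma spherical_design_3I:
  fixes C :: "(real^'n::{finite,wellorder}) set"
  assumes C: "spherical_code C" "C \<noteq> {}"
    and 1: "\<And>u. norm u = 1 \<Longrightarrow> (\<Sum>x\<in>C. x \<bullet> u) = 0"
    and 2: "\<And>u. norm u = 1 \<Longrightarrow> (\<Sum>x\<in>C. (x \<bullet> u)\<^sup>2) = real (card C) / CARD('n)"
    and 3: "\<And>u. norm u = 1 \<Longrightarrow> (\<Sum>x\<in>C. (x \<bullet> u) ^ 3) = 0"
  shows "spherical_design 3 C"
proof -
  define N where "N = real (card C)"
  have N: "N > 0" using C by (simp add: N_def spherical_code_def card_gt_0_iff)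
  have scale: "(\<Sum>x\<in>C. (x \<bullet> v) ^ k) = norm v ^ k * (\<Sum>x\<in>C. (x \<bullet> (v /\<^sub>R norm v)) ^ k)"
    if "v \<noteq> 0" for v :: "real^'n::{finite,wellorder}" and k
  proof -
    have "x \<bullet> v = norm v * (x \<bullet> (v /\<^sub>R norm v))" for x using that by simp
    then show ?thesis unfolding sum_distrib_left power_mult_distrib[symmetric] by (metis (no_types, lifting))
  qed
  have 2: "(\<Sum>x\<in>C. (x \<bullet> v)\<^sup>2) = N / CARD('n) * (v \<bullet> v)" for v
    using scale[of v 2] 2[of "v /\<^sub>R norm v"]
    by (cases "v = 0") (simp_all add: N_def power2_norm_eq_inner)
  have 3: "(\<Sum>x\<in>C. (x \<bullet> v) ^ 3) = 0" for v
    using scale[of v 3] 3[of "v /\<^sub>R norm v"] by (cases "v = 0") simp_all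
  let ?a = "\<lambda>i. axis i (1::real) :: real^'n::{finite,wellorder}"
  have inner_axis: "x \<bullet> ?a i = x $ i" for x i by (simp add: inner_axis)
  have lin: "(\<Sum>x\<in>C. x $ i) = 0" for i
    using 1[of "?a i"] by (simp add: inner_axis norm_axis_1)
  have quad: "(\<Sum>x\<in>C. x $ i * x $ j) = (if i = j then N / CARD('n) else 0)" for i j
  proof -
    have "4 * (\<Sum>x\<in>C. x $ i * x $ j) = (\<Sum>x\<in>C. (x \<bullet> (?a i + ?a j))\<^sup>2) - (\<Sum>x\<in>C. (x \<bullet> (?a i - ?a j))\<^sup>2)"
      unfolding sum_distrib_left sum_subtractf[symmetric]
      by (rule sum.cong) (auto simp: inner_add_right inner_diff_right inner_axis power2_eq_square algebra_simps)
    also have "\<dots> = N / CARD('n) * (4 * (?a i \<bullet> ?a j))"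
      unfolding 2 by (simp add: inner_add_left inner_add_right inner_diff_left inner_diff_right inner_commute field_simps)
    finally show ?thesis by (auto simp: inner_axis_axis field_simps)
  qed
  have cub: "(\<Sum>x\<in>C. x $ i * (x $ j * x $ k)) = 0" for i j k
  proof -
    \<comment> \<open>The polarization identity of the cubic form: the alternating sum of the cubes
      of \<open>a \<plusminus> b \<plusminus> c\<close> is \<open>24 a b c\<close>.\<close>
    have "24 * (\<Sum>x\<in>C. x $ i * (x $ j * x $ k)) =
        (\<Sum>x\<in>C. (x \<bullet> (?a i + ?a j + ?a k)) ^ 3) - (\<Sum>x\<in>C. (x \<bullet> (?a i + ?a j - ?a k)) ^ 3)
      - (\<Sum>x\<in>C. (x \<bullet> (?a i - ?a j + ?a k)) ^ 3) + (\<Sum>x\<in>C. (x \<bullet> (?a i - ?a j - ?a k)) ^ 3)"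
      unfolding sum_distrib_left sum_subtractf[symmetric] sum.distrib[symmetric]
      by (rule sum.cong) (auto simp: inner_add_right inner_diff_right inner_axis power3_eq_cube algebra_simps)
    then show ?thesis by (simp add: 3)
  qed
  have mono: "(\<Sum>x\<in>C. \<Prod>i\<in>UNIV. (x $ i) ^ e i) / N = (\<integral>x. (\<Prod>i\<in>UNIV. (x $ i) ^ e i) \<partial>sphere_measure)"
    if e: "sum e UNIV \<le> 3" for e :: "'n \<Rightarrow> nat"
  proof -
    interpret prob_space "sphere_measure :: (real^'n::{finite,wellorder}) measure" by (rule prob_space_sphere_measure)
    have zero: "(\<Prod>i\<in>UNIV. (x $ i) ^ e i) = 1" if "sum e UNIV = 0" for e and x :: "real^'n::{finite,wellorder}"
      using that by simp
    consider "sum e UNIV = 0" | "sum e UNIV = Suc 0" | "sum e UNIV = Suc (Suc 0)" | "sum e UNIV = Suc (Suc (Suc 0))"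
      using e by linarith
    then show ?thesis
    proof cases
      case 1
      then show ?thesis using N prob_space by (simp add: zero N_def)
    next
      case 2
      then obtain i e' where "sum e' UNIV = 0"
        "\<And>x :: real^'n::{finite,wellorder}. (\<Prod>j\<in>UNIV. (x $ j) ^ e j) = x $ i * (\<Prod>j\<in>UNIV. (x $ j) ^ e' j)"
        by (rule monomial_split; blast)
      then show ?thesis using zero[of e'] by (simp add: lin sphere_measure_linear)
    next
      case 3
      then obtain i e' where 1: "sum e' UNIV = Suc 0"
        "\<And>x :: real^'n::{finite,wellorder}. (\<Prod>j\<in>UNIV. (x $ j) ^ e j) = x $ i * (\<Prod>j\<in>UNIV. (x $ j) ^ e' j)"
        by (rule monomial_split; blast)
      obtain j e'' where "sum e'' UNIV = 0"
        "\<And>x :: real^'n::{finite,wellorder}. (\<Prod>j\<in>UNIV. (x $ j) ^ e' j) = x $ j * (\<Prod>j\<in>UNIV. (x $ j) ^ e'' j)"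
        using 1(1) by (rule monomial_split; blast)
      then show ?thesis using zero[of e''] 1(2) N by (simp add: quad sphere_measure_quadratic)
    next
      case 4
      then obtain i e' where 1: "sum e' UNIV = Suc (Suc 0)"
        "\<And>x :: real^'n::{finite,wellorder}. (\<Prod>j\<in>UNIV. (x $ j) ^ e j) = x $ i * (\<Prod>j\<in>UNIV. (x $ j) ^ e' j)"
        by (rule monomial_split; blast)
      obtain j e'' where 2: "sum e'' UNIV = Suc 0"
        "\<And>x :: real^'n::{finite,wellorder}. (\<Prod>j\<in>UNIV. (x $ j) ^ e' j) = x $ j * (\<Prod>j\<in>UNIV. (x $ j) ^ e'' j)"
        using 1(1) by (rule monomial_split; blast)
      obtain k e3 where "sum e3 UNIV = 0"
        "\<And>x :: real^'n::{finite,wellorder}. (\<Prod>j\<in>UNIV. (x $ j) ^ e'' j) = x $ k * (\<Prod>j\<in>UNIV. (x $ j) ^ e3 j)"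
        using 2(1) by (rule monomial_split; blast)
      then show ?thesis using zero[of e3] 1(2) 2(2) by (simp add: cub sphere_measure_cubic)
    qed
  qed
  have "(\<Sum>x\<in>C. p x) / N = integral\<^sup>L sphere_measure p" if p: "poly_fun_upto 3 p" for p
  proof -
    obtain c where p: "p = (\<lambda>x. \<Sum>e | sum e UNIV \<le> 3. c e * (\<Prod>i\<in>UNIV. (x $ i) ^ e i))"
      using p by (auto simp: poly_fun_upto_def)
    have int: "integrable sphere_measure (\<lambda>x :: real^'n::{finite,wellorder}. \<Prod>i\<in>UNIV. (x $ i) ^ e i)" for e
    proof (rule integrable_sphere_measure[where B = 1])
      fix x :: "real^'n::{finite,wellorder}" assume "norm x = 1"
      then show "\<bar>\<Prod>i\<in>UNIV. (x $ i) ^ e i\<bar> \<le> 1"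
        using component_le_norm_cart[of x] by (auto simp: abs_prod power_abs intro!: prod_le_1 power_le_one)
    qed simp
    have "(\<Sum>x\<in>C. p x) / N = (\<Sum>e | sum e UNIV \<le> 3. c e * ((\<Sum>x\<in>C. \<Prod>i\<in>UNIV. (x $ i) ^ e i) / N))"
      unfolding p by (subst sum.swap) (simp add: sum_distrib_left sum_divide_distrib)
    also have "\<dots> = (\<Sum>e | sum e UNIV \<le> 3. c e * (\<integral>x. (\<Prod>i\<in>UNIV. (x $ i) ^ e i) \<partial>sphere_measure))"
      by (rule sum.cong) (auto simp: mono)
    also have "\<dots> = integral\<^sup>L sphere_measure p"
      unfolding p using int by (subst Bochner_Integration.integral_sum) auto
    finally show ?thesis .
  qed
  then show ?thesis using C by (simp add: spherical_design_def N_def)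
qed

section \<open>The Golay code\<close>

definition qr_bits :: "bool list" where
  "qr_bits = [True, False, False, False, False, True, False, True, False, False, True, True,
     False, False, True, True, False, True, False, True, True, True, True]"

text \<open>Rotation to the left by \<open>23 - i\<close> is the cyclic shift by \<open>i\<close> to
  the right. The appended bit belongs to the label 23, the point at infinity.\<close>

definition qr_word :: "nat \<Rightarrow> bool list" where
  "qr_word i = rotate (23 - i) qr_bits @ [False]"

text \<open>The generator polynomial \<open>1 + x + x^5 + x^6 + x^7 + x^9 + x^11\<close> of the
  binary Golay code; with the parity bit at infinity its weight is 8. Its degree 11 puts the twelve
  shifts in echelon form, with leading positions 11 to 22.\<close>

definition octad_bits :: "bool list" where
  "octad_bits = [True, True, False, False, False, True, True, True, False, True, False, True,
     False, False, False, False, False, False, False, False, False, False, False]"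

definition octad_word :: "nat \<Rightarrow> bool list" where
  "octad_word i = rotate (23 - i) octad_bits @ [True]"

text \<open>
The code is self-orthogonal, so a codeword of weight 4 would yield two disjoint pairs of points
whose columns of the generator matrix have the same sum. The first 11 rows already exclude this.
\<close>

definition qr_column :: "nat \<Rightarrow> bool list" where
  "qr_column p = map (\<lambda>i. qr_word i ! p) [0..<11]"

lemma qr_words_card:
  "\<forall>i\<in>set [0..<23]. length (filter id (qr_word i)) = 12"
  by code_simp

lemma qr_words_even:
  "\<forall>i\<in>set [0..<23]. \<forall>j\<in>set [0..<23]. even (length (filter id (map2 (\<and>) (qr_word i) (qr_word j))))"
  by code_simp

text \<open>A membership certificate: the word is the all-ones word plus six generators. For
  \<open>i < 12\<close> the shifts \<open>j + i\<close> stay below 23, so no wrap-around has to be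
  treated.\<close>

lemma octad_words_sum:
  "\<forall>i\<in>set [0..<12]. octad_word i =
     foldr (map2 (\<noteq>)) (map (\<lambda>j. qr_word (j + i)) [1, 2, 4, 7, 9, 10]) (replicate 24 True)"
  by code_simp

text \<open>Written out literally, so that the evaluation of all 276 pair sums does not recompute
  the columns.\<close>

definition column_table :: "bool list list" where
  "column_table = [[True, True, True, True, True, False, True, False, True, True, False],
     [False, True, True, True, True, True, False, True, False, True, True],
     [False, False, True, True, True, True, True, False, True, False, True],
     [False, False, False, True, True, True, True, True, False, True, False],
     [False, False, False, False, True, True, True, True, True, False, True],
     [True, False, False, False, False, True, True, True, True, True, False],
     [False, True, False, False, False, False, True, True, True, True, True],
     [True, False, True, False, False, False, False, True, True, True, True],
     [False, True, False, True, False, False, False, False, True, True, True],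
     [False, False, True, False, True, False, False, False, False, True, True],
     [True, False, False, True, False, True, False, False, False, False, True],
     [True, True, False, False, True, False, True, False, False, False, False],
     [False, True, True, False, False, True, False, True, False, False, False],
     [False, False, True, True, False, False, True, False, True, False, False],
     [True, False, False, True, True, False, False, True, False, True, False],
     [True, True, False, False, True, True, False, False, True, False, True],
     [False, True, True, False, False, True, True, False, False, True, False],
     [True, False, True, True, False, False, True, True, False, False, True],
     [False, True, False, True, True, False, False, True, True, False, False],
     [True, False, True, False, True, True, False, False, True, True, False],
     [True, True, False, True, False, True, True, False, False, True, True],
     [True, True, True, False, True, False, True, True, False, False, True],
     [True, True, True, True, False, True, False, True, True, False, False],
     [False, False, False, False, False, False, False, False, False, False, False]]"

lemma column_table: "map qr_column [0..<24] = column_table"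
  by code_simp

text \<open>Splitting on the leading bit decides distinctness of 276 words of 11 bits without the
  almost 38000 comparisons of a pairwise check.\<close>

primrec radix_distinct :: "nat \<Rightarrow> bool list list \<Rightarrow> bool" where
  "radix_distinct 0 xss \<longleftrightarrow> length xss \<le> 1"
| "radix_distinct (Suc n) xss \<longleftrightarrow>
     radix_distinct n (map tl (filter hd xss)) \<and> radix_distinct n (map tl (filter (Not \<circ> hd) xss))"

lemma distinct_filters: "distinct (filter P xs) \<Longrightarrow> distinct (filter (Not \<circ> P) xs) \<Longrightarrow> distinct xs"
  by (induction xs) (auto split: if_splits)

lemma radix_distinct_imp_distinct: "radix_distinct n xss \<Longrightarrow> distinct xss"
proof (induction n arbitrary: xss)
  case 0
  then show ?case by (cases xss) auto
next
  case (Suc n)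
  then have "distinct (filter hd xss)" "distinct (filter (Not \<circ> hd) xss)"
    using distinct_map by (auto simp: comp_def)
  then show ?case by (rule distinct_filters)
qed

lemma column_table_distinct: "radix_distinct 11 column_table"
  by code_simp

lemma column_sums_distinct:
  "radix_distinct 11 (map (\<lambda>(p, q). map2 (\<noteq>) (column_table ! p) (column_table ! q))
     (concat (map (\<lambda>q. map (\<lambda>p. (p, q)) [0..<q]) [0..<24])))"
  by code_simp

section \<open>Bit lists as subsets of the 24 coordinates\<close>

lemma of_nat_24_eq_iff: "a < 24 \<Longrightarrow> b < 24 \<Longrightarrow> (of_nat a :: 24) = of_nat b \<longleftrightarrow> a = b"
  by (simp add: of_nat_eq_iff_cong_CHAR cong_def)

lemma inj_on_of_nat_24: "inj_on (of_nat :: nat \<Rightarrow> 24) {..<24}"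
  by (rule inj_onI) (simp add: of_nat_24_eq_iff)

lemma of_nat_24_image: "(of_nat :: nat \<Rightarrow> 24) ` {..<24} = UNIV"
  by (rule card_subset_eq) (simp_all add: card_image[OF inj_on_of_nat_24])

lemma of_nat_24_cases: obtains n where "n < 24" "(p :: 24) = of_nat n"
  using of_nat_24_image by (metis UNIV_I imageE lessThan_iff)

definition word :: "bool list \<Rightarrow> 24 set" where
  "word bs = {of_nat n | n. n < 24 \<and> bs ! n}"

lemma of_nat_in_word: "n < 24 \<Longrightarrow> of_nat n \<in> word bs \<longleftrightarrow> bs ! n"
  by (auto simp: word_def of_nat_24_eq_iff)

lemma set_24_eqI:
  assumes "\<And>n. n < 24 \<Longrightarrow> (of_nat n :: 24) \<in> A \<longleftrightarrow> of_nat n \<in> B"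
  shows "A = B"
  using assms of_nat_24_cases by (metis subsetI subset_antisym)

lemma card_word: assumes "length bs = 24" shows "card (word bs) = length (filter id bs)"
proof -
  have "word bs = of_nat ` {n. n < length bs \<and> bs ! n}" using assms by (auto simp: word_def)
  moreover have "inj_on (of_nat :: nat \<Rightarrow> 24) {n. n < length bs \<and> bs ! n}"
    using assms by (intro inj_on_subset[OF inj_on_of_nat_24]) auto
  ultimately show ?thesis by (simp add: card_image length_filter_conv_card)
qed

lemma word_Int:
  assumes "length xs = 24" "length ys = 24"
  shows "word xs \<inter> word ys = word (map2 (\<and>) xs ys)"
  by (rule set_24_eqI) (use assms in \<open>auto simp: of_nat_in_word\<close>)

lemma word_sym_diff:
  assumes "length xs = 24" "length ys = 24"
  shows "word (map2 (\<noteq>) xs ys) = sym_diff (word xs) (word ys)"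
  by (rule set_24_eqI) (use assms in \<open>auto simp: of_nat_in_word\<close>)

lemma length_qr_word [simp]: "length (qr_word i) = 24"
  by (simp add: qr_word_def qr_bits_def)

lemma length_octad_word [simp]: "length (octad_word i) = 24"
  by (simp add: octad_word_def octad_bits_def)

lemma qr_bits_nth: "\<forall>n\<in>set [0..<23]. qr_bits ! n \<longleftrightarrow> n \<in> {0, 5, 7, 10, 11, 14, 15, 17, 19, 20, 21, 22}"
  by code_simp

lemma qr_word_nth: assumes "i < 23" "n < 23" shows "qr_word i ! n \<longleftrightarrow> (n + (23 - i)) mod 23 \<in> {0, 5, 7, 10, 11, 14, 15, 17, 19, 20, 21, 22}"
proof -
  have len: "length qr_bits = 23" by (simp add: qr_bits_def)
  have "qr_word i ! n = qr_bits ! ((n + (23 - i)) mod 23)"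
    using assms by (simp add: qr_word_def nth_append nth_rotate len add.commute)
  also have "\<dots> \<longleftrightarrow> (n + (23 - i)) mod 23 \<in> {0, 5, 7, 10, 11, 14, 15, 17, 19, 20, 21, 22}"
    using qr_bits_nth by (metis atLeastLessThan_iff le0 mod_less_divisor set_upt zero_less_numeral)
  finally show ?thesis .
qed

lemma qr_word_nth_23: "\<not> qr_word i ! 23"
  by (simp add: qr_word_def nth_append qr_bits_def)

lemma golay_generators_eq: "golay_generators = insert UNIV ((\<lambda>i. word (qr_word i)) ` {..<23})"
proof -
  let ?Q = "{0, 5, 7, 10, 11, 14, 15, 17, 19, 20, 21, 22 :: nat}"
  have Q: "m < 23" if "m \<in> ?Q" for m using that by auto
  have *: "(\<lambda>n. of_nat ((n + i) mod 23)) ` ?Q = word (qr_word i)" if i: "i < 23" for i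
  proof (rule set_24_eqI)
    fix n :: nat assume n: "n < 24"
    have "(of_nat n :: 24) \<in> (\<lambda>n. of_nat ((n + i) mod 23)) ` ?Q \<longleftrightarrow> (\<exists>m\<in>?Q. n = (m + i) mod 23)"
    proof -
      have "(of_nat n :: 24) = of_nat ((m + i) mod 23) \<longleftrightarrow> n = (m + i) mod 23" for m
        using n by (intro of_nat_24_eq_iff) (auto intro: less_trans[OF mod_less_divisor])
      then show ?thesis by (simp only: image_iff)
    qed
    also have "\<dots> \<longleftrightarrow> qr_word i ! n"
    proof (cases "n = 23")
      case True
      have "(m + i) mod 23 \<noteq> 23" for m using mod_less_divisor[of 23 "m + i"] by linarith
      then show ?thesis using True qr_word_nth_23 by metis
    next
      case False
      then have n: "n < 23" using n by simp
      have "(\<exists>m\<in>?Q. n = (m + i) mod 23) \<longleftrightarrow> (n + (23 - i)) mod 23 \<in> ?Q" (is "?L \<longleftrightarrow> ?R")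
      proof
        assume ?L
        then obtain m where m: "m \<in> ?Q" "n = (m + i) mod 23" by blast
        have "(n + (23 - i)) mod 23 = (m + i + (23 - i)) mod 23" unfolding m(2) by (simp add: mod_simps)
        also have "\<dots> = m" using i Q[OF m(1)] by simp
        finally show ?R using m(1) by simp
      next
        assume R: ?R
        have "((n + (23 - i)) mod 23 + i) mod 23 = (n + (23 - i) + i) mod 23" by (simp add: mod_simps)
        also have "\<dots> = n" using i n by simp
        finally show ?L using R by (intro bexI[of _ "(n + (23 - i)) mod 23"]) simp_all
      qed
      then show ?thesis using qr_word_nth[OF i n] by simp
    qed
    finally show "(of_nat n :: 24) \<in> (\<lambda>n. of_nat ((n + i) mod 23)) ` ?Q \<longleftrightarrow> of_nat n \<in> word (qr_word i)"
      using n by (simp add: of_nat_in_word)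
  qed
  have "{(\<lambda>n. of_nat ((n + i) mod 23) :: 24) ` ?Q | i. i < 23} = (\<lambda>i. (\<lambda>n. of_nat ((n + i) mod 23)) ` ?Q) ` {..<23}"
    unfolding lessThan_def by (rule setcompr_eq_image)
  also have "\<dots> = (\<lambda>i. word (qr_word i)) ` {..<23}"
    by (rule image_cong[OF refl], rule *) (simp only: lessThan_iff)
  finally show ?thesis unfolding golay_generators_def by (rule arg_cong)
qed

section \<open>Weights and number of the codewords\<close>

lemma golay_generators_even:
  assumes "G \<in> golay_generators" "H \<in> golay_generators"
  shows "even (card (G \<inter> H))" "4 dvd card G"
proof -
  have c: "card (word (qr_word i)) = 12" if "i < 23" for i
    using qr_words_card that by (simp add: card_word)
  have e: "even (card (word (qr_word i) \<inter> word (qr_word j)))" if "i < 23" "j < 23" for i j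
    using qr_words_even that by (simp add: card_word word_Int)
  show "even (card (G \<inter> H))" "4 dvd card G"
    using assms c e by (auto simp: golay_generators_eq)
qed

lemma card_sym_diff_add:
  assumes "finite A" "finite B"
  shows "card (sym_diff A B) + 2 * card (A \<inter> B) = card A + card B"
proof -
  have "card (sym_diff A B) = card (A - B) + card (B - A)"
    using assms by (intro card_Un_disjoint) auto
  moreover have "card A = card (A - B) + card (A \<inter> B)"
    using assms by (subst card_Un_disjoint[symmetric]) (auto intro: arg_cong[where f = card])
  moreover have "card B = card (B - A) + card (A \<inter> B)"
    using assms by (subst card_Un_disjoint[symmetric]) (auto intro: arg_cong[where f = card])
  ultimately show ?thesis by simp
qed

lemma sym_diff_Int: "sym_diff A B \<inter> C = sym_diff (A \<inter> C) (B \<inter> C)"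
  by auto

lemma sym_diff_assoc: "sym_diff (sym_diff A B) C = sym_diff A (sym_diff B C)"
  by auto

lemma even_card_sym_diff:
  assumes "finite A" "finite B"
  shows "even (card (sym_diff A B)) \<longleftrightarrow> even (card A + card B)"
  using card_sym_diff_add[OF assms] by (metis even_add even_mult_iff even_numeral)

text \<open>Both claims go through one induction: by \<open>card_sym_diff_add\<close>, adding a
  generator keeps the weight divisible by 4 because the intersection with it is even.\<close>

lemma golay_doubly_even:
  assumes "S \<in> golay"
  shows "4 dvd card S" "G \<in> golay_generators \<Longrightarrow> even (card (S \<inter> G))"
proof -
  have "4 dvd card S \<and> (\<forall>G\<in>golay_generators. even (card (S \<inter> G)))"
    using assms
  proof induction
    case golay_empty then show ?case by simp
  next
    case (golay_add S G)
    have eq: "card (sym_diff S G) + 2 * card (S \<inter> G) = card S + card G"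
      by (rule card_sym_diff_add) auto
    obtain k where "card (S \<inter> G) = 2 * k" using golay_add by auto
    then have "card (sym_diff S G) + 4 * k = card S + card G" using eq by simp
    moreover have "4 dvd card S + card G" using golay_add golay_generators_even by auto
    ultimately have "4 dvd card (sym_diff S G)" by (metis dvd_add_left_iff dvd_triv_left)
    moreover have "even (card (sym_diff S G \<inter> H))" if "H \<in> golay_generators" for H
      unfolding sym_diff_Int using golay_add that golay_generators_even by (subst even_card_sym_diff) auto
    ultimately show ?case by simp
  qed
  then show "4 dvd card S" "G \<in> golay_generators \<Longrightarrow> even (card (S \<inter> G))" by auto
qed

lemma golay_sym_diff: "S \<in> golay \<Longrightarrow> T \<in> golay \<Longrightarrow> sym_diff S T \<in> golay"
proof -
  assume S: "S \<in> golay" and "T \<in> golay"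
  from this(2) show ?thesis
  proof induction
    case golay_empty
    then show ?case using S by simp
  next
    case (golay_add T G)
    have "sym_diff (sym_diff S T) G \<in> golay"
      by (rule golay.golay_add[OF golay_add.IH golay_add.hyps(2)])
    then show ?case by (simp only: sym_diff_assoc)
  qed
qed

lemma golay_generators_subset: "G \<in> golay_generators \<Longrightarrow> G \<in> golay"
  using golay.golay_add[OF golay_empty, of G] by simp

lemma golay_UNIV: "UNIV \<in> golay"
  by (rule golay_generators_subset) (simp add: golay_generators_def)

lemma golay_Compl: assumes "S \<in> golay" shows "- S \<in> golay"
proof -
  have "- S = sym_diff S UNIV" by auto
  then show ?thesis using golay_sym_diff[OF assms golay_UNIV] by simp
qed

lemma qr_word_golay: "i < 23 \<Longrightarrow> word (qr_word i) \<in> golay"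
  by (rule golay_generators_subset) (simp add: golay_generators_eq)

lemma octad_word_golay: assumes "i < 12" shows "word (octad_word i) \<in> golay"
proof -
  have *: "length (foldr (map2 (\<noteq>)) (map (\<lambda>j. qr_word (j + i)) js) (replicate 24 True)) = 24 \<and>
     word (foldr (map2 (\<noteq>)) (map (\<lambda>j. qr_word (j + i)) js) (replicate 24 True)) \<in> golay"
    if "\<forall>j\<in>set js. j + i < 23" for js
    using that
  proof (induction js)
    case Nil
    have "word (replicate 24 True) = UNIV" by (rule set_24_eqI) (simp add: of_nat_in_word)
    then show ?case using golay_UNIV by simp
  next
    case (Cons j js)
    let ?X = "foldr (map2 (\<noteq>)) (map (\<lambda>j. qr_word (j + i)) js) (replicate 24 True)"
    have X: "length ?X = 24" "word ?X \<in> golay" "j + i < 23" using Cons by auto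
    have "sym_diff (word (qr_word (j + i))) (word ?X) \<in> golay"
      by (rule golay_sym_diff[OF qr_word_golay[OF X(3)] X(2)])
    then show ?case using X(1)
      unfolding list.map foldr.simps o_apply word_sym_diff[OF length_qr_word X(1)] by simp
  qed
  have "\<forall>j\<in>set [1, 2, 4, 7, 9, 10]. j + i < 23" using assms by simp
  from *[OF this] show ?thesis using octad_words_sum assms by simp
qed

lemma octad_word_top:
  assumes "i < 12"
  shows "of_nat (11 + i) \<in> word (octad_word i)" "n < 23 \<Longrightarrow> 11 + i < n \<Longrightarrow> of_nat n \<notin> word (octad_word i)"
proof -
  have len: "length octad_bits = 23" by (simp add: octad_bits_def)
  have nth: "octad_word i ! n = octad_bits ! ((n + (23 - i)) mod 23)" if "n < 23" for n
    using assms that by (simp add: octad_word_def nth_append nth_rotate len add.commute)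
  have "(11 + i + (23 - i)) mod 23 = 11" using assms by simp
  then have "octad_word i ! (11 + i)" using assms by (subst nth) (auto simp: octad_bits_def)
  then show "of_nat (11 + i) \<in> word (octad_word i)" using assms of_nat_in_word[of "11 + i"] by simp
  have bits: "\<forall>m\<in>set [12..<23]. \<not> octad_bits ! m" by code_simp
  assume n: "n < 23" "11 + i < n"
  then have "(n + (23 - i)) mod 23 = n - i"
    by (subst le_mod_geq) auto
  moreover have "n - i \<in> set [12..<23]" unfolding set_upt atLeastLessThan_iff using n by linarith
  ultimately have "\<not> octad_word i ! n" using bits nth[OF n(1)] by metis
  then show "of_nat n \<notin> word (octad_word i)" using n by (simp add: of_nat_in_word)
qed

lemma finite_golay [simp]: "finite golay"
  by (rule finite_subset[OF subset_UNIV]) simp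

text \<open>\<open>H m\<close> collects the codewords that vanish at the finite positions from
  \<open>m\<close> on. The \<open>k\<close>-th shift of the generator polynomial has its last finite
  position at \<open>11 + k\<close>, so adding it embeds a disjoint copy of
  \<open>H (11 + k)\<close> in \<open>H (11 + Suc k)\<close>. Twelve doublings start from the empty
  word.\<close>

lemma card_golay_ge: "card golay \<ge> 4096"
proof -
  define H where "H m = {S \<in> golay. \<forall>n<23. m \<le> n \<longrightarrow> of_nat n \<notin> S}" for m
  have "card (H (11 + k)) \<ge> 2 ^ k" if "k \<le> 12" for k
    using that
  proof (induction k)
    case 0
    have "{} \<in> H 11" by (simp add: H_def golay_empty)
    moreover have "finite (H 11)" by (simp add: H_def)
    ultimately have "card (H 11) > 0" by (auto simp: card_gt_0_iff)
    then show ?case by simp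
  next
    case (Suc k)
    let ?w = "word (octad_word k)"
    have k: "k < 12" using Suc by simp
    have fin: "finite (H m)" for m by (simp add: H_def)
    have sub: "H (11 + k) \<union> sym_diff ?w ` H (11 + k) \<subseteq> H (11 + Suc k)"
      using octad_word_top[OF k] octad_word_golay[OF k]
      by (auto simp: H_def intro!: golay_sym_diff)
    have "S \<noteq> sym_diff ?w S'" if "S \<in> H (11 + k)" "S' \<in> H (11 + k)" for S S'
    proof -
      have "of_nat (11 + k) \<notin> S" "of_nat (11 + k) \<notin> S'" using that k by (auto simp: H_def simp del: of_nat_add)
      then show ?thesis using octad_word_top(1)[OF k] by blast
    qed
    then have disj: "H (11 + k) \<inter> sym_diff ?w ` H (11 + k) = {}" by blast
    have inj: "inj_on (sym_diff ?w) (H (11 + k))" by (rule inj_onI) blast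
    have "2 ^ Suc k \<le> card (H (11 + k)) + card (sym_diff ?w ` H (11 + k))"
      using Suc inj by (simp add: card_image)
    also have "\<dots> = card (H (11 + k) \<union> sym_diff ?w ` H (11 + k))"
      using fin disj by (simp add: card_Un_disjoint)
    also have "\<dots> \<le> card (H (11 + Suc k))" using fin sub by (rule card_mono)
    finally show ?case .
  qed
  from this[of 12] have "2 ^ 12 \<le> card (H 23)" by simp
  also have "card (H 23) \<le> card golay" by (rule card_mono) (auto simp: H_def)
  finally show ?thesis by simp
qed

lemma column_nth: "i < 11 \<Longrightarrow> p < 24 \<Longrightarrow> qr_column p ! i \<longleftrightarrow> of_nat p \<in> word (qr_word i)"
  by (simp add: qr_column_def of_nat_in_word)

lemma length_column [simp]: "length (qr_column p) = 11"
  by (simp add: qr_column_def)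

lemma column_table_nth: "p < 24 \<Longrightarrow> column_table ! p = qr_column p"
  by (simp add: column_table[symmetric])

lemma column_inj: assumes "p < 24" "q < 24" "qr_column p = qr_column q" shows "p = q"
proof -
  have "distinct column_table" using column_table_distinct by (rule radix_distinct_imp_distinct)
  moreover have "length column_table = 24" by (simp add: column_table[symmetric])
  ultimately show ?thesis using assms by (simp add: column_table_nth[symmetric] nth_eq_iff_index_eq)
qed

lemma column_sum_inj:
  assumes "p < q" "q < 24" "r < s" "s < 24"
    and "map2 (\<noteq>) (qr_column p) (qr_column q) = map2 (\<noteq>) (qr_column r) (qr_column s)"
  shows "p = r" "q = s"
proof -
  let ?P = "concat (map (\<lambda>q. map (\<lambda>p. (p, q)) [0..<q]) [0..<24])"
  let ?f = "\<lambda>(p, q). map2 (\<noteq>) (column_table ! p) (column_table ! q)"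
  have "distinct (map ?f ?P)" by (rule radix_distinct_imp_distinct[OF column_sums_distinct])
  then have inj: "inj_on ?f (set ?P)" by (simp only: distinct_map)
  have mem: "(p, q) \<in> set ?P" "(r, s) \<in> set ?P" using assms by (auto simp: image_iff Bex_def)
  have "?f (p, q) = ?f (r, s)" using assms by (simp add: column_table_nth)
  from inj_onD[OF inj this mem] have "(p, q) = (r, s)" .
  then show "p = r" "q = s" by auto
qed

lemma golay_card_neq_4: assumes S: "S \<in> golay" shows "card S \<noteq> 4"
proof
  assume c: "card S = 4"
  define A where "A = {n. n < 24 \<and> of_nat n \<in> S}"
  have fin: "finite A" by (simp add: A_def)
  have SA: "S = of_nat ` A" by (rule set_24_eqI) (auto simp: A_def of_nat_24_eq_iff)
  have inj: "inj_on (of_nat :: nat \<Rightarrow> 24) A"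
    by (rule inj_on_subset[OF inj_on_of_nat_24]) (auto simp: A_def)
  have "card A = 4" using c by (simp add: SA card_image[OF inj])
  define xs where "xs = sorted_list_of_set A"
  have xs: "sorted_wrt (<) xs" "set xs = A" "length xs = 4"
    using fin \<open>card A = 4\<close> by (simp_all add: xs_def)
  then obtain a b c d where abcd: "xs = [a, b, c, d]"
    by (auto simp: length_Suc_conv numeral_eq_Suc)
  have lt: "a < b" "b < c" "c < d" "d < 24" and A: "A = {a, b, c, d}"
    using xs abcd by (auto simp: A_def)
  \<comment> \<open>An even number of the four columns have a one in row \<open>i\<close>, so the
    bit sums of the two pairs agree in that row.\<close>
  have "map2 (\<noteq>) (qr_column a) (qr_column b) = map2 (\<noteq>) (qr_column c) (qr_column d)"
  proof (rule nth_equalityI)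
    fix i assume "i < length (map2 (\<noteq>) (qr_column a) (qr_column b))"
    then have i: "i < 11" by simp
    let ?G = "word (qr_word i)"
    have "even (card (S \<inter> ?G))"
      using i by (intro golay_doubly_even(2)[OF S]) (simp add: golay_generators_eq)
    also have "S \<inter> ?G = of_nat ` {n \<in> A. qr_column n ! i}"
      by (rule set_24_eqI) (use i in \<open>auto simp: A_def column_nth of_nat_24_eq_iff\<close>)
    also have "card (of_nat ` {n \<in> A. qr_column n ! i} :: 24 set) = card {n \<in> A. qr_column n ! i}"
      by (rule card_image) (rule inj_on_subset[OF inj], auto)
    also have "card {n \<in> A. qr_column n ! i} = (\<Sum>n\<in>A. if qr_column n ! i then 1 else 0)"
      using fin by (simp add: sum.If_cases Int_def)
    finally have "even (\<Sum>n\<in>A. if qr_column n ! i then 1 else 0 :: nat)" .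
    then show "map2 (\<noteq>) (qr_column a) (qr_column b) ! i = map2 (\<noteq>) (qr_column c) (qr_column d) ! i"
      using i lt by (auto simp: A split: if_splits)
  qed simp
  then have "a = c" using column_sum_inj[of a b c d] lt by simp
  then show False using lt by simp
qed

lemma card_Compl_24: "card (- S :: 24 set) = 24 - card S"
  by (simp add: Compl_eq_Diff_UNIV card_Diff_subset)

text \<open>Among the multiples of 4 up to 24 only 4 and 20 have to be excluded, and complementation
  takes 20 to 4.\<close>

lemma golay_card:
  assumes "S \<in> golay"
  shows "card S \<in> {0, 8, 12, 16, 24}"
proof -
  have "4 dvd card S" "4 dvd card (- S)" "card S \<noteq> 4" "card (- S) \<noteq> 4"
    using assms golay_doubly_even golay_card_neq_4 golay_Compl by auto
  moreover have "card (- S) = 24 - card S" by (simp add: card_Compl_24)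
  moreover have "card S \<le> 24" using card_mono[of UNIV S] by simp
  moreover from \<open>4 dvd card S\<close> obtain k where k: "card S = 4 * k" by blast
  ultimately have "k \<le> 6" "k \<noteq> 1" "k \<noteq> 5" by auto
  then have "k \<in> {0, 2, 3, 4, 6}" by auto
  then show ?thesis using k by auto
qed

lemma golay_separates:
  assumes "p \<noteq> q"
  obtains G where "G \<in> golay" "p \<in> G \<longleftrightarrow> q \<notin> G"
proof -
  obtain m where m: "m < 24" "p = of_nat m" by (rule of_nat_24_cases)
  obtain n where n: "n < 24" "q = of_nat n" by (rule of_nat_24_cases)
  have "qr_column m \<noteq> qr_column n" using column_inj m n assms by auto
  then obtain i where i: "i < 11" "qr_column m ! i \<noteq> qr_column n ! i"
    using nth_equalityI[of "qr_column m" "qr_column n"] by auto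
  then show ?thesis using m n column_nth qr_word_golay[of i]
    by (intro that[of "word (qr_word i)"]) auto
qed

text \<open>Orthogonality of characters replaces the enumeration of the codewords.\<close>

lemma golay_sum_squares: "(\<Sum>S\<in>golay. (24 - 2 * int (card S))\<^sup>2) = 24 * int (card golay)"
proof -
  define v :: "24 set \<Rightarrow> 24 \<Rightarrow> int" where "v S p = (if p \<in> S then -1 else 1)" for S p
  have sum: "24 - 2 * int (card S) = (\<Sum>p\<in>UNIV. v S p)" for S
  proof -
    have "(\<Sum>p\<in>UNIV. v S p) = (\<Sum>p\<in>S. -1) + (\<Sum>p\<in>-S. 1)"
      by (simp add: v_def sum.If_cases)
    also have "\<dots> = 24 - 2 * int (card S)"
      using card_mono[of UNIV S] by (simp add: card_Compl_24 of_nat_diff)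
    finally show ?thesis by simp
  qed
  have orth: "(\<Sum>S\<in>golay. v S p * v S q) = (if p = q then int (card golay) else 0)" for p q
  proof (cases "p = q")
    case True
    then show ?thesis by (simp add: v_def if_distrib cong: if_cong) 
  next
    case False
    then obtain G where G: "G \<in> golay" "p \<in> G \<longleftrightarrow> q \<notin> G" by (rule golay_separates)
    \<comment> \<open>Translation by a codeword that separates \<open>p\<close> and \<open>q\<close>
      permutes the code and flips the sign of every term.\<close>
    have "(\<Sum>S\<in>golay. v S p * v S q) = (\<Sum>S\<in>golay. v (sym_diff S G) p * v (sym_diff S G) q)"
      by (rule sum.reindex_bij_witness[of _ "\<lambda>S. sym_diff S G" "\<lambda>S. sym_diff S G"])
         (use G in \<open>auto simp: sym_diff_assoc intro!: golay_sym_diff\<close>)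
    also have "\<dots> = (\<Sum>S\<in>golay. - (v S p * v S q))"
      by (rule sum.cong) (use G in \<open>auto simp: v_def\<close>)
    finally show ?thesis using False by (simp add: sum_negf)
  qed
  have "(\<Sum>S\<in>golay. (24 - 2 * int (card S))\<^sup>2) = (\<Sum>S\<in>golay. \<Sum>p\<in>UNIV. \<Sum>q\<in>UNIV. v S p * v S q)"
    by (simp add: sum power2_eq_square sum_product)
  also have "\<dots> = (\<Sum>p\<in>UNIV. \<Sum>q\<in>UNIV. \<Sum>S\<in>golay. v S p * v S q)"
    by (subst sum.swap, rule sum.cong[OF refl], rule sum.swap)
  also have "\<dots> = 24 * int (card golay)" by (simp add: orth)
  finally show ?thesis .
qed

definition octads :: "24 set set" where
  "octads = {S \<in> golay. card S = 8}"

text \<open>In the sum of squares the words of weight 12 have coefficient 0, weights 0 and 24 give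
  576 each, and weights 8 and 16 occur equally often and give 64 per word. So
  \<open>1152 + 128 * card octads = 24 * card golay\<close>, and 4096 codewords yield 759.\<close>

lemma card_octads_ge: "card octads \<ge> 759"
proof -
  let ?W = "\<lambda>w. {S \<in> golay. card S = w}"
  have zero: "?W 0 = {{}}" using golay_empty by auto
  have full: "?W 24 = {UNIV}" using golay_UNIV card_eq_UNIV_imp_eq_UNIV by fastforce
  have bij: "card (?W 16) = card (?W 8)"
    by (rule bij_betw_same_card[of uminus], rule bij_betwI[of _ _ _ uminus])
       (auto simp: golay_Compl card_Compl_24)
  define n where "n w = card (?W w)" for w
  have n: "n 0 = 1" "n 24 = 1" "n 16 = n 8" "n 8 = card octads"
    unfolding n_def zero full bij octads_def by simp_all
  have "(\<Sum>S\<in>golay. (24 - 2 * int (card S))\<^sup>2)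
      = (\<Sum>w\<in>{0, 8, 12, 16, 24}. \<Sum>S\<in>?W w. (24 - 2 * int (card S))\<^sup>2)"
    by (rule sum.group[symmetric]) (use golay_card in \<open>simp_all add: image_subset_iff\<close>)
  also have "\<dots> = (\<Sum>w\<in>{0, 8, 12, 16, 24}. (24 - 2 * int w)\<^sup>2 * int (n w))"
    by (rule sum.cong) (auto simp: n_def)
  also have "\<dots> = 1152 + 128 * int (card octads)"
    by (simp add: n)
  finally have "1152 + 128 * int (card octads) \<ge> 24 * 4096"
    using golay_sum_squares card_golay_ge by simp
  then show ?thesis by simp
qed

section \<open>The Leech lattice\<close>

definition leech_int :: "(24 \<Rightarrow> int) \<Rightarrow> bool" where
  "leech_int z \<longleftrightarrow> (\<exists>m. (\<forall>i. [z i = m] (mod 2)) \<and> [(\<Sum>i\<in>UNIV. z i) = 4 * m] (mod 8) \<and>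
     (\<forall>k. {i. [z i = k] (mod 4)} \<in> golay))"

lemma sum_of_bool_int: "(\<Sum>i\<in>UNIV. of_bool (i \<in> A)) = int (card (A :: 24 set))"
  by (simp add: of_bool_def sum.If_cases)

lemma golay_card_int: assumes "A \<in> golay" obtains k where "int (card A) = 4 * k"
  using golay_doubly_even(1)[OF assms] by (metis dvd_def int_ops(7) of_nat_numeral)

text \<open>A parametrization without congruences for single coordinates. The condition modulo 8
  shrinks to a parity of \<open>sum b UNIV\<close>, because \<open>2 * card A\<close> is divisible
  by 8 and \<open>24 m\<close> and \<open>4 m\<close> differ by \<open>4 m\<close> modulo 8.\<close>

lemma leech_int_iff:
  "leech_int z \<longleftrightarrow> (\<exists>m A b. A \<in> golay \<and> (\<forall>i. z i = m + 2 * of_bool (i \<in> A) + 4 * b i) \<and>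
     even (sum b UNIV - m))"
proof
  assume "leech_int z"
  then obtain m where m: "\<And>i. [z i = m] (mod 2)" "[(\<Sum>i\<in>UNIV. z i) = 4 * m] (mod 8)"
      "\<And>k. {i. [z i = k] (mod 4)} \<in> golay" by (auto simp: leech_int_def)
  define A where "A = {i. [z i = m + 2] (mod 4)}"
  define b where "b i = (z i - m - 2 * of_bool (i \<in> A)) div 4" for i
  have A: "A \<in> golay" using m(3) by (simp add: A_def)
  have z: "z i = m + 2 * of_bool (i \<in> A) + 4 * b i" for i
  proof -
    have "4 dvd z i - m - 2 * of_bool (i \<in> A)"
      using m(1)[of i] by (auto simp: A_def cong_iff_dvd_diff of_bool_def) presburger+
    then show ?thesis by (simp add: b_def)
  qed
  obtain k where k: "int (card A) = 4 * k" using A by (rule golay_card_int)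
  have "(\<Sum>i\<in>UNIV. z i) = 24 * m + 2 * int (card A) + 4 * sum b UNIV"
    by (simp add: z sum.distrib sum_distrib_left[symmetric] sum_of_bool_int del: sum_of_bool_eq)
  then have "8 dvd 24 * m + 8 * k + 4 * sum b UNIV - 4 * m"
    using m(2) k by (simp add: cong_iff_dvd_diff)
  then have "even (sum b UNIV - m)" by presburger
  with A z show "\<exists>m A b. A \<in> golay \<and> (\<forall>i. z i = m + 2 * of_bool (i \<in> A) + 4 * b i) \<and> even (sum b UNIV - m)"
    by blast
next
  assume "\<exists>m A b. A \<in> golay \<and> (\<forall>i. z i = m + 2 * of_bool (i \<in> A) + 4 * b i) \<and> even (sum b UNIV - m)"
  then obtain m A b where A: "A \<in> golay" and z: "\<And>i. z i = m + 2 * of_bool (i \<in> A) + 4 * b i"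
    and b: "even (sum b UNIV - m)" by blast
  obtain k where k: "int (card A) = 4 * k" using A by (rule golay_card_int)
  have "(\<Sum>i\<in>UNIV. z i) = 24 * m + 2 * int (card A) + 4 * sum b UNIV"
    by (simp add: z sum.distrib sum_distrib_left[symmetric] sum_of_bool_int del: sum_of_bool_eq)
  then have "(\<Sum>i\<in>UNIV. z i) - 4 * m = 20 * m + 8 * k + 4 * sum b UNIV" using k by simp
  moreover have "8 dvd 20 * m + 8 * k + 4 * sum b UNIV" using b by presburger
  ultimately have "[(\<Sum>i\<in>UNIV. z i) = 4 * m] (mod 8)" by (simp only: cong_iff_dvd_diff)
  moreover have "[z i = m] (mod 2)" for i by (simp add: z cong_iff_dvd_diff)
  \<comment> \<open>The class of \<open>m + 2\<close> is \<open>A\<close>, that of \<open>m\<close>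
    is its complement, and the two classes of the other parity are empty.\<close>
  moreover have "{i. [z i = k] (mod 4)} \<in> golay" for k
  proof -
    have "[z i = k] (mod 4) \<longleftrightarrow> (if i \<in> A then 4 dvd m + 2 - k else 4 dvd m - k)" for i
    proof -
      have "z i - k = (m + 2 * of_bool (i \<in> A) - k) + 4 * b i" by (simp add: z)
      then have "4 dvd z i - k \<longleftrightarrow> 4 dvd m + 2 * of_bool (i \<in> A) - k"
        by (simp only:) (rule dvd_add_left_iff, simp)
      then show ?thesis by (cases "i \<in> A") (simp_all add: cong_iff_dvd_diff)
    qed
    moreover have "\<not> (4 dvd m + 2 - k \<and> 4 dvd m - k)" by presburger
    ultimately have "{i. [z i = k] (mod 4)} \<in> {A, - A, {}}" by auto
    then show ?thesis using A golay_Compl golay_empty by auto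
  qed
  ultimately show "leech_int z" unfolding leech_int_def by blast
qed

lemma leech_intI:
  assumes "A \<in> golay" "\<And>i. z i = m + 2 * of_bool (i \<in> A) + 4 * b i" "even (sum b UNIV - m)"
  shows "leech_int z"
  unfolding leech_int_iff using assms by (intro exI[of _ m] exI[of _ A] exI[of _ b]) simp

lemma golay_even_Int: assumes "A \<in> golay" "B \<in> golay" shows "even (card (A \<inter> B))"
proof -
  have "card (sym_diff A B) + 2 * card (A \<inter> B) = card A + card B"
    by (rule card_sym_diff_add) auto
  moreover have "4 dvd card (sym_diff A B)" "4 dvd card A" "4 dvd card B"
    using assms golay_sym_diff golay_doubly_even(1) by auto
  ultimately have "4 dvd 2 * card (A \<inter> B)" by (metis dvd_add dvd_add_right_iff)
  then show ?thesis by presburger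
qed

lemma leech_int_diff: assumes "leech_int z" "leech_int w" shows "leech_int (\<lambda>i. z i - w i)"
proof -
  obtain m A b where A: "A \<in> golay" and z: "\<And>i. z i = m + 2 * of_bool (i \<in> A) + 4 * b i"
    and b: "even (sum b UNIV - m)" using assms(1) unfolding leech_int_iff by blast
  obtain n B c where B: "B \<in> golay" and w: "\<And>i. w i = n + 2 * of_bool (i \<in> B) + 4 * c i"
    and c: "even (sum c UNIV - n)" using assms(2) unfolding leech_int_iff by blast
  \<comment> \<open>The indicator of \<open>A\<close> minus that of \<open>B\<close> is the
    indicator of the symmetric difference minus twice that of \<open>B - A\<close>; the last part is
    the carry into the coefficient of 4. It has even total because \<open>B\<close> and
    \<open>A \<inter> B\<close> have even size.\<close>
  define d where "d i = b i - c i - of_bool (i \<in> B - A)" for i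
  have "int (card (B - A)) = int (card B) - int (card (A \<inter> B))"
    by (simp add: card_Diff_subset_Int Int_commute of_nat_diff card_mono)
  moreover have "even (card B)" using golay_doubly_even(1)[OF B] by presburger
  ultimately have "even (int (card (B - A)))" using golay_even_Int[OF A B] by simp
  moreover have "sum d UNIV = sum b UNIV - sum c UNIV - int (card (B - A))"
    by (simp only: d_def[abs_def] sum_subtractf sum_of_bool_int)
  ultimately have "even (sum d UNIV - (m - n))" using b c by presburger
  moreover have "z i - w i = (m - n) + 2 * of_bool (i \<in> sym_diff A B) + 4 * d i" for i
    by (auto simp: z w d_def)
  ultimately show ?thesis
    unfolding leech_int_iff using golay_sym_diff[OF A B] by blast
qed

lemma leech_int_sum_squares: assumes "leech_int z" shows "16 dvd (\<Sum>i\<in>UNIV. (z i)\<^sup>2)"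
proof -
  obtain m A b where A: "A \<in> golay" and z: "\<And>i. z i = m + 2 * of_bool (i \<in> A) + 4 * b i"
    and b: "even (sum b UNIV - m)" using assms unfolding leech_int_iff by blast
  obtain k where k: "int (card A) = 4 * k" using A by (rule golay_card_int)
  obtain l where l: "sum b UNIV = m + 2 * l" using b by (metis add.commute diff_add_cancel dvd_def)
  define e where "e i = (b i)\<^sup>2 + of_bool (i \<in> A) * b i" for i
  have "(z i)\<^sup>2 = m\<^sup>2 + 4 * (1 + m) * of_bool (i \<in> A) + 8 * m * b i + 16 * e i" for i
    by (simp add: z e_def power2_eq_square algebra_simps of_bool_def)
  then have "(\<Sum>i\<in>UNIV. (z i)\<^sup>2) = 24 * m\<^sup>2 + 4 * (1 + m) * int (card A) + 8 * m * sum b UNIV + 16 * sum e UNIV"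
    by (simp add: sum.distrib sum_distrib_left[symmetric] sum_of_bool_int del: sum_of_bool_eq)
  also have "\<dots> = 16 * (2 * m\<^sup>2 + (1 + m) * k + m * l + sum e UNIV)"
    unfolding k l by (simp add: algebra_simps power2_eq_square)
  finally show ?thesis by simp
qed

text \<open>For odd \<open>m\<close> all 24 coordinates are odd, and divisibility by 16 lifts 24 to
  32. For even \<open>m\<close> the coordinates congruent to 2 modulo 4 form the codeword
  \<open>B\<close>: if it is nonempty, at least 8 squares are at least 4; if it is empty,
  \<open>z = 4 c\<close> with an even coordinate sum, so the sum of the squares of \<open>c\<close>
  is even and positive.\<close>

lemma leech_int_min: assumes "leech_int z" "z i \<noteq> 0" shows "(\<Sum>i\<in>UNIV. (z i)\<^sup>2) \<ge> 32"
proof -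
  let ?S = "\<Sum>i\<in>UNIV. (z i)\<^sup>2"
  obtain m A b where A: "A \<in> golay" and z: "\<And>i. z i = m + 2 * of_bool (i \<in> A) + 4 * b i"
    and b: "even (sum b UNIV - m)" using assms unfolding leech_int_iff by blast
  have d: "16 dvd ?S" using assms(1) by (rule leech_int_sum_squares)
  have ge: "?S \<ge> c * int (card B)" if "\<And>i. i \<in> B \<Longrightarrow> c \<le> (z i)\<^sup>2" for B c
  proof -
    have "c * int (card B) = (\<Sum>i\<in>B. c)" by simp
    also have "\<dots> \<le> (\<Sum>i\<in>B. (z i)\<^sup>2)" by (rule sum_mono) (rule that)
    also have "\<dots> \<le> ?S" by (rule sum_mono2) auto
    finally show ?thesis .
  qed
  have sq: "1 \<le> t\<^sup>2" if "t \<noteq> 0" for t :: int using that by (simp add: int_one_le_iff_zero_less)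
  have sq4: "4 * c\<^sup>2 \<le> (2 * t)\<^sup>2" if "c\<^sup>2 \<le> t\<^sup>2" for t c :: int using that by (simp add: power_mult_distrib)
  show ?thesis
  proof (cases "odd m")
    case True
    have "odd (z i)" for i using True by (simp add: z)
    then have "z i \<noteq> 0" for i by (metis even_zero)
    then have "?S \<ge> 1 * int (card (UNIV :: 24 set))" by (intro ge sq)
    then show ?thesis using d by (simp, presburger)
  next
    case False
    then obtain n where n: "m = 2 * n" by blast
    define B where "B = (if even n then A else - A)"
    have B: "B \<in> golay" using A golay_Compl by (simp add: B_def)
    have zB: "z i = 2 * (n + of_bool (i \<in> A) + 2 * b i)" "odd (n + of_bool (i \<in> A) + 2 * b i) \<longleftrightarrow> i \<in> B" for i
      by (auto simp: z n B_def)
    show ?thesis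
    proof (cases "B = {}")
      case False
      then have "card B \<noteq> 0" by simp
      then have "card B \<ge> 8" using golay_card[OF B] by auto
      moreover have "4 \<le> (z i)\<^sup>2" if "i \<in> B" for i
      proof -
        have "odd (n + of_bool (i \<in> A) + 2 * b i)" using zB(2) that by blast
        then have "n + of_bool (i \<in> A) + 2 * b i \<noteq> 0" by (metis even_zero)
        then have "4 * 1\<^sup>2 \<le> (z i)\<^sup>2" unfolding zB(1) by (intro sq4) (simp add: sq)
        then show ?thesis by simp
      qed
      then have "?S \<ge> 4 * int (card B)" by (rule ge)
      ultimately show ?thesis by simp
    next
      case True
      define c where "c i = (n + of_bool (i \<in> A) + 2 * b i) div 2" for i
      have zc: "z i = 4 * c i" for i
      proof -
        have "even (n + of_bool (i \<in> A) + 2 * b i)" using zB(2) True by blast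
        then have "2 * c i = n + of_bool (i \<in> A) + 2 * b i" unfolding c_def by (rule dvd_mult_div_cancel)
        with zB(1)[of i] have "z i = 2 * (2 * c i)" by (simp only:)
        then show ?thesis by simp
      qed
      have "c i \<noteq> 0" using assms(2) by (simp add: zc)
      have "sum c UNIV = sum b UNIV + (\<Sum>i\<in>UNIV. (n + of_bool (i \<in> A)) div 2)"
        by (simp add: c_def sum.distrib[symmetric])
      \<comment> \<open>With \<open>B\<close> empty, \<open>A\<close> is empty or everything
        according to the parity of \<open>n\<close>, so all 24 coordinates contribute the same
        integer and the total is even.\<close>
      also have "(\<Sum>i\<in>UNIV. (n + of_bool (i \<in> A)) div 2) = 24 * (if even n then n div 2 else (n + 1) div 2)"
      proof -
        have "A = (if even n then {} else UNIV)" using True by (auto simp: B_def split: if_splits)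
        then show ?thesis by simp
      qed
      finally have "even (sum c UNIV)" using b n by auto
      have "?S = 16 * (\<Sum>i\<in>UNIV. (c i)\<^sup>2)" by (simp add: zc power_mult_distrib sum_distrib_left)
      moreover have "even (\<Sum>i\<in>UNIV. (c i)\<^sup>2)"
      proof -
        have "even ((\<Sum>i\<in>UNIV. (c i)\<^sup>2) - sum c UNIV)"
          unfolding sum_subtractf[symmetric] by (rule dvd_sum) simp
        then show ?thesis using \<open>even (sum c UNIV)\<close> by simp
      qed
      moreover have "(\<Sum>i\<in>UNIV. (c i)\<^sup>2) > 0"
        using \<open>c i \<noteq> 0\<close> by (intro sum_pos2[where i = i]) auto
      ultimately show ?thesis by presburger
    qed
  qed
qed

section \<open>Minimal vectors and their number\<close>

definition leech_min :: "(24 \<Rightarrow> int) set" where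
  "leech_min = {z. leech_int z \<and> (\<Sum>i\<in>UNIV. (z i)\<^sup>2) = 32}"

lemma finite_leech_min: "finite leech_min"
proof (rule finite_subset)
  show "leech_min \<subseteq> (\<Pi>\<^sub>E i\<in>UNIV. {-5..5})"
  proof
    fix z assume z: "z \<in> leech_min"
    have "z i \<in> {-5..5}" for i
    proof -
      have "(z i)\<^sup>2 \<le> (\<Sum>i\<in>UNIV. (z i)\<^sup>2)" by (rule member_le_sum) auto
      then have "(z i)\<^sup>2 < 6\<^sup>2" using z by (simp add: leech_min_def)
      then have "\<bar>z i\<bar> < 6" by (metis abs_numeral power2_abs power_less_imp_less_base zero_le_numeral)
      then show ?thesis by auto
    qed
    then show "z \<in> (\<Pi>\<^sub>E i\<in>UNIV. {-5..5})" by (auto simp: PiE_UNIV_domain)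
  qed
qed (auto intro: finite_PiE)

text \<open>Covers the two even shapes of minimal vectors: \<open>c = 4\<close> on two positions
  with arbitrary signs, and \<open>c = 2\<close> on an octad with evenly many minus signs.\<close>

definition signed_vec :: "int \<Rightarrow> 24 set \<times> 24 set \<Rightarrow> 24 \<Rightarrow> int" where
  "signed_vec c = (\<lambda>(P, N) i. if i \<in> N then - c else if i \<in> P then c else 0)"

text \<open>The odd shape: one entry of absolute value 3 among entries of absolute value 1, all
  residues modulo 4 being governed by the codeword \<open>A\<close>.\<close>

definition odd_vec :: "24 set \<times> 24 \<Rightarrow> 24 \<Rightarrow> int" where
  "odd_vec = (\<lambda>(A, p) i. (if i \<in> A then -1 else 1) * (if i = p then -3 else 1))"

lemma inj_signed_vec: assumes "c > 0" shows "inj_on (signed_vec c) {(P, N). N \<subseteq> P}"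
proof (rule inj_onI, clarify)
  fix P N P' N' :: "24 set" assume sub: "N \<subseteq> P" "N' \<subseteq> P'" and eq: "signed_vec c (P, N) = signed_vec c (P', N')"
  have "N = {i. signed_vec c (P, N) i < 0}" "P = {i. signed_vec c (P, N) i \<noteq> 0}" if "N \<subseteq> P" for P N :: "24 set"
    using assms that by (auto simp: signed_vec_def)
  then show "P = P' \<and> N = N'" using sub eq by metis
qed

lemma inj_odd_vec: "inj odd_vec"
proof (rule injI, clarify)
  fix A A' :: "24 set" and p p' assume eq: "odd_vec (A, p) = odd_vec (A', p')"
  have p: "{p} = {i. \<bar>odd_vec (A, p) i\<bar> = 3}" and A: "A = {i. odd_vec (A, p) i \<in> {-1, 3}}" for A :: "24 set" and p
    by (auto simp: odd_vec_def)
  have "{p} = {p'}" unfolding p[of p A] p[of p' A'] eq by simp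
  moreover have "A = A'" by (subst A[of A p], subst A[of A' p']) (simp add: eq)
  ultimately show "A = A' \<and> p = p'" by simp
qed

lemma sum_squares_signed_vec:
  assumes "N \<subseteq> P" shows "(\<Sum>i\<in>UNIV. (signed_vec c (P, N) i)\<^sup>2) = c\<^sup>2 * int (card P)"
proof -
  have "(signed_vec c (P, N) i)\<^sup>2 = (if i \<in> P then c\<^sup>2 else 0)" for i
    using assms by (auto simp: signed_vec_def)
  then show ?thesis by (simp add: sum.If_cases)
qed

lemma signed_vec_4_leech_min: assumes "card P = 2" "N \<subseteq> P" shows "signed_vec 4 (P, N) \<in> leech_min"
proof -
  have fin: "finite N" by simp
  have "sum (signed_vec 1 (P, N)) UNIV = (\<Sum>i\<in>UNIV. of_bool (i \<in> P) - 2 * of_bool (i \<in> N))"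
    using assms by (intro sum.cong) (auto simp: signed_vec_def)
  also have "\<dots> = int (card P) - 2 * int (card N)"
    by (simp add: sum_subtractf sum_distrib_left[symmetric] sum_of_bool_int del: sum_of_bool_eq)
  finally have "even (sum (signed_vec 1 (P, N)) UNIV - 0)" using assms by simp
  moreover have "signed_vec 4 (P, N) i = 0 + 2 * of_bool (i \<in> {}) + 4 * signed_vec 1 (P, N) i" for i
    by (auto simp: signed_vec_def)
  ultimately have "leech_int (signed_vec 4 (P, N))"
    unfolding leech_int_iff using golay_empty by blast
  then show ?thesis using assms by (simp add: leech_min_def sum_squares_signed_vec)
qed

lemma signed_vec_2_leech_min:
  assumes "P \<in> octads" "N \<subseteq> P" "even (card N)" shows "signed_vec 2 (P, N) \<in> leech_min"
proof -
  have "even (sum (\<lambda>i. - of_bool (i \<in> N)) (UNIV :: 24 set) - (0 :: int))"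
    using assms(3) by (simp only: sum_negf sum_of_bool_int) simp
  moreover have "signed_vec 2 (P, N) i = 0 + 2 * of_bool (i \<in> P) + 4 * (- of_bool (i \<in> N))" for i
    using assms(2) by (auto simp: signed_vec_def)
  moreover have "P \<in> golay" using assms(1) by (simp add: octads_def)
  ultimately have "leech_int (signed_vec 2 (P, N))"
    by (intro leech_intI[where m = 0 and A = P and b = "\<lambda>i. - of_bool (i \<in> N)"])
  then show ?thesis using assms by (simp add: leech_min_def sum_squares_signed_vec octads_def)
qed

lemma odd_vec_leech_min: assumes "A \<in> golay" shows "odd_vec (A, p) \<in> leech_min"
proof -
  have "even (card A)" using golay_doubly_even(1)[OF assms] by presburger
  then have "odd (card (sym_diff A {p}))" by (subst even_card_sym_diff) auto
  then have "even (sum (\<lambda>i. - of_bool (i \<in> sym_diff A {p})) (UNIV :: 24 set) - (1 :: int))"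
    by (simp only: sum_negf sum_of_bool_int) simp
  moreover have "odd_vec (A, p) i = 1 + 2 * of_bool (i \<in> A) + 4 * (- of_bool (i \<in> sym_diff A {p}))" for i
    by (auto simp: odd_vec_def)
  ultimately have "leech_int (odd_vec (A, p))"
    using assms by (intro leech_intI[where m = 1 and A = A and b = "\<lambda>i. - of_bool (i \<in> sym_diff A {p})"])
  moreover have "(odd_vec (A, p) i)\<^sup>2 = (if i = p then 9 else 1)" for i
    by (auto simp: odd_vec_def)
  ultimately show ?thesis by (simp add: leech_min_def sum.If_cases Compl_eq_Diff_UNIV card_Diff_subset)
qed

text \<open>Toggling the element \<open>p\<close> exchanges even and odd subsets.\<close>

lemma card_even_subsets:
  assumes "finite P" "p \<in> P"
  shows "2 * card {N. N \<subseteq> P \<and> even (card N)} = 2 ^ card P"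
proof -
  let ?E = "{N. N \<subseteq> P \<and> even (card N)}" and ?O = "{N. N \<subseteq> P \<and> odd (card N)}"
  have fin: "finite N" if "N \<subseteq> P" for N using that assms finite_subset by blast
  have "bij_betw (\<lambda>N. sym_diff N {p}) ?E ?O"
    by (rule bij_betwI[of _ _ _ "\<lambda>N. sym_diff N {p}"])
       (use assms fin in \<open>auto simp: even_card_sym_diff\<close>)
  then have "card ?E = card ?O" by (rule bij_betw_same_card)
  moreover have "card (Pow P) = card ?E + card ?O"
  proof -
    have "Pow P = ?E \<union> ?O" by auto
    moreover have "finite ?E" "finite ?O" using assms by auto
    moreover have "?E \<inter> ?O = {}" by auto
    ultimately show ?thesis by (simp add: card_Un_disjoint)
  qed
  ultimately show ?thesis using assms by (simp add: card_Pow)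
qed

text \<open>\<open>276 * 4 + 759 * 128 + 4096 * 24 = 196560\<close>. The matching upper bound comes
  from linear programming.\<close>

lemma card_leech_min_ge: "card leech_min \<ge> 196560"
proof -
  define A where "A = signed_vec 4 ` (SIGMA P : {P. card P = 2}. Pow P)"
  define B where "B = signed_vec 2 ` (SIGMA P : octads. {N. N \<subseteq> P \<and> even (card N)})"
  define D where "D = odd_vec ` (golay \<times> UNIV)"
  have sub: "A \<subseteq> leech_min" "B \<subseteq> leech_min" "D \<subseteq> leech_min"
    using signed_vec_4_leech_min signed_vec_2_leech_min odd_vec_leech_min by (auto simp: A_def B_def D_def)
  have fin: "finite A" "finite B" "finite D"
    by (rule finite_subset[OF _ finite_leech_min], rule sub)+
  have "card A = 1104"
  proof -
    have "card {P :: 24 set. card P = 2} = 276"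
      using n_subsets[of "UNIV :: 24 set" 2] by (simp add: choose_two)
    moreover have "card A = card (SIGMA P : {P :: 24 set. card P = 2}. Pow P)"
      unfolding A_def by (rule card_image[OF inj_on_subset[OF inj_signed_vec]]) auto
    ultimately show ?thesis by (simp add: card_Pow)
  qed
  moreover have "card B \<ge> 97152"
  proof -
    have "card {N. N \<subseteq> P \<and> even (card N)} = 128" if "P \<in> octads" for P
    proof -
      have P: "card P = 8" using that by (simp add: octads_def)
      then obtain p where "p \<in> P" by (metis card.empty ex_in_conv zero_neq_numeral)
      then show ?thesis using card_even_subsets[of P p] P by simp
    qed
    moreover have "finite octads" by (simp add: octads_def)
    moreover have "card B = card (SIGMA P : octads. {N. N \<subseteq> P \<and> even (card N)})"
      unfolding B_def by (rule card_image[OF inj_on_subset[OF inj_signed_vec]]) auto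
    ultimately have "card B = 128 * card octads" by simp
    then show ?thesis using card_octads_ge by simp
  qed
  moreover have "card D \<ge> 98304"
  proof -
    have "card D = card (golay \<times> (UNIV :: 24 set))"
      unfolding D_def by (rule card_image[OF inj_on_subset[OF inj_odd_vec]]) auto
    then show ?thesis using card_golay_ge by (simp add: card_cartesian_product)
  qed
  moreover have "A \<inter> B = {}"
  proof -
    have 1: "z i \<in> {0, 4, -4}" if "z \<in> A" for z i using that by (auto simp: A_def signed_vec_def split: if_splits)
    have 2: "\<exists>i. z i \<in> {2, -2}" if zB: "z \<in> B" for z
    proof -
      obtain P N where PN: "P \<in> octads" "N \<subseteq> P" "z = signed_vec 2 (P, N)" using zB by (auto simp: B_def)
      then have "card P \<noteq> 0" by (simp add: octads_def)
      then obtain p where "p \<in> P" by (metis card.empty ex_in_conv)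
      then show ?thesis using PN by (auto simp: signed_vec_def intro!: exI[of _ p])
    qed
    have False if zA: "z \<in> A" and zB: "z \<in> B" for z
    proof -
      obtain i where "z i \<in> {2, -2}" using 2[OF zB] by blast
      then show False using 1[OF zA, of i] by auto
    qed
    then show ?thesis by blast
  qed
  moreover have "(A \<union> B) \<inter> D = {}"
  proof -
    have "even (z i)" if "z \<in> A \<union> B" for z i using that by (auto simp: A_def B_def signed_vec_def)
    moreover have "odd (z i)" if "z \<in> D" for z i using that by (auto simp: D_def odd_vec_def split: if_splits)
    ultimately show ?thesis by blast
  qed
  ultimately have "card (A \<union> B \<union> D) \<ge> 196560"
    using fin by (simp add: card_Un_disjoint)
  also have "card (A \<union> B \<union> D) \<le> card leech_min"
    using sub finite_leech_min by (intro card_mono) auto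
  finally show ?thesis .
qed

text \<open>The factor \<open>sqrt 32\<close> gives the minimal vectors length 1, so that they are
  the points of the code itself, while \<open>leech_lattice\<close> has minimal norm 2.\<close>

definition unit_leech :: "(real^24) set" where
  "unit_leech = (\<lambda>z. \<chi> i. of_int (z i) / sqrt 32) ` {z. leech_int z}"

lemma inner_scaled_int:
  "(\<chi> i. of_int (z i) / sqrt 32 :: real^24) \<bullet> (\<chi> i. of_int (w i) / sqrt 32) = of_int (\<Sum>i\<in>UNIV. z i * w i) / 32"
  by (simp add: inner_vec_def sum_divide_distrib)

lemma unit_leech_diff: "u \<in> unit_leech \<Longrightarrow> v \<in> unit_leech \<Longrightarrow> u - v \<in> unit_leech"
proof -
  assume "u \<in> unit_leech" "v \<in> unit_leech"
  then obtain z w where zw: "leech_int z" "u = (\<chi> i. of_int (z i) / sqrt 32)"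
     "leech_int w" "v = (\<chi> i. of_int (w i) / sqrt 32)" by (auto simp: unit_leech_def)
  have "u - v = (\<chi> i. of_int (z i - w i) / sqrt 32)"
    by (simp add: zw vec_eq_iff diff_divide_distrib)
  then show ?thesis using leech_int_diff[OF zw(1,3)] unfolding unit_leech_def
    by (intro image_eqI[of _ _ "\<lambda>i. z i - w i"]) simp_all
qed

text \<open>Polarization of squared norms divisible by 16 makes the integer inner products divisible
  by 8, and 8/32 is 1/4.\<close>

lemma unit_leech_inner: assumes "u \<in> unit_leech" "v \<in> unit_leech"
  obtains k :: int where "u \<bullet> v = of_int k / 4"
proof -
  obtain z w where zw: "leech_int z" "u = (\<chi> i. of_int (z i) / sqrt 32)"
     "leech_int w" "v = (\<chi> i. of_int (w i) / sqrt 32)" using assms by (auto simp: unit_leech_def)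
  have "2 * (\<Sum>i\<in>UNIV. z i * w i) = (\<Sum>i\<in>UNIV. (z i)\<^sup>2) + (\<Sum>i\<in>UNIV. (w i)\<^sup>2) - (\<Sum>i\<in>UNIV. (z i - w i)\<^sup>2)"
    unfolding sum_distrib_left sum.distrib[symmetric] sum_subtractf[symmetric]
    by (rule sum.cong) (auto simp: power2_eq_square algebra_simps)
  moreover have "16 dvd (\<Sum>i\<in>UNIV. (z i)\<^sup>2)" "16 dvd (\<Sum>i\<in>UNIV. (w i)\<^sup>2)" "16 dvd (\<Sum>i\<in>UNIV. (z i - w i)\<^sup>2)"
    using zw leech_int_diff leech_int_sum_squares by auto
  ultimately have "16 dvd 2 * (\<Sum>i\<in>UNIV. z i * w i)" by simp
  then have "8 dvd (\<Sum>i\<in>UNIV. z i * w i)" by presburger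
  then obtain k where "(\<Sum>i\<in>UNIV. z i * w i) = 8 * k" by blast
  then have "u \<bullet> v = of_int k / 4" by (simp add: zw inner_scaled_int del: of_int_sum)
  then show ?thesis by (rule that)
qed

lemma unit_leech_min: assumes "u \<in> unit_leech" "u \<noteq> 0" shows "u \<bullet> u \<ge> 1"
proof -
  obtain z where z: "leech_int z" "u = (\<chi> i. of_int (z i) / sqrt 32)"
    using assms by (auto simp: unit_leech_def)
  obtain i where "z i \<noteq> 0" using assms(2) by (auto simp: z vec_eq_iff)
  then have "(\<Sum>i\<in>UNIV. z i * z i) \<ge> 32" using leech_int_min[OF z(1)] by (simp add: power2_eq_square)
  then have "real_of_int (\<Sum>i\<in>UNIV. z i * z i) \<ge> 32" by linarith
  then show ?thesis by (simp add: z(2) inner_scaled_int del: of_int_sum)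
qed

lemma unit_leech_minimal: "{u \<in> unit_leech. u \<bullet> u = 1} = (\<lambda>z. \<chi> i. of_int (z i) / sqrt 32) ` leech_min"
proof -
  have "(\<chi> i. of_int (z i) / sqrt 32 :: real^24) \<bullet> (\<chi> i. of_int (z i) / sqrt 32) = 1 \<longleftrightarrow> (\<Sum>i\<in>UNIV. (z i)\<^sup>2) = 32" for z
  proof -
    have "of_int (\<Sum>i\<in>UNIV. z i * z i) / 32 = (1::real) \<longleftrightarrow> real_of_int (\<Sum>i\<in>UNIV. z i * z i) = real_of_int 32"
      by simp
    then show ?thesis unfolding inner_scaled_int of_int_eq_iff by (simp only: power2_eq_square)
  qed
  then show ?thesis unfolding unit_leech_def leech_min_def by blast
qed

lemma leech_code_eq: "leech_code = {u \<in> unit_leech. u \<bullet> u = 1}"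
proof -
  let ?L = "leech_lattice"
  have s: "sqrt 32 = 2 * sqrt 8" using real_sqrt_mult[of 4 8] by simp
  have L: "v \<in> ?L \<longleftrightarrow> v /\<^sub>R 2 \<in> unit_leech" for v
  proof -
    have "v = (\<chi> i. of_int (z i) / sqrt 8) \<longleftrightarrow> v /\<^sub>R 2 = (\<chi> i. of_int (z i) / sqrt 32)" for z
      by (simp add: vec_eq_iff s field_simps)
    moreover have "v \<in> ?L \<longleftrightarrow> (\<exists>z. leech_int z \<and> v = (\<chi> i. of_int (z i) / sqrt 8))"
      unfolding leech_lattice_def leech_int_def by (auto simp: vec_eq_iff)
    ultimately show ?thesis by (auto simp: unit_leech_def)
  qed
  have ne: "\<exists>u\<in>unit_leech. u \<bullet> u = 1"
  proof -
    have "leech_min \<noteq> {}" using card_leech_min_ge by auto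
    then show ?thesis using unit_leech_minimal by auto
  qed
  have norm: "norm v \<ge> 2" if "v \<in> ?L" "v \<noteq> 0" for v
  proof -
    have "(v /\<^sub>R 2) \<bullet> (v /\<^sub>R 2) \<ge> 1" using that by (intro unit_leech_min) (auto simp: L)
    then have "(norm v)\<^sup>2 \<ge> 2\<^sup>2" by (simp add: power2_norm_eq_inner)
    then show ?thesis by (rule power2_le_imp_le) simp
  qed
  have min: "minimal_vectors ?L = {v \<in> ?L. norm v = 2}"
  proof (intro equalityI subsetI)
    fix v assume v: "v \<in> minimal_vectors ?L"
    obtain u where u: "u \<in> unit_leech" "u \<bullet> u = 1" using ne by blast
    then have nu: "norm u = 1" by (simp add: norm_eq_1)
    then have "2 *\<^sub>R u \<in> ?L - {0}" using u by (auto simp: L)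
    then have "norm v \<le> norm (2 *\<^sub>R u)" using v unfolding minimal_vectors_def by blast
    then show "v \<in> {v \<in> ?L. norm v = 2}" using v norm[of v] nu by (auto simp: minimal_vectors_def)
  next
    fix v assume "v \<in> {v \<in> ?L. norm v = 2}"
    then show "v \<in> minimal_vectors ?L" using norm by (auto simp: minimal_vectors_def)
  qed
  show ?thesis
  proof (intro equalityI subsetI)
    fix u assume "u \<in> leech_code"
    then obtain v where "v \<in> ?L" "norm v = 2" "u = v /\<^sub>R 2" by (auto simp: leech_code_def min)
    then show "u \<in> {u \<in> unit_leech. u \<bullet> u = 1}" by (auto simp: L power2_norm_eq_inner[symmetric])
  next
    fix u assume "u \<in> {u \<in> unit_leech. u \<bullet> u = 1}"
    then have "u \<in> unit_leech" "norm u = 1" by (auto simp: norm_eq_1)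
    then show "u \<in> leech_code" unfolding leech_code_def min
      by (intro image_eqI[of _ _ "2 *\<^sub>R u"]) (auto simp: L)
  qed
qed

lemma finite_leech_code: "finite leech_code"
  by (simp add: leech_code_eq unit_leech_minimal finite_leech_min)

lemma card_leech_code_ge: "card leech_code \<ge> 196560"
proof -
  have "inj_on (\<lambda>z. (\<chi> i. of_int (z i) / sqrt 32) :: real^24) leech_min"
    by (rule inj_onI) (auto simp: vec_eq_iff)
  then show ?thesis using card_leech_min_ge by (simp add: leech_code_eq unit_leech_minimal card_image)
qed

lemma unit_leech_0: "0 \<in> unit_leech"
proof -
  have "leech_code \<noteq> {}" using card_leech_code_ge by auto
  then show ?thesis using unit_leech_diff by (metis (no_types, lifting) diff_self ex_in_conv leech_code_eq mem_Collect_eq)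
qed

lemma unit_leech_add: "u \<in> unit_leech \<Longrightarrow> v \<in> unit_leech \<Longrightarrow> u + v \<in> unit_leech"
  using unit_leech_diff[of u "0 - v"] unit_leech_diff[OF unit_leech_0, of v] by simp

lemma leech_code_uminus: "u \<in> leech_code \<Longrightarrow> - u \<in> leech_code"
  using unit_leech_diff[OF unit_leech_0, of u] by (simp add: leech_code_eq)

lemma norm_leech_code: "u \<in> leech_code \<Longrightarrow> norm u = 1"
  by (simp add: leech_code_eq norm_eq_1)

text \<open>Inner products \<open>\<plusminus>3/4\<close> would make \<open>u - v\<close> or
  \<open>u + v\<close> a nonzero lattice vector of squared norm 1/2, below the minimum 1.\<close>

lemma leech_code_inner:
  assumes u: "u \<in> leech_code" and v: "v \<in> leech_code"
  shows "u \<bullet> v \<in> {-1, -1/2, -1/4, 0, 1/4, 1/2, 1}"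
proof -
  have L: "u \<in> unit_leech" "v \<in> unit_leech" "u \<bullet> u = 1" "v \<bullet> v = 1" using u v by (auto simp: leech_code_eq)
  obtain k :: int where k: "u \<bullet> v = of_int k / 4" using L(1,2) by (rule unit_leech_inner)
  have "\<bar>u \<bullet> v\<bar> \<le> 1" using Cauchy_Schwarz_ineq2[of u v] u v by (simp add: norm_leech_code)
  then have "\<bar>k\<bar> \<le> 4" by (simp add: k)
  moreover have "k \<noteq> 3"
  proof
    assume "k = 3"
    then have "(u - v) \<bullet> (u - v) = 1 / 2" using L k by (simp add: inner_diff inner_commute[of v u])
    moreover from this have "u - v \<noteq> 0" by auto
    ultimately show False using unit_leech_min[of "u - v"] unit_leech_diff L by simp
  qed
  moreover have "k \<noteq> -3"
  proof
    assume "k = -3"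
    then have "(u + v) \<bullet> (u + v) = 1 / 2" using L k by (simp add: inner_add inner_commute[of v u])
    moreover from this have "u + v \<noteq> 0" by auto
    ultimately show False using unit_leech_min[of "u + v"] unit_leech_add L by simp
  qed
  ultimately have "k \<in> {-4, -2, -1, 0, 1, 2, 4}" by auto
  then show ?thesis by (auto simp: k)
qed

section \<open>The designs with 196560 and 4600 points\<close>

lemma sum_atMost_small:
  fixes f :: "nat \<Rightarrow> real"
  shows "(\<Sum>j\<le>1. f j) = f 0 + f 1" "(\<Sum>j\<le>2. f j) = f 0 + f 1 + f 2"
    "(\<Sum>j\<le>3. f j) = f 0 + f 1 + f 2 + f 3"
  by (simp_all add: eval_nat_numeral)

lemma gegen_coeff_small:
  "gegen_coeff n k 1 = - (real k * (real k - 1)) / (2 * (2 * real k - 4 + real n))"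
  "gegen_coeff n k 2 = - gegen_coeff n k 1 * (real k - 2) * (real k - 3) / (4 * (2 * real k - 6 + real n))"
  "gegen_coeff n k 3 = - gegen_coeff n k 2 * (real k - 4) * (real k - 5) / (6 * (2 * real k - 8 + real n))"
  using gegen_coeff.simps(2)[of n k 0] gegen_coeff.simps(2)[of n k 1] gegen_coeff.simps(2)[of n k 2]
  by (simp_all add: eval_nat_numeral)

text \<open>In dimensions 24 and 23 only even degrees occur, since the codes there are antipodal and
  the test polynomials even.\<close>

lemma gegenbauer_values:
  "gegenbauer 24 2 t = t ^ 2 - 1 / 24"
  "gegenbauer 24 4 t = t ^ 4 - 3 / 14 * t ^ 2 + 3 / 728"
  "gegenbauer 24 6 t = t ^ 6 - 15 / 32 * t ^ 4 + 3 / 64 * t ^ 2 - 1 / 1792"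
  "gegenbauer 23 2 t = t ^ 2 - 1 / 23"
  "gegenbauer 23 4 t = t ^ 4 - 2 / 9 * t ^ 2 + 1 / 225"
  "gegenbauer 23 6 t = t ^ 6 - 15 / 31 * t ^ 4 + 45 / 899 * t ^ 2 - 5 / 8091"
  "gegenbauer 22 1 t = t"
  "gegenbauer 22 2 t = t ^ 2 - 1 / 22"
  "gegenbauer 22 3 t = t ^ 3 - 1 / 8 * t"
  by (simp_all add: gegenbauer_def sum_atMost_small[unfolded One_nat_def] gegen_coeff_small[unfolded One_nat_def])

definition gegen_sum :: "nat \<Rightarrow> (real^'n::finite) set \<Rightarrow> real" where
  "gegen_sum k C = (\<Sum>x\<in>C. \<Sum>y\<in>C. gegenbauer CARD('n) k (x \<bullet> y))"

lemma gegen_sum_nonneg: "C \<subseteq> sphere 0 1 \<Longrightarrow> gegen_sum k C \<ge> 0"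
  unfolding gegen_sum_def by (rule gegenbauer_sum_nonneg)

lemma sum_by_values:
  fixes g :: "real \<Rightarrow> real"
  assumes "finite C" "finite V" "\<And>y. y \<in> C \<Longrightarrow> v y \<in> V"
  shows "(\<Sum>y\<in>C. g (v y)) = (\<Sum>t\<in>V. real (card {y \<in> C. v y = t}) * g t)"
proof -
  have "(\<Sum>y\<in>C. g (v y)) = (\<Sum>t\<in>V. \<Sum>y\<in>{y \<in> C. v y = t}. g (v y))"
    using assms by (intro sum.group[symmetric]) auto
  also have "\<dots> = (\<Sum>t\<in>V. real (card {y \<in> C. v y = t}) * g t)"
    by (rule sum.cong) auto
  finally show ?thesis .
qed

lemma unit_inner_eq_1: "norm x = 1 \<Longrightarrow> norm y = 1 \<Longrightarrow> x \<bullet> y = 1 \<longleftrightarrow> x = (y :: 'a::real_inner)"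
proof
  assume "norm x = 1" "norm y = 1" "x \<bullet> y = 1"
  then have "(x - y) \<bullet> (x - y) = 0" by (simp add: inner_diff inner_commute[of y x] norm_eq_1)
  then show "x = y" by simp
qed (simp add: norm_eq_1)

lemma unit_inner_eq_minus_1:
  "norm x = 1 \<Longrightarrow> norm y = 1 \<Longrightarrow> x \<bullet> y = -1 \<longleftrightarrow> y = - (x :: 'a::real_inner)"
  using unit_inner_eq_1[of x "- y"] by auto

lemma antipodal_double_sum:
  fixes C :: "'a::real_inner set"
  assumes C: "finite C" "\<And>x. x \<in> C \<Longrightarrow> norm x = 1" "\<And>x. x \<in> C \<Longrightarrow> - x \<in> C"
    and f: "f 1 = a" "f (-1) = a" "\<And>x y. x \<in> C \<Longrightarrow> y \<in> C \<Longrightarrow> x \<bullet> y \<noteq> 1 \<Longrightarrow> x \<bullet> y \<noteq> -1 \<Longrightarrow> f (x \<bullet> y) = (0::real)"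
  shows "(\<Sum>x\<in>C. \<Sum>y\<in>C. f (x \<bullet> y)) = 2 * a * real (card C)"
proof -
  have "(\<Sum>y\<in>C. f (x \<bullet> y)) = 2 * a" if x: "x \<in> C" for x
  proof -
    have "x \<noteq> 0" using C(2)[OF x] by auto
    then have ne: "x \<noteq> - x" by (simp add: eq_neg_iff_add_eq_0 scaleR_2[symmetric])
    have "(\<Sum>y\<in>C. f (x \<bullet> y)) = (\<Sum>y\<in>{x, - x}. f (x \<bullet> y))"
    proof (rule sum.mono_neutral_right)
      show "\<forall>y\<in>C - {x, - x}. f (x \<bullet> y) = 0"
      proof
        fix y assume "y \<in> C - {x, - x}"
        then have y: "y \<in> C" "y \<noteq> x" "y \<noteq> - x" by auto
        have "x \<bullet> y \<noteq> 1" using unit_inner_eq_1[of x y] C(2) x y by blast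
        moreover have "x \<bullet> y \<noteq> -1" using unit_inner_eq_minus_1[of x y] C(2) x y by blast
        ultimately show "f (x \<bullet> y) = 0" using f(3) x y by blast
      qed
    qed (use C x in auto)
    also have "\<dots> = f 1 + f (-1)" using ne C(2)[OF x] by (simp add: norm_eq_1)
    finally show ?thesis using f by simp
  qed
  then show ?thesis by simp
qed

text \<open>The test polynomial vanishes at all inner products except \<open>\<plusminus>1\<close>,
  where it is 45/64, so its double sum is known exactly. Its constant coefficient 1/139776 alone
  accounts for at least that sum once \<open>N \<ge> 196560\<close>. Hence the other Gegenbauer sums
  vanish, and equality fixes \<open>N\<close>.\<close>

lemma leech_code_design:
  "card leech_code = 196560"
  "gegen_sum 2 leech_code = 0" "gegen_sum 4 leech_code = 0" "gegen_sum 6 leech_code = 0"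
proof -
  let ?f = "\<lambda>t::real. t\<^sup>2 * (t\<^sup>2 - 1/4) * (t\<^sup>2 - 1/16)"
  define N where "N = real (card leech_code)"
  have N: "N \<ge> 196560" using card_leech_code_ge by (simp add: N_def)
  have sub: "leech_code \<subseteq> sphere 0 1" using norm_leech_code by auto
  have "(\<Sum>x\<in>leech_code. \<Sum>y\<in>leech_code. ?f (x \<bullet> y)) = 2 * (45/64) * N"
    unfolding N_def
  proof (rule antipodal_double_sum)
    fix x y assume "x \<in> leech_code" "y \<in> leech_code" "x \<bullet> y \<noteq> 1" "x \<bullet> y \<noteq> -1"
    then have "x \<bullet> y \<in> {-1/2, -1/4, 0, 1/4, 1/2}" using leech_code_inner[of x y] by auto
    moreover have "\<forall>t\<in>{-1/2, -1/4, 0, 1/4, 1/2}. ?f t = 0" by (simp add: power2_eq_square)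
    ultimately show "?f (x \<bullet> y) = 0" by (rule bspec[rotated])
  qed (auto simp: finite_leech_code norm_leech_code leech_code_uminus power2_eq_square)
  moreover have f: "?f t = gegenbauer 24 6 t + 5/32 * gegenbauer 24 4 t + 1/448 * gegenbauer 24 2 t + 1/139776" for t
    unfolding gegenbauer_values by (simp add: field_simps power2_eq_square power4_eq_xxxx power_numeral_reduce)
  have "(\<Sum>x\<in>leech_code. \<Sum>y\<in>leech_code. ?f (x \<bullet> y))
      = gegen_sum 6 leech_code + 5/32 * gegen_sum 4 leech_code + 1/448 * gegen_sum 2 leech_code + N * N / 139776"
    unfolding f gegen_sum_def sum.distrib sum_distrib_left[symmetric] by (simp add: N_def)
  ultimately have eq: "gegen_sum 6 leech_code + 5/32 * gegen_sum 4 leech_code + 1/448 * gegen_sum 2 leech_code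
       + N * N / 139776 = 45/32 * N"
    by linarith
  have "N * N / 139776 \<ge> 196560 * N / 139776" using N by (intro divide_right_mono mult_right_mono) auto
  moreover have "196560 * N / 139776 = 45/32 * N" by simp
  moreover have nn: "gegen_sum k leech_code \<ge> 0" for k using sub by (rule gegen_sum_nonneg)
  ultimately have "gegen_sum 6 leech_code = 0 \<and> gegen_sum 4 leech_code = 0 \<and> gegen_sum 2 leech_code = 0"
    using eq nn[of 2] nn[of 4] nn[of 6] by linarith
  then show "gegen_sum 2 leech_code = 0" "gegen_sum 4 leech_code = 0" "gegen_sum 6 leech_code = 0" by auto
  then have "N * (N - 196560) = 0" using eq by (simp add: algebra_simps)
  then have "N = 196560" using N by simp
  then show "card leech_code = 196560" by (simp add: N_def)
qed

lemma leech_code_moments: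
  assumes u: "norm u = 1"
  shows "(\<Sum>y\<in>leech_code. (y \<bullet> u) ^ 2) = 8190" "(\<Sum>y\<in>leech_code. (y \<bullet> u) ^ 4) = 945"
proof -
  have sub: "leech_code \<subseteq> sphere 0 1" using norm_leech_code by auto
  have "(\<Sum>y\<in>leech_code. gegenbauer 24 2 (y \<bullet> u)) = 0" "(\<Sum>y\<in>leech_code. gegenbauer 24 4 (y \<bullet> u)) = 0"
    using gegenbauer_sum_zero[OF finite_leech_code sub u, of 2] gegenbauer_sum_zero[OF finite_leech_code sub u, of 4]
      leech_code_design by (simp_all add: gegen_sum_def)
  then show "(\<Sum>y\<in>leech_code. (y \<bullet> u) ^ 2) = 8190" "(\<Sum>y\<in>leech_code. (y \<bullet> u) ^ 4) = 945"
    unfolding gegenbauer_values sum.distrib sum_subtractf sum_distrib_left[symmetric]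
    by (simp_all add: leech_code_design(1))
qed

text \<open>By antipodality only the counts at 1/2, 1/4 and 0 are unknown; the last drops out of the
  second and fourth moments, which leaves two equations for two unknowns.\<close>

lemma leech_code_counts:
  assumes x: "x \<in> leech_code"
  shows "card {y \<in> leech_code. x \<bullet> y = 1/2} = 4600" "card {y \<in> leech_code. x \<bullet> y = 1/4} = 47104"
proof -
  let ?n = "\<lambda>t. card {y \<in> leech_code. x \<bullet> y = t}"
  have nx: "norm x = 1" using x by (rule norm_leech_code)
  have sym: "?n (- t) = ?n t" for t
    by (rule bij_betw_same_card[of uminus], rule bij_betwI[of _ _ _ uminus]) (auto simp: leech_code_uminus)
  have one: "?n 1 = 1"
  proof -
    have "{y \<in> leech_code. x \<bullet> y = 1} = {x}" using x nx unit_inner_eq_1 norm_leech_code by blast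
    then show ?thesis by simp
  qed
  have "(\<Sum>y\<in>leech_code. g (x \<bullet> y)) = (\<Sum>t\<in>{-1, -1/2, -1/4, 0, 1/4, 1/2, 1}. real (?n t) * g t)" for g
    by (rule sum_by_values) (use leech_code_inner[OF x] finite_leech_code in auto)
  then have sum: "(\<Sum>y\<in>leech_code. g (x \<bullet> y)) = g (-1) + real (?n (1/2)) * g (-1/2) + real (?n (1/4)) * g (-1/4)
      + real (?n 0) * g 0 + real (?n (1/4)) * g (1/4) + real (?n (1/2)) * g (1/2) + g 1" for g
    using sym[of "1/2"] sym[of "1/4"] sym[of 1] one by simp
  have "(\<Sum>y\<in>leech_code. (x \<bullet> y) ^ 2) = 8190" "(\<Sum>y\<in>leech_code. (x \<bullet> y) ^ 4) = 945"
    using leech_code_moments[OF nx] by (simp_all add: inner_commute)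
  then have "real (?n (1/2)) / 2 + real (?n (1/4)) / 8 = 8188" "real (?n (1/2)) / 8 + real (?n (1/4)) / 128 = 943"
    using sum[of "\<lambda>t. t ^ 2"] sum[of "\<lambda>t. t ^ 4"] by (simp_all add: power_divide)
  then have "real (?n (1/2)) = 4600 \<and> real (?n (1/4)) = 47104" by linarith
  then show "?n (1/2) = 4600" "?n (1/4) = 47104" by auto
qed

section \<open>Derived codes and the 4600 points\<close>

lemma derived_code_inner:
  assumes "norm x = 1" "x \<bullet> y = a" "x \<bullet> y' = a" "\<bar>a\<bar> < 1"
  shows "((y - a *\<^sub>R x) /\<^sub>R sqrt (1 - a\<^sup>2)) \<bullet> ((y' - a *\<^sub>R x) /\<^sub>R sqrt (1 - a\<^sup>2)) = (y \<bullet> y' - a\<^sup>2) / (1 - a\<^sup>2)"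
proof -
  have "a\<^sup>2 < 1" using assms(4) by (simp add: abs_square_less_1)
  then have "sqrt (1 - a\<^sup>2) * sqrt (1 - a\<^sup>2) = 1 - a\<^sup>2" by simp
  moreover have "(y - a *\<^sub>R x) \<bullet> (y' - a *\<^sub>R x) = y \<bullet> y' - a\<^sup>2"
    using assms by (simp add: inner_diff inner_commute[of y x] norm_eq_1 power2_eq_square)
  ultimately show ?thesis
    by (simp add: divide_inverse mult.assoc[symmetric] inverse_mult_distrib[symmetric] del: inverse_mult_distrib)
qed

lemma derived_code_eq_image:
  "derived_code C x a = (\<lambda>y. (y - a *\<^sub>R x) /\<^sub>R sqrt (1 - a\<^sup>2)) ` {y \<in> C. x \<bullet> y = a}"
  by (auto simp: derived_code_def)

lemma card_derived_code:
  assumes "\<bar>a\<bar> < 1" shows "card (derived_code C x a) = card {y \<in> C. x \<bullet> y = a}"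
proof -
  have "sqrt (1 - a\<^sup>2) \<noteq> 0" using assms abs_square_less_1[of a] by simp
  then have "inj_on (\<lambda>y. (y - a *\<^sub>R x) /\<^sub>R sqrt (1 - a\<^sup>2)) {y \<in> C. x \<bullet> y = a}"
    by (intro inj_onI) simp
  then show ?thesis unfolding derived_code_eq_image by (rule card_image)
qed

lemma half_code_cases:
  assumes x: "x \<in> leech_code" and v: "v \<in> half_code x"
  obtains y where "y \<in> leech_code" "x \<bullet> y = 1/2" "v = (y - (1/2) *\<^sub>R x) /\<^sub>R sqrt (1 - (1/2)\<^sup>2)"
  using v unfolding half_code_def derived_code_def by blast

lemma half_code_orthogonal:
  assumes x: "x \<in> leech_code" and v: "v \<in> half_code x"
  shows "x \<bullet> v = 0"
proof -
  obtain y where "x \<bullet> y = 1/2" "v = (y - (1/2) *\<^sub>R x) /\<^sub>R sqrt (1 - (1/2)\<^sup>2)"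
    using x v by (rule half_code_cases)
  moreover have "x \<bullet> x = 1" using norm_leech_code[OF x] by (simp add: norm_eq_1)
  ultimately show ?thesis by (simp add: inner_diff_right)
qed

text \<open>The lattice vector \<open>y + z - x\<close> has squared norm
  \<open>1 + 2 (y \<bullet> z)\<close>, which rules out \<open>y \<bullet> z = -1/4\<close> and
  \<open>-1\<close>; at \<open>-1/2\<close> it is zero and the two points are antipodal.\<close>

lemma half_code_inner:
  assumes x: "x \<in> leech_code" and v: "v \<in> half_code x" and w: "w \<in> half_code x"
  shows "v \<bullet> w \<in> {-1, -1/3, 0, 1/3, 1}"
proof -
  obtain y where y: "y \<in> leech_code" "x \<bullet> y = 1/2" "v = (y - (1/2) *\<^sub>R x) /\<^sub>R sqrt (1 - (1/2)\<^sup>2)"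
    using x v by (rule half_code_cases)
  obtain z where z: "z \<in> leech_code" "x \<bullet> z = 1/2" "w = (z - (1/2) *\<^sub>R x) /\<^sub>R sqrt (1 - (1/2)\<^sup>2)"
    using x w by (rule half_code_cases)
  have vw: "v \<bullet> w = (y \<bullet> z - (1/2)\<^sup>2) / (1 - (1/2)\<^sup>2)"
    unfolding y(3) z(3) by (rule derived_code_inner) (use x y z norm_leech_code in auto)
  have L: "x \<in> unit_leech" "y \<in> unit_leech" "z \<in> unit_leech" and n: "x \<bullet> x = 1" "y \<bullet> y = 1" "z \<bullet> z = 1"
    using x y z by (auto simp: leech_code_eq)
  have "y + z - x \<in> unit_leech" using L by (intro unit_leech_diff unit_leech_add)
  moreover have e: "(y + z - x) \<bullet> (y + z - x) = 1 + 2 * (y \<bullet> z)"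
    using n y z by (simp add: inner_diff inner_add inner_commute[of y x] inner_commute[of z x] inner_commute[of z y])
  ultimately have "y + z - x = 0 \<or> y \<bullet> z \<ge> 0" using unit_leech_min[of "y + z - x"] by auto
  then have "y \<bullet> z = -1/2 \<or> y \<bullet> z \<ge> 0" using e by auto
  then have "y \<bullet> z \<in> {-1/2, 0, 1/4, 1/2, 1}" using leech_code_inner[OF y(1) z(1)] by auto
  then show ?thesis unfolding vw by (auto simp: power2_eq_square)
qed

lemma half_code_norm:
  assumes x: "x \<in> leech_code" and v: "v \<in> half_code x"
  shows "norm v = 1"
proof -
  obtain y where y: "y \<in> leech_code" "x \<bullet> y = 1/2" "v = (y - (1/2) *\<^sub>R x) /\<^sub>R sqrt (1 - (1/2)\<^sup>2)"
    using x v by (rule half_code_cases)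
  have "v \<bullet> v = (y \<bullet> y - (1/2)\<^sup>2) / (1 - (1/2)\<^sup>2)"
    unfolding y(3) by (rule derived_code_inner) (use x y norm_leech_code in auto)
  also have "y \<bullet> y = 1" using norm_leech_code[OF y(1)] by (simp add: norm_eq_1)
  finally show ?thesis by (simp add: norm_eq_1 power2_eq_square)
qed

lemma half_code_uminus:
  assumes x: "x \<in> leech_code" and v: "v \<in> half_code x"
  shows "- v \<in> half_code x"
proof -
  obtain y where y: "y \<in> leech_code" "x \<bullet> y = 1/2" "v = (y - (1/2) *\<^sub>R x) /\<^sub>R sqrt (1 - (1/2)\<^sup>2)"
    using x v by (rule half_code_cases)
  have n: "x \<bullet> x = 1" "y \<bullet> y = 1" using x y by (auto simp: leech_code_eq)
  \<comment> \<open>The reflection \<open>y \<mapsto> x - y\<close> of the neighbours of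
    \<open>x\<close> is the antipodal map after projection.\<close>
  have "x - y \<in> leech_code"
    using x y n unit_leech_diff by (auto simp: leech_code_eq inner_diff inner_commute[of y x])
  moreover have "x \<bullet> (x - y) = 1/2" using n y by (simp add: inner_diff)
  moreover have "- v = ((x - y) - (1/2) *\<^sub>R x) /\<^sub>R sqrt (1 - (1/2)\<^sup>2)"
  proof -
    define h where "h = (1/2) *\<^sub>R x"
    have "x = h + h" unfolding h_def scaleR_add_left[symmetric] by simp
    then have "(x - y) - h = - (y - h)" by (simp add: algebra_simps)
    then have "(x - y) - (1/2) *\<^sub>R x = - (y - (1/2) *\<^sub>R x)" by (simp only: h_def)
    then show ?thesis unfolding y(3) by (simp only: scaleR_minus_right)
  qed
  ultimately show ?thesis unfolding half_code_def derived_code_def by blast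
qed

lemma card_half_code: "x \<in> leech_code \<Longrightarrow> card (half_code x) = 4600"
  using leech_code_counts(1) by (simp add: half_code_def card_derived_code)

lemma finite_half_code: "x \<in> leech_code \<Longrightarrow> finite (half_code x)"
  by (rule card_ge_0_finite) (simp add: card_half_code)

text \<open>Gegenbauer kernels depend on the dimension, so a code inside the complement of one or
  two vectors is treated in \<open>real^23\<close> or \<open>real^22\<close> through an
  isometry.\<close>

lemma isometry_onto_orthogonal_complement:
  fixes B :: "'a::euclidean_space set"
  assumes "finite B" "pairwise orthogonal B" "0 \<notin> B" "card B + CARD('n) = DIM('a)"
  shows "\<exists>f :: real^'n \<Rightarrow> 'a. linear f \<and> (\<forall>v. norm (f v) = norm v) \<and> range f = {v. \<forall>b\<in>B. b \<bullet> v = 0}"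
proof -
  let ?S = "{y \<in> UNIV. \<forall>x\<in>span B. orthogonal x y}"
  have "dim ?S + dim (span B) = dim (UNIV :: 'a set)"
    by (rule dim_subspace_orthogonal_to_vectors) auto
  moreover have "dim (span B) = card B"
    using assms by (intro dim_span_eq_card_independent pairwise_orthogonal_independent)
  ultimately have dim: "dim ?S = CARD('n)" using assms(4) by simp
  have S: "?S = {v. \<forall>b\<in>B. b \<bullet> v = 0}"
  proof (intro equalityI subsetI)
    fix v assume "v \<in> ?S" then show "v \<in> {v. \<forall>b\<in>B. b \<bullet> v = 0}"
      by (auto simp: orthogonal_def span_base)
  next
    fix v assume v: "v \<in> {v. \<forall>b\<in>B. b \<bullet> v = 0}"
    have "orthogonal v x" if "x \<in> span B" for x
      by (rule orthogonal_to_span[OF that]) (use v in \<open>auto simp: orthogonal_def inner_commute\<close>)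
    then show "v \<in> ?S" by (simp add: orthogonal_commute)
  qed
  have sub: "subspace ?S" unfolding S by (auto simp: subspace_def inner_add_right)
  have "dim (UNIV :: (real^'n) set) = dim ?S" unfolding dim by simp
  then obtain f :: "real^'n \<Rightarrow> 'a" and g where "linear f" "f ` UNIV = ?S" "\<And>x. x \<in> UNIV \<Longrightarrow> norm (f x) = norm x"
    by (rule isometries_subspaces[OF subspace_UNIV sub]) blast
  then show ?thesis using S by (intro exI[of _ f]) auto
qed

lemma isometry_inner:
  assumes "linear f" "\<And>v. norm (f v) = norm v"
  shows "f u \<bullet> f v = u \<bullet> v"
proof -
  have *: "a \<bullet> b = ((norm (a + b))\<^sup>2 - (norm (a - b))\<^sup>2) / 4" for a b :: "'c::real_inner"
    by (simp add: power2_norm_eq_inner inner_add inner_diff inner_commute)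
  show ?thesis
    unfolding *[of "f u"] *[of u] linear_add[OF assms(1), symmetric] linear_diff[OF assms(1), symmetric] assms(2) ..
qed

lemma isometry_inj: assumes "linear f" "\<And>v. norm (f v) = norm v" shows "inj f"
  unfolding linear_injective_0[OF assms(1)] using assms(2) by (metis norm_eq_zero)

lemma half_code_design:
  assumes x: "x \<in> leech_code" and u: "norm u = 1" "x \<bullet> u = 0"
  shows "(\<Sum>y\<in>half_code x. (y \<bullet> u) ^ 2) = 200" "(\<Sum>y\<in>half_code x. (y \<bullet> u) ^ 4) = 24"
    "(\<Sum>y\<in>half_code x. (y \<bullet> u) ^ 6) = 40 / 9"
proof -
  have "x \<noteq> 0" using norm_leech_code[OF x] by auto
  then have "\<exists>f :: real^23 \<Rightarrow> real^24. linear f \<and> (\<forall>v. norm (f v) = norm v) \<and> range f = {v. \<forall>b\<in>{x}. b \<bullet> v = 0}"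
    by (intro isometry_onto_orthogonal_complement) (auto simp: pairwise_def)
  then obtain f :: "real^23 \<Rightarrow> real^24" where f: "linear f" "\<And>v. norm (f v) = norm v" "range f = {v. \<forall>b\<in>{x}. b \<bullet> v = 0}"
    by blast
  note inner = isometry_inner[OF f(1,2)] and inj = isometry_inj[OF f(1,2)]
  define D where "D = f -` half_code x"
  have im: "f ` D = half_code x" unfolding D_def using f(3) half_code_orthogonal[OF x] by (auto simp: image_vimage_eq)
  have inD: "inj_on f D" using inj by (rule inj_on_subset) simp
  have sumD: "(\<Sum>y\<in>half_code x. F y) = (\<Sum>v\<in>D. F (f v))" for F :: "_ \<Rightarrow> real"
    unfolding im[symmetric] using inD by (simp add: sum.reindex)
  have card: "card D = 4600" using card_image[OF inD] card_half_code[OF x] by (simp add: im)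
  have fin: "finite D" by (rule card_ge_0_finite) (simp add: card)
  have mem: "v \<in> D \<Longrightarrow> f v \<in> half_code x" for v by (simp add: D_def)
  have norm: "v \<in> D \<Longrightarrow> norm v = 1" for v using half_code_norm[OF x mem] f(2) by metis
  have sub: "D \<subseteq> sphere 0 1" using norm by auto
  \<comment> \<open>A factor \<open>t\<^sup>2\<close> would already cancel the inner product 0; the
    power \<open>t ^ 4\<close> brings the degree to 6, so that the sixth moment is covered too. The
    bound is met exactly: \<open>4600 * 2/5175 = 2 * 8/9\<close>.\<close>
  let ?f = "\<lambda>t::real. t ^ 4 * (t\<^sup>2 - 1/9)"
  have "(\<Sum>v\<in>D. \<Sum>w\<in>D. ?f (v \<bullet> w)) = 2 * (8/9) * real (card D)"
  proof (rule antipodal_double_sum)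
    fix v w assume "v \<in> D" "w \<in> D" "v \<bullet> w \<noteq> 1" "v \<bullet> w \<noteq> -1"
    then have "v \<bullet> w \<in> {-1/3, 0, 1/3}" using half_code_inner[OF x mem mem, of v w] inner by auto
    moreover have "\<forall>t\<in>{-1/3, 0, 1/3}. ?f t = 0" by (simp add: power2_eq_square)
    ultimately show "?f (v \<bullet> w) = 0" by (rule bspec[rotated])
  next
    fix v assume "v \<in> D" then show "- v \<in> D"
      using half_code_uminus[OF x mem, of v] linear_neg[OF f(1), of v] by (simp add: D_def)
  qed (use fin norm in auto)
  moreover have f_eq: "?f t = gegenbauer 23 6 t + 104/279 * gegenbauer 23 4 t + 77/2349 * gegenbauer 23 2 t + 2/5175" for t
    unfolding gegenbauer_values by (simp add: field_simps power2_eq_square power4_eq_xxxx power_numeral_reduce)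
  have "(\<Sum>v\<in>D. \<Sum>w\<in>D. ?f (v \<bullet> w))
      = gegen_sum 6 D + 104/279 * gegen_sum 4 D + 77/2349 * gegen_sum 2 D + 2/5175 * real (card D) * real (card D)"
    unfolding f_eq gegen_sum_def sum.distrib sum_distrib_left[symmetric] by simp
  ultimately have eq: "gegen_sum 6 D + 104/279 * gegen_sum 4 D + 77/2349 * gegen_sum 2 D = 0"
    by (simp add: card)
  have nn: "gegen_sum k D \<ge> 0" for k using sub by (rule gegen_sum_nonneg)
  have zero: "gegen_sum 2 D = 0" "gegen_sum 4 D = 0" "gegen_sum 6 D = 0"
    using eq nn[of 2] nn[of 4] nn[of 6] by linarith+
  have "u \<in> range f" using f(3) u by auto
  then obtain u' where u': "u = f u'" by blast
  then have nu: "norm u' = 1" using u f(2) by simp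
  have "(\<Sum>v\<in>D. gegenbauer 23 2 (v \<bullet> u')) = 0" "(\<Sum>v\<in>D. gegenbauer 23 4 (v \<bullet> u')) = 0"
    "(\<Sum>v\<in>D. gegenbauer 23 6 (v \<bullet> u')) = 0"
    using gegenbauer_sum_zero[OF fin sub nu, of 2] gegenbauer_sum_zero[OF fin sub nu, of 4]
      gegenbauer_sum_zero[OF fin sub nu, of 6] zero by (simp_all add: gegen_sum_def)
  then have "(\<Sum>v\<in>D. (v \<bullet> u') ^ 2) = 200 \<and> (\<Sum>v\<in>D. (v \<bullet> u') ^ 4) = 24 \<and> (\<Sum>v\<in>D. (v \<bullet> u') ^ 6) = 40 / 9"
    unfolding gegenbauer_values sum.distrib sum_subtractf sum_distrib_left[symmetric]
    by (simp add: card)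
  then show "(\<Sum>y\<in>half_code x. (y \<bullet> u) ^ 2) = 200" "(\<Sum>y\<in>half_code x. (y \<bullet> u) ^ 4) = 24"
    "(\<Sum>y\<in>half_code x. (y \<bullet> u) ^ 6) = 40 / 9"
    by (simp_all add: sumD u' inner)
qed

lemma half_code_odd:
  assumes x: "x \<in> leech_code" and k: "odd k"
  shows "(\<Sum>y\<in>half_code x. (y \<bullet> u) ^ k) = 0"
proof -
  have "(\<Sum>y\<in>half_code x. (y \<bullet> u) ^ k) = (\<Sum>y\<in>half_code x. (- y \<bullet> u) ^ k)"
    by (rule sum.reindex_bij_witness[of _ uminus uminus]) (auto simp: half_code_uminus[OF x])
  also have "\<dots> = - (\<Sum>y\<in>half_code x. (y \<bullet> u) ^ k)" using k by (simp add: sum_negf)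
  finally show ?thesis by simp
qed

text \<open>Odd powers cancel by antipodality and the even ones up to 6 have constant sums, so
  degree 7 is reached from a test polynomial of degree 6.\<close>

lemma half_code_poly_sum:
  assumes x: "x \<in> leech_code" and u: "norm u = 1" "x \<bullet> u = 0" and w: "norm w = 1" "x \<bullet> w = 0"
    and p: "degree p \<le> 7"
  shows "(\<Sum>y\<in>half_code x. poly p (u \<bullet> y)) = (\<Sum>y\<in>half_code x. poly p (w \<bullet> y))"
proof -
  have *: "(\<Sum>y\<in>half_code x. (u \<bullet> y) ^ k) = (\<Sum>y\<in>half_code x. (w \<bullet> y) ^ k)" if "k \<le> 7" for k
  proof (cases "odd k")
    case True
    then show ?thesis using half_code_odd[OF x True, of u] half_code_odd[OF x True, of w]
      by (simp add: inner_commute)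
  next
    case False
    then have "k \<in> {0, 2, 4, 6}" using that by (auto elim!: evenE)
    then show ?thesis using half_code_design[OF x u] half_code_design[OF x w] by (auto simp: inner_commute)
  qed
  have "(\<Sum>y\<in>half_code x. poly p (v \<bullet> y)) = (\<Sum>i\<le>degree p. poly.coeff p i * (\<Sum>y\<in>half_code x. (v \<bullet> y) ^ i))" for v
    unfolding poly_altdef sum_distrib_left by (rule sum.swap)
  then show ?thesis using p * by simp
qed

section \<open>The code with 2025 points\<close>

definition quad_nodes :: "real set" where
  "quad_nodes = {- (sqrt 5 / 5), - (sqrt 5 / 15), sqrt 5 / 15, sqrt 5 / 5}"

text \<open>Eight nodes give an interpolating polynomial of degree at most 7, which is the strength
  of the design, and doubling makes the node polynomial a square.\<close>

definition quad_node_list :: "real list" where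
  "quad_node_list = [- (sqrt 5 / 5), - (sqrt 5 / 5), - (sqrt 5 / 15), - (sqrt 5 / 15),
     sqrt 5 / 15, sqrt 5 / 15, sqrt 5 / 5, sqrt 5 / 5]"

lemma sqrt_5_bounds: "0 < sqrt 5" "sqrt 5 < 5"
  by (auto intro: real_less_lsqrt)

lemma prod_quad_node_list:
  "(\<Prod>a\<leftarrow>quad_node_list. t - a) =
     ((t + sqrt 5 / 5) * (t + sqrt 5 / 15) * (t - sqrt 5 / 15) * (t - sqrt 5 / 5))\<^sup>2"
  by (simp add: quad_node_list_def power2_eq_square)

lemma prod_quad_node_list_eq_0: "(\<Prod>a\<leftarrow>quad_node_list. t - a) = 0 \<longleftrightarrow> t \<in> quad_nodes"
  unfolding prod_quad_node_list quad_nodes_def by (auto simp: add_eq_0_iff2)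

lemma quad_node_list_subset: "set quad_node_list \<subseteq> {-1<..<1}"
proof -
  have "-1 < - (sqrt 5 / 5)" "- (sqrt 5 / 5) < 1" "-1 < sqrt 5 / 5" "sqrt 5 / 5 < 1"
    "-1 < - (sqrt 5 / 15)" "- (sqrt 5 / 15) < 1" "-1 < sqrt 5 / 15" "sqrt 5 / 15 < 1"
    using sqrt_5_bounds by linarith+
  then show ?thesis
    unfolding quad_node_list_def list.set insert_subset greaterThanLessThan_iff by blast
qed

text \<open>The interpolating polynomial has the same sum at \<open>u\<close> and at
  \<open>w\<close>, so the potentials differ by the interpolation error at \<open>u\<close>
  alone.\<close>

lemma half_code_potential:
  assumes x: "x \<in> leech_code" and u: "norm u = 1" "x \<bullet> u = 0" "u \<notin> half_code x"
    and w: "norm w = 1" "x \<bullet> w = 0" "\<And>y. y \<in> half_code x \<Longrightarrow> w \<bullet> y \<in> quad_nodes"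
    and D: "monotone_sequence D"
  shows "potential (D 0) (half_code x) u = potential (D 0) (half_code x) w
     + (\<Sum>y\<in>half_code x. (\<Prod>a\<leftarrow>quad_node_list. (u \<bullet> y) - a) * newton_rest quad_node_list D 0 (u \<bullet> y))"
    "y \<in> half_code x \<Longrightarrow> u \<bullet> y \<in> {-1..<1}"
proof -
  let ?p = "newton_poly quad_node_list D"
  have "degree ?p \<le> 7" using degree_newton_poly[of quad_node_list D] by (simp add: quad_node_list_def)
  then have p: "(\<Sum>y\<in>half_code x. poly ?p (u \<bullet> y)) = (\<Sum>y\<in>half_code x. poly ?p (w \<bullet> y))"
    by (rule half_code_poly_sum[OF x u(1,2) w(1,2)])
  have "potential (D 0) (half_code x) w = (\<Sum>y\<in>half_code x. poly ?p (w \<bullet> y))"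
    unfolding potential_def
  proof (rule sum.cong[OF refl])
    fix y assume "y \<in> half_code x"
    then have "(\<Prod>a\<leftarrow>quad_node_list. (w \<bullet> y) - a) = 0" using w(3) prod_quad_node_list_eq_0 by blast
    then show "D 0 (w \<bullet> y) = poly ?p (w \<bullet> y)"
      using newton_interpolation[of D "w \<bullet> y" quad_node_list] by simp
  qed
  then show "potential (D 0) (half_code x) u = potential (D 0) (half_code x) w
     + (\<Sum>y\<in>half_code x. (\<Prod>a\<leftarrow>quad_node_list. (u \<bullet> y) - a) * newton_rest quad_node_list D 0 (u \<bullet> y))"
    using p newton_interpolation[of D _ quad_node_list] by (simp add: potential_def sum.distrib)
  assume y: "y \<in> half_code x"
  have ny: "norm y = 1" using x y by (rule half_code_norm)
  have "\<bar>u \<bullet> y\<bar> \<le> 1" using Cauchy_Schwarz_ineq2[of u y] u ny by simp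
  moreover have "u \<bullet> y \<noteq> 1" using unit_inner_eq_1[OF u(1) ny] u(3) y by auto
  ultimately show "u \<bullet> y \<in> {-1..<1}" by auto
qed

lemma quad_point_not_in_half_code:
  assumes "x \<in> leech_code" "norm w = 1" "\<And>y. y \<in> half_code x \<Longrightarrow> w \<bullet> y \<in> quad_nodes"
  shows "w \<notin> half_code x"
proof
  assume "w \<in> half_code x"
  then have "1 \<in> quad_nodes" using assms by (force simp: norm_eq_1)
  then show False using sqrt_5_bounds by (auto simp: quad_nodes_def)
qed

lemma universal_minimumI:
  assumes x: "x \<in> leech_code"
    and w: "norm w = 1" "x \<bullet> w = 0" "\<And>y. y \<in> half_code x \<Longrightarrow> w \<bullet> y \<in> quad_nodes"
  shows "universal_minimum (half_code x) x w"
  unfolding universal_minimum_def Let_def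
proof (intro conjI allI impI ballI)
  show "w \<in> {u \<in> sphere 0 1. x \<bullet> u = 0} - half_code x"
    using w quad_point_not_in_half_code[OF x w(1,3)] by simp
  fix h u assume h: "absolutely_monotone h" and u: "u \<in> {u \<in> sphere 0 1. x \<bullet> u = 0} - half_code x"
  let ?D = "\<lambda>j. (deriv ^^ j) h"
  have D: "monotone_sequence ?D" using h by (rule monotone_sequence_deriv)
  have u': "norm u = 1" "x \<bullet> u = 0" "u \<notin> half_code x" using u by auto
  have "0 \<le> (\<Sum>y\<in>half_code x. (\<Prod>a\<leftarrow>quad_node_list. (u \<bullet> y) - a) * newton_rest quad_node_list ?D 0 (u \<bullet> y))"
    using half_code_potential(2)[OF x u' w D] quad_node_list_subset
    by (intro sum_nonneg mult_nonneg_nonneg newton_rest_nonneg[OF D])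
       (auto simp: prod_quad_node_list, simp add: quad_node_list_def)
  then show "potential h (half_code x) w \<le> potential h (half_code x) u"
    using half_code_potential(1)[OF x u' w D] by simp
qed

text \<open>For a minimal vector \<open>a\<close> with \<open>x \<bullet> a = 1/4\<close>, the
  lattice vector \<open>y + a - x\<close> has squared norm \<open>3/2 + 2 (y \<bullet> a)\<close>.
  This excludes \<open>y \<bullet> a = -1/2\<close> and \<open>-1\<close>, and the remaining values
  -1/4, 0, 1/4, 1/2 project to the four nodes.\<close>

lemma quad_point_exists:
  assumes x: "x \<in> leech_code"
  shows "\<exists>w. norm w = 1 \<and> x \<bullet> w = 0 \<and> (\<forall>y\<in>half_code x. w \<bullet> y \<in> quad_nodes)"
proof -
  have "{y \<in> leech_code. x \<bullet> y = 1/4} \<noteq> {}"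
    using leech_code_counts(2)[OF x] by (metis card.empty zero_neq_numeral)
  then obtain a where a: "a \<in> leech_code" "x \<bullet> a = 1/4" by blast
  define w where "w = (a - (1/4) *\<^sub>R x) /\<^sub>R sqrt (1 - (1/4)\<^sup>2)"
  have L: "x \<in> unit_leech" "a \<in> unit_leech" and n: "x \<bullet> x = 1" "a \<bullet> a = 1"
    using x a by (auto simp: leech_code_eq)
  have "w \<bullet> w = (a \<bullet> a - (1/4)\<^sup>2) / (1 - (1/4)\<^sup>2)"
    unfolding w_def by (rule derived_code_inner) (use x a norm_leech_code in auto)
  then have "norm w = 1" using n by (simp add: norm_eq_1 power2_eq_square)
  moreover have "x \<bullet> w = 0" using a n by (simp add: w_def inner_diff_right)
  moreover have "w \<bullet> v \<in> quad_nodes" if v: "v \<in> half_code x" for v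
  proof -
    obtain y where y: "y \<in> leech_code" "x \<bullet> y = 1/2" "v = (y - (1/2) *\<^sub>R x) /\<^sub>R sqrt (1 - (1/2)\<^sup>2)"
      using x v by (rule half_code_cases)
    have Ly: "y \<in> unit_leech" and ny: "y \<bullet> y = 1" using y by (auto simp: leech_code_eq)
    have e: "(y + a - x) \<bullet> (y + a - x) = 3/2 + 2 * (y \<bullet> a)"
      using n ny a y by (simp add: inner_diff inner_add inner_commute[of y x] inner_commute[of a x] inner_commute[of a y])
    have "y + a - x \<in> unit_leech" using L Ly by (intro unit_leech_diff unit_leech_add)
    then have "y + a - x = 0 \<or> 3/2 + 2 * (y \<bullet> a) \<ge> 1" using unit_leech_min[of "y + a - x"] e by auto
    moreover have "y + a - x = 0 \<Longrightarrow> y \<bullet> a = -3/4" using e by simp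
    moreover have "y \<bullet> a \<noteq> 1"
    proof
      assume "y \<bullet> a = 1"
      then have "y = a" using unit_inner_eq_1 norm_leech_code y(1) a(1) by blast
      then show False using y a by simp
    qed
    ultimately have ya: "y \<bullet> a \<in> {-1/4, 0, 1/4, 1/2}" using leech_code_inner[OF y(1) a(1)] by auto
    have s: "sqrt (1 - (1/4)\<^sup>2) * sqrt (1 - (1/2)\<^sup>2) = 3 * sqrt 5 / 8"
    proof -
      have "sqrt (45 / 64) = 3 * sqrt 5 / 8"
        by (rule real_sqrt_unique) (auto simp: power_mult_distrib power_divide)
      then show ?thesis unfolding real_sqrt_mult[symmetric] by (simp add: power2_eq_square)
    qed
    have "(a - (1/4) *\<^sub>R x) \<bullet> (y - (1/2) *\<^sub>R x) = y \<bullet> a - 1/2 * (x \<bullet> a) - 1/4 * (x \<bullet> y) + 1/8 * (x \<bullet> x)"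
      by (simp add: inner_diff inner_commute[of a x] inner_commute[of a y] algebra_simps)
    then have "(a - (1/4) *\<^sub>R x) \<bullet> (y - (1/2) *\<^sub>R x) = y \<bullet> a - 1/8"
      unfolding n a(2) y(2) by simp
    then have "w \<bullet> v = inverse (sqrt (1 - (1/4)\<^sup>2) * sqrt (1 - (1/2)\<^sup>2)) * (y \<bullet> a - 1/8)"
      unfolding w_def y(3) by (simp only: inner_scaleR_left inner_scaleR_right inverse_mult_distrib mult_ac)
    also have "\<dots> = (y \<bullet> a - 1/8) * (8 * sqrt 5 / 15)"
    proof -
      have "inverse (3 * sqrt 5 / 8) = 8 * sqrt 5 / 15"
        by (rule inverse_unique) simp
      then show ?thesis unfolding s by (simp only: mult.commute)
    qed
    finally have "w \<bullet> v = (y \<bullet> a - 1/8) * (8 * sqrt 5 / 15)" .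
    moreover have "\<forall>k\<in>{-1/4, 0, 1/4, 1/2}. (k - 1/8) * (8 * sqrt 5 / 15) \<in> quad_nodes"
      by (simp add: quad_nodes_def)
    ultimately show ?thesis using ya by metis
  qed
  ultimately show ?thesis by blast
qed

text \<open>Comparison with a known quadrature point \<open>v\<close> under \<open>exp\<close> makes
  the sum of the interpolation errors at most 0. Each error is a square times a positive number, so
  the square vanishes at every \<open>w \<bullet> y\<close>.\<close>

lemma universal_minimumD:
  assumes x: "x \<in> leech_code" and w: "universal_minimum (half_code x) x w"
  shows "norm w = 1" "x \<bullet> w = 0" "\<And>y. y \<in> half_code x \<Longrightarrow> w \<bullet> y \<in> quad_nodes"
proof -
  have w': "norm w = 1" "x \<bullet> w = 0" "w \<notin> half_code x"
    using w by (auto simp: universal_minimum_def Let_def)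
  then show "norm w = 1" "x \<bullet> w = 0" by auto
  obtain v where v: "norm v = 1" "x \<bullet> v = 0" "\<And>y. y \<in> half_code x \<Longrightarrow> v \<bullet> y \<in> quad_nodes"
    using quad_point_exists[OF x] by blast
  let ?D = "\<lambda>j::nat. exp :: real \<Rightarrow> real"
  let ?R = "\<lambda>y. (\<Prod>a\<leftarrow>quad_node_list. (w \<bullet> y) - a) * newton_rest quad_node_list ?D 0 (w \<bullet> y)"
  have D: "monotone_sequence ?D" by (rule monotone_sequence_exp)
  have "v \<in> {u \<in> sphere 0 1. x \<bullet> u = 0} - half_code x"
    using v quad_point_not_in_half_code[OF x v(1,3)] by simp
  then have "potential exp (half_code x) w \<le> potential exp (half_code x) v"
    using w absolutely_monotone_exp unfolding universal_minimum_def Let_def by blast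
  then have le: "(\<Sum>y\<in>half_code x. ?R y) \<le> 0"
    using half_code_potential(1)[OF x w' v D] by simp
  have pos: "newton_rest quad_node_list ?D 0 (w \<bullet> y) > 0" if "y \<in> half_code x" for y
    using half_code_potential(2)[OF x w' v D that] quad_node_list_subset
    by (intro newton_rest_pos[OF D]) (auto simp: quad_node_list_def)
  have nn: "?R y \<ge> 0" if "y \<in> half_code x" for y
    using pos[OF that] by (intro mult_nonneg_nonneg) (auto simp: prod_quad_node_list)
  have "\<forall>y\<in>half_code x. ?R y = 0"
    using le nn sum_nonneg_eq_0_iff[OF finite_half_code[OF x], of ?R] sum_nonneg[of "half_code x" ?R]
    by (simp add: antisym)
  then show "w \<bullet> y \<in> quad_nodes" if "y \<in> half_code x" for y
    using that pos[OF that] prod_quad_node_list_eq_0[of "w \<bullet> y"] by fastforce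
qed

text \<open>The moments of degree 0 to 3 are four linear equations for the four counts; in units of
  \<open>r = sqrt 5 / 15\<close> the nodes are \<open>-3, -1, 1, 3\<close>.\<close>

lemma quad_point_count:
  assumes x: "x \<in> leech_code"
    and w: "norm w = 1" "x \<bullet> w = 0" "\<And>y. y \<in> half_code x \<Longrightarrow> w \<bullet> y \<in> quad_nodes"
  shows "card {y \<in> half_code x. w \<bullet> y = sqrt 5 / 15} = 2025"
proof -
  define r where "r = sqrt 5 / 15"
  have r: "r > 0" "r\<^sup>2 = 1/45" by (auto simp: r_def power_divide)
  define n where "n k = real (card {y \<in> half_code x. w \<bullet> y = k * r})" for k
  have nodes: "quad_nodes = {-3 * r, -1 * r, 1 * r, 3 * r}" by (auto simp: quad_nodes_def r_def)
  have sum: "(\<Sum>y\<in>half_code x. g (w \<bullet> y)) = n (-3) * g (-3 * r) + n (-1) * g (-1 * r) + n 1 * g (1 * r) + n 3 * g (3 * r)" for g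
  proof -
    have "(\<Sum>y\<in>half_code x. g (w \<bullet> y)) = (\<Sum>t\<in>quad_nodes. real (card {y \<in> half_code x. w \<bullet> y = t}) * g t)"
      by (rule sum_by_values) (use w finite_half_code[OF x] in \<open>auto simp: quad_nodes_def\<close>)
    also have "\<dots> = (\<Sum>k\<in>{-3, -1, 1, 3}. n k * g (k * r))"
      unfolding nodes n_def by (rule sum.reindex_bij_witness[of _ "\<lambda>k. k * r" "\<lambda>t. t / r"]) (use r in auto)
    finally show ?thesis by simp
  qed
  have "n (-3) + n (-1) + n 1 + n 3 = 4600"
    using sum[of "\<lambda>_. 1"] card_half_code[OF x] by simp
  moreover have "r * (- 3 * n (-3) - n (-1) + n 1 + 3 * n 3) = 0"
    using sum[of "\<lambda>t. t ^ 1"] half_code_odd[OF x, of 1 w] by (simp add: inner_commute[of w] algebra_simps)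
  moreover have "r\<^sup>2 * (9 * n (-3) + n (-1) + n 1 + 9 * n 3) = 200"
    using sum[of "\<lambda>t. t ^ 2"] half_code_design(1)[OF x w(1,2)]
    by (simp add: inner_commute[of w] power_mult_distrib algebra_simps)
  moreover have "r ^ 3 * (- 27 * n (-3) - n (-1) + n 1 + 27 * n 3) = 0"
    using sum[of "\<lambda>t. t ^ 3"] half_code_odd[OF x, of 3 w]
    by (simp add: inner_commute[of w] power_mult_distrib algebra_simps)
  ultimately have "n 1 = 2025" using r by simp
  then show ?thesis by (simp add: n_def r_def)
qed

lemma is_C2025_properties:
  assumes C: "is_C2025 C"
  shows "spherical_code C" "card C = 2025" "inner_products C \<subseteq> {- 4/11, - 1/44, 7/22}"
proof -
  obtain x w and f :: "real^22 \<Rightarrow> real^24" where x: "x \<in> leech_code"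
    and um: "universal_minimum (half_code x) x w" and f: "linear f" "\<And>v. norm (f v) = norm v"
    and im: "f ` C = derived_code (half_code x) w (sqrt 5 / 15)"
    using C unfolding is_C2025_def by blast
  note w = universal_minimumD[OF x um]
  define r where "r = sqrt 5 / 15"
  have r: "r\<^sup>2 = 1/45" "\<bar>r\<bar> < 1" "r > 0" using sqrt_5_bounds by (auto simp: r_def power_divide)
  have inj: "inj_on f C" using isometry_inj[OF f] by (rule inj_on_subset) simp
  have "card (f ` C) = 2025"
    unfolding im using card_derived_code[OF r(2), of "half_code x" w] quad_point_count[OF x w] by (simp add: r_def)
  then show card: "card C = 2025" using card_image[OF inj] by simp
  have rep: "\<exists>y\<in>half_code x. w \<bullet> y = r \<and> f v = (y - r *\<^sub>R w) /\<^sub>R sqrt (1 - r\<^sup>2)" if "v \<in> C" for v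
  proof -
    have "f v \<in> derived_code (half_code x) w r" using that im unfolding r_def by blast
    then show ?thesis unfolding derived_code_def by blast
  qed
  have "norm v = 1" if v: "v \<in> C" for v
  proof -
    obtain y where y: "y \<in> half_code x" "w \<bullet> y = r" "f v = (y - r *\<^sub>R w) /\<^sub>R sqrt (1 - r\<^sup>2)" using rep[OF v] by blast
    have "f v \<bullet> f v = (y \<bullet> y - r\<^sup>2) / (1 - r\<^sup>2)" unfolding y(3) by (rule derived_code_inner[OF w(1) y(2) y(2) r(2)])
    also have "y \<bullet> y = 1" using half_code_norm[OF x y(1)] by (simp add: norm_eq_1)
    finally have "f v \<bullet> f v = 1" using r by simp
    then show ?thesis using isometry_inner[OF f] by (simp add: norm_eq_1)
  qed
  moreover have "finite C" by (rule card_ge_0_finite) (simp add: card)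
  ultimately show "spherical_code C" by (auto simp: spherical_code_def)
  show "inner_products C \<subseteq> {- 4/11, - 1/44, 7/22}"
  proof
    fix t assume "t \<in> inner_products C"
    then obtain u v where uv: "u \<in> C" "v \<in> C" "u \<noteq> v" "t = u \<bullet> v" by (auto simp: inner_products_def)
    obtain y where y: "y \<in> half_code x" "w \<bullet> y = r" "f u = (y - r *\<^sub>R w) /\<^sub>R sqrt (1 - r\<^sup>2)" using rep[OF uv(1)] by blast
    obtain z where z: "z \<in> half_code x" "w \<bullet> z = r" "f v = (z - r *\<^sub>R w) /\<^sub>R sqrt (1 - r\<^sup>2)" using rep[OF uv(2)] by blast
    have "f u \<bullet> f v = (y \<bullet> z - r\<^sup>2) / (1 - r\<^sup>2)" unfolding y(3) z(3) by (rule derived_code_inner[OF w(1) y(2) z(2) r(2)])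
    then have t: "t = (y \<bullet> z - 1/45) / (1 - 1/45)" using isometry_inner[OF f] uv(4) r by simp
    have "f u \<noteq> f v" using isometry_inj[OF f] uv(3) by (simp add: inj_eq)
    then have "y \<noteq> z" using y z by auto
    then have "y \<bullet> z \<noteq> 1" using unit_inner_eq_1 half_code_norm[OF x] y(1) z(1) by blast
    \<comment> \<open>Antipodal points have opposite inner products with \<open>w\<close>, but both
      equal \<open>r > 0\<close>.\<close>
    moreover have "y \<bullet> z \<noteq> -1"
    proof
      assume "y \<bullet> z = -1"
      then have "z = - y" using unit_inner_eq_minus_1 half_code_norm[OF x] y(1) z(1) by blast
      then show False using y(2) z(2) r(3) by simp
    qed
    ultimately have "y \<bullet> z \<in> {-1/3, 0, 1/3}" using half_code_inner[OF x y(1) z(1)] by auto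
    then show "t \<in> {- 4/11, - 1/44, 7/22}" unfolding t by auto
  qed
qed

lemma is_C2025_exists: "\<exists>C. is_C2025 C"
proof -
  have "leech_code \<noteq> {}" using card_leech_code_ge by auto
  then obtain x where x: "x \<in> leech_code" by blast
  obtain w where w: "norm w = 1" "x \<bullet> w = 0" "\<And>y. y \<in> half_code x \<Longrightarrow> w \<bullet> y \<in> quad_nodes"
    using quad_point_exists[OF x] by blast
  have um: "universal_minimum (half_code x) x w" using x w by (rule universal_minimumI)
  have nx: "norm x = 1" using x by (rule norm_leech_code)
  then have ne: "x \<noteq> w" using w by (auto simp: norm_eq_1)
  have nz: "x \<noteq> 0" "w \<noteq> 0" using nx w by auto
  have "\<exists>f :: real^22 \<Rightarrow> real^24. linear f \<and> (\<forall>v. norm (f v) = norm v) \<and> range f = {v. \<forall>b\<in>{x, w}. b \<bullet> v = 0}"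
    using ne nz w(2) by (intro isometry_onto_orthogonal_complement)
      (auto simp: pairwise_def orthogonal_def inner_commute)
  then obtain f :: "real^22 \<Rightarrow> real^24" where f: "linear f" "\<forall>v. norm (f v) = norm v"
      "range f = {v. x \<bullet> v = 0 \<and> w \<bullet> v = 0}" by auto
  let ?D = "derived_code (half_code x) w (sqrt 5 / 15)"
  have "?D \<subseteq> range f"
  proof
    fix v assume "v \<in> ?D"
    then obtain y where y: "y \<in> half_code x" "w \<bullet> y = sqrt 5 / 15"
      "v = (y - (sqrt 5 / 15) *\<^sub>R w) /\<^sub>R sqrt (1 - (sqrt 5 / 15)\<^sup>2)" unfolding derived_code_def by blast
    then show "v \<in> range f" using half_code_orthogonal[OF x y(1)] w
      by (simp add: f(3) inner_diff_right norm_eq_1)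
  qed
  then have "f ` (f -` ?D) = ?D" by auto
  then have "is_C2025 (f -` ?D)" unfolding is_C2025_def using x um f by blast
  then show ?thesis by blast
qed

section \<open>The energy bound\<close>

definition cubic :: "real \<Rightarrow> real \<Rightarrow> real \<Rightarrow> real \<Rightarrow> real \<Rightarrow> real" where
  "cubic c0 c1 c2 c3 t = c0 + c1 * (t + 4/11) + c2 * ((t + 4/11) * (t + 1/44))
     + c3 * ((t + 4/11) * (t + 1/44) * (t - 7/22))"

text \<open>The contribution of the Gegenbauer components of degree 1 to 3 to the double sum of
  \<open>cubic\<close>; the constants 17/44, 5/484 and 3/44 come from expanding the Newton basis,
  and their positivity makes the bound work.\<close>

definition gegen_excess :: "real \<Rightarrow> real \<Rightarrow> real \<Rightarrow> (real^22) set \<Rightarrow> real" where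
  "gegen_excess c1 c2 c3 C = (c1 + 17/44 * c2 + 5/484 * c3) * gegen_sum 1 C
     + (c2 + 3/44 * c3) * gegen_sum 2 C + c3 * gegen_sum 3 C"

lemma cubic_gegenbauer:
  "cubic c0 c1 c2 c3 t = (c1 + 17/44 * c2 + 5/484 * c3) * gegenbauer 22 1 t
     + (c2 + 3/44 * c3) * gegenbauer 22 2 t + c3 * gegenbauer 22 3 t
     + (c0 + 4/11 * c1 + 13/242 * c2 + 5/10648 * c3)"
  unfolding gegenbauer_values cubic_def by (simp add: field_simps power2_eq_square power3_eq_cube)

text \<open>The double sum consists of the excess and 2025 squared times the constant component.
  Removing the diagonal leaves the claimed weights, by the quadrature rule with nodes -4/11, -1/44,
  7/22, 1 and weights 330, 1232, 462, 1.\<close>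

lemma cubic_energy:
  fixes C :: "(real^22) set"
  assumes C: "spherical_code C" "card C = 2025"
  shows "energy (cubic c0 c1 c2 c3) C
    = 2025 * (330 * cubic c0 c1 c2 c3 (- 4/11) + 1232 * cubic c0 c1 c2 c3 (- 1/44) + 462 * cubic c0 c1 c2 c3 (7/22))
     + gegen_excess c1 c2 c3 C"
proof -
  let ?f = "cubic c0 c1 c2 c3"
  let ?c = "c0 + 4/11 * c1 + 13/242 * c2 + 5/10648 * c3"
  have fin: "finite C" and norm: "\<And>x. x \<in> C \<Longrightarrow> x \<bullet> x = 1"
    using C by (auto simp: spherical_code_def norm_eq_1[symmetric])
  have "energy ?f C = (\<Sum>x\<in>C. (\<Sum>y\<in>C. ?f (x \<bullet> y)) - ?f 1)"
    unfolding energy_def by (rule sum.cong) (auto simp: sum_diff1 fin norm)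
  also have "\<dots> = (\<Sum>x\<in>C. \<Sum>y\<in>C. ?f (x \<bullet> y)) - 2025 * ?f 1"
    by (simp add: sum_subtractf C(2))
  also have "(\<Sum>x\<in>C. \<Sum>y\<in>C. ?f (x \<bullet> y)) = gegen_excess c1 c2 c3 C + 2025 * 2025 * ?c"
    unfolding cubic_gegenbauer gegen_excess_def gegen_sum_def sum.distrib sum_distrib_left[symmetric]
    by (simp add: C(2))
  also have "gegen_excess c1 c2 c3 C + 2025 * 2025 * ?c - 2025 * ?f 1
     = 2025 * (330 * ?f (- 4/11) + 1232 * ?f (- 1/44) + 462 * ?f (7/22)) + gegen_excess c1 c2 c3 C"
    by (simp add: cubic_def field_simps)
  finally show ?thesis .
qed

text \<open>Divided differences at initial segments of the node list. Only the coefficient with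
  \<open>k = 3\<close> involves \<open>d\<close>; there \<open>d\<close> repeats a node.\<close>

definition newton_coeff :: "nat \<Rightarrow> real \<Rightarrow> (nat \<Rightarrow> real \<Rightarrow> real) \<Rightarrow> real" where
  "newton_coeff k d D = (let as = [- 4/11, - 1/44, 7/22, d] in newton_rest (take k as) D 0 (as ! k))"

definition remainder :: "real \<Rightarrow> (nat \<Rightarrow> real \<Rightarrow> real) \<Rightarrow> real \<Rightarrow> real" where
  "remainder d D t = (t + 4/11) * (t + 1/44) * (t - 7/22) * (t - d) * newton_rest [- 4/11, - 1/44, 7/22, d] D 0 t"

lemma newton_cubic:
  "D 0 t = cubic (D 0 (- 4/11)) (newton_coeff 1 d D) (newton_coeff 2 d D) (newton_coeff 3 d D) t + remainder d D t"
proof -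
  define q1 where "q1 = quotient_sequence (- 4/11) D"
  define q2 where "q2 = quotient_sequence (- 1/44) q1"
  define q3 where "q3 = quotient_sequence (7/22) q2"
  define q4 where "q4 = quotient_sequence d q3"
  have "D 0 t = D 0 (- 4/11) + (t - (- 4/11)) * q1 0 t"
    unfolding q1_def by (rule quotient_sequence_mult)
  also have "q1 0 t = q1 0 (- 1/44) + (t - (- 1/44)) * q2 0 t"
    unfolding q2_def by (rule quotient_sequence_mult)
  also have "q2 0 t = q2 0 (7/22) + (t - 7/22) * q3 0 t"
    unfolding q3_def by (rule quotient_sequence_mult)
  also have "q3 0 t = q3 0 d + (t - d) * q4 0 t"
    unfolding q4_def by (rule quotient_sequence_mult)
  finally have nested: "D 0 t = D 0 (- 4/11) + (t - (- 4/11)) * (q1 0 (- 1/44) + (t - (- 1/44)) *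
      (q2 0 (7/22) + (t - 7/22) * (q3 0 d + (t - d) * q4 0 t)))" .
  \<comment> \<open>Stated over variables, so that the expansion does not normalize the rational
    nodes.\<close>
  have ring: "a + u * (b + v * (c + w * (e + z * q))) = a + b * u + c * (u * v) + e * (u * v * w) + u * v * w * z * q"
    for a b c e u v w z q :: real by (simp add: algebra_simps)
  have "newton_coeff 1 d D = q1 0 (- 1/44)" "newton_coeff 2 d D = q2 0 (7/22)" "newton_coeff 3 d D = q3 0 d"
    "newton_rest [- 4/11, - 1/44, 7/22, d] D = q4"
    by (simp_all add: newton_coeff_def q1_def q2_def q3_def q4_def take_Cons')
  moreover have "t - (- 4/11) = t + 4/11" "t - (- 1/44) = t + 1/44" by simp_all
  ultimately show ?thesis
    unfolding cubic_def remainder_def nested ring by (simp only:)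
qed

text \<open>A purely algebraic identity for any sequence \<open>D\<close> and any \<open>d\<close>;
  monotonicity enters only through the signs of the last two terms.\<close>

lemma energy_decomposition:
  fixes C :: "(real^22) set"
  assumes C: "spherical_code C" "card C = 2025"
  shows "energy (D 0) C = 2025 * (330 * D 0 (- 4/11) + 1232 * D 0 (- 1/44) + 462 * D 0 (7/22))
     + gegen_excess (newton_coeff 1 d D) (newton_coeff 2 d D) (newton_coeff 3 d D) C
     + energy (remainder d D) C"
proof -
  let ?f = "cubic (D 0 (- 4/11)) (newton_coeff 1 d D) (newton_coeff 2 d D) (newton_coeff 3 d D)"
  have "energy (D 0) C = energy ?f C + energy (remainder d D) C"
    unfolding energy_def sum.distrib[symmetric] newton_cubic[of D _ d, symmetric] ..
  moreover have "remainder d D (- 4/11) = 0" "remainder d D (- 1/44) = 0" "remainder d D (7/22) = 0"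
    by (simp_all add: remainder_def)
  then have "?f (- 4/11) = D 0 (- 4/11)" "?f (- 1/44) = D 0 (- 1/44)" "?f (7/22) = D 0 (7/22)"
    using newton_cubic[of D "- 4/11" d] newton_cubic[of D "- 1/44" d] newton_cubic[of D "7/22" d] by linarith+
  ultimately show ?thesis unfolding cubic_energy[OF C] by (simp only:)
qed

lemma newton_coeff_nonneg:
  assumes "monotone_sequence D" "d \<in> {-1<..<1}" "k \<in> {1, 2, 3}"
  shows "newton_coeff k d D \<ge> 0"
  using assms unfolding newton_coeff_def Let_def
  by (intro newton_rest_nonneg) (auto simp: take_Cons')

lemma newton_coeff_3_pos:
  assumes D: "monotone_sequence D" "d \<in> {-1<..<1}" and pos: "\<And>t. t \<in> {-1<..<1} \<Longrightarrow> D 4 t > 0"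
  shows "newton_coeff 3 d D > 0"
proof -
  have D3: "D 3 t > 0" if t: "t \<in> {-1<..<1}" for t
  proof -
    \<comment> \<open>The midpoint between -1 and \<open>t\<close>: \<open>D 3\<close> is
      nonnegative there and strictly increasing up to \<open>t\<close>.\<close>
    define s where "s = (t - 1) / 2"
    have s: "s \<in> {-1<..<1}" "s < t" using t by (auto simp: s_def)
    have "D 3 s < D 3 t"
    proof (rule DERIV_pos_imp_increasing[OF s(2)])
      fix z assume "s \<le> z" "z \<le> t"
      then have z: "z \<in> {-1<..<1}" using s t by auto
      then have "(D 3 has_real_derivative D (Suc 3) z) (at z)"
        using D unfolding monotone_sequence_def derivative_sequence_def by blast
      then show "\<exists>y. (D 3 has_real_derivative y) (at z) \<and> 0 < y" using pos[OF z] by auto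
    qed
    moreover have "D 3 s \<ge> 0" using D s(1) unfolding monotone_sequence_def by simp
    ultimately show ?thesis by simp
  qed
  show ?thesis unfolding newton_coeff_def Let_def
    by (rule newton_rest_pos) (use D D3[unfolded numeral_3_eq_3] in \<open>auto simp: take_Cons'\<close>)
qed

lemma inner_in_range:
  assumes C: "spherical_code C" and xy: "x \<in> C" "y \<in> C" "x \<noteq> y"
  shows "x \<bullet> y \<in> {-1..<1}"
proof -
  have n: "norm x = 1" "norm y = 1" using C xy by (auto simp: spherical_code_def)
  have "\<bar>x \<bullet> y\<bar> \<le> 1" using Cauchy_Schwarz_ineq2[of x y] n by simp
  moreover have "x \<bullet> y \<noteq> 1" using unit_inner_eq_1[OF n] xy by simp
  ultimately show ?thesis by auto
qed

text \<open>The repeated node turns one linear factor into a square; the other two factors are those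
  of the endpoints of \<open>T\<close>, and their product is negative only inside
  \<open>T\<close>.\<close>

lemma remainder_nonneg:
  assumes T: "T = {- 4/11 <..< - 1/44} \<and> d = 7/22 \<or> T = {- 1/44 <..< 7/22} \<and> d = - 4/11"
    and D: "monotone_sequence D" and t: "t \<in> {-1..<1}" "t \<notin> T"
  shows "remainder d D t \<ge> 0"
proof -
  have "newton_rest [- 4/11, - 1/44, 7/22, d] D 0 t \<ge> 0"
    using T t(1) by (intro newton_rest_nonneg[OF D]) auto
  moreover have "(t + 4/11) * (t + 1/44) * (t - 7/22) * (t - d) \<ge> 0"
    using T
  proof
    assume T: "T = {- 4/11 <..< - 1/44} \<and> d = 7/22"
    then have "t \<le> - 4/11 \<or> t \<ge> - 1/44" using t by auto
    then have "(t + 4/11) * (t + 1/44) \<ge> 0" by (auto simp: zero_le_mult_iff)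
    then have "(t + 4/11) * (t + 1/44) * (t - 7/22)\<^sup>2 \<ge> 0" by simp
    then show ?thesis using T by (simp only: power2_eq_square mult.assoc)
  next
    assume T: "T = {- 1/44 <..< 7/22} \<and> d = - 4/11"
    then have "t \<le> - 1/44 \<or> t \<ge> 7/22" using t by auto
    then have "(t + 1/44) * (t - 7/22) \<ge> 0" by (auto simp: zero_le_mult_iff)
    then have "(t + 4/11)\<^sup>2 * ((t + 1/44) * (t - 7/22)) \<ge> 0" by simp
    moreover have td: "t - d = t + 4/11" using T by simp
    have "(t + 4/11) * (t + 1/44) * (t - 7/22) * (t - d) = (t + 4/11)\<^sup>2 * ((t + 1/44) * (t - 7/22))"
      unfolding td power2_eq_square by (simp only: mult_ac)
    ultimately show ?thesis by (simp only:)
  qed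
  ultimately show ?thesis unfolding remainder_def by (rule mult_nonneg_nonneg[rotated])
qed

lemma remainder_eq_0D:
  assumes "d \<in> {- 4/11, 7/22}" and D: "monotone_sequence D" and pos: "\<And>t. t \<in> {-1<..<1} \<Longrightarrow> D 4 t > 0"
    and t: "t \<in> {-1..<1}" "remainder d D t = 0"
  shows "t \<in> {- 4/11, - 1/44, 7/22}"
proof -
  have "newton_rest [- 4/11, - 1/44, 7/22, d] D 0 t > 0"
  proof (rule newton_rest_pos[OF D])
    fix s :: real assume "s \<in> {-1<..<1}"
    then show "D (length [- 4/11, - 1/44, 7/22, d]) s > 0" using pos[of s] by (simp add: eval_nat_numeral)
  qed (use assms in auto)
  then have "(t + 4/11) * (t + 1/44) * (t - 7/22) * (t - d) = 0" using t(2) by (simp add: remainder_def)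
  then show ?thesis using assms(1) by (auto simp: add_eq_0_iff2)
qed

lemma energy_remainder_nonneg:
  assumes T: "T = {- 4/11 <..< - 1/44} \<and> d = 7/22 \<or> T = {- 1/44 <..< 7/22} \<and> d = - 4/11"
    and D: "monotone_sequence D" and C: "spherical_code C" "avoiding T C"
  shows "energy (remainder d D) C \<ge> 0"
    "energy (remainder d D) C = 0 \<Longrightarrow> x \<in> C \<Longrightarrow> y \<in> C \<Longrightarrow> x \<noteq> y \<Longrightarrow> remainder d D (x \<bullet> y) = 0"
proof -
  have fin: "finite C" using C by (simp add: spherical_code_def)
  have nn: "remainder d D (x \<bullet> y) \<ge> 0" if "x \<in> C" "y \<in> C - {x}" for x y
  proof (rule remainder_nonneg[OF T D])
    show "x \<bullet> y \<in> {-1..<1}" using inner_in_range[OF C(1)] that by blast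
    show "x \<bullet> y \<notin> T" using C(2) that unfolding avoiding_def inner_products_def by blast
  qed
  have nn': "(\<Sum>y\<in>C - {x}. remainder d D (x \<bullet> y)) \<ge> 0" if "x \<in> C" for x
    using nn that by (intro sum_nonneg)
  then show "energy (remainder d D) C \<ge> 0" unfolding energy_def by (rule sum_nonneg)
  assume "energy (remainder d D) C = 0" and xy: "x \<in> C" "y \<in> C" "x \<noteq> y"
  then have "(\<Sum>y\<in>C - {x}. remainder d D (x \<bullet> y)) = 0"
    unfolding energy_def using sum_nonneg_eq_0_iff[OF fin nn'] by simp
  then have "\<forall>y\<in>C - {x}. remainder d D (x \<bullet> y) = 0"
    using sum_nonneg_eq_0_iff[of "C - {x}" "\<lambda>y. remainder d D (x \<bullet> y)"] fin nn[OF xy(1)] by simp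
  then show "remainder d D (x \<bullet> y) = 0" using xy by auto
qed

lemma gegen_excess_nonneg:
  assumes "spherical_code C" "c1 \<ge> 0" "c2 \<ge> 0" "c3 \<ge> 0"
  shows "gegen_excess c1 c2 c3 C \<ge> 0"
    "c3 > 0 \<Longrightarrow> gegen_excess c1 c2 c3 C = 0 \<Longrightarrow> gegen_sum 1 C = 0 \<and> gegen_sum 2 C = 0 \<and> gegen_sum 3 C = 0"
proof -
  have g: "gegen_sum k C \<ge> 0" for k
    using assms(1) by (intro gegen_sum_nonneg) (simp add: spherical_code_def)
  define a1 where "a1 = (c1 + 17/44 * c2 + 5/484 * c3) * gegen_sum 1 C"
  define a2 where "a2 = (c2 + 3/44 * c3) * gegen_sum 2 C"
  define a3 where "a3 = c3 * gegen_sum 3 C"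
  have e: "gegen_excess c1 c2 c3 C = a1 + a2 + a3" by (simp add: gegen_excess_def a1_def a2_def a3_def)
  have nn: "a1 \<ge> 0" "a2 \<ge> 0" "a3 \<ge> 0" using assms g by (simp_all add: a1_def a2_def a3_def)
  then show "gegen_excess c1 c2 c3 C \<ge> 0" by (simp add: e)
  assume c3: "c3 > 0" and "gegen_excess c1 c2 c3 C = 0"
  then have "a1 = 0" "a2 = 0" "a3 = 0" using nn e by linarith+
  moreover have "c1 + 17/44 * c2 + 5/484 * c3 > 0" "c2 + 3/44 * c3 > 0" using c3 assms by linarith+
  ultimately show "gegen_sum 1 C = 0 \<and> gegen_sum 2 C = 0 \<and> gegen_sum 3 C = 0"
    using c3 by (auto simp: a1_def a2_def a3_def)
qed

text \<open>The monic cubic that vanishes at the three inner products has energy 0 and claimed value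
  0, so its excess is 0. As its three Gegenbauer coefficients are positive, all Gegenbauer sums of
  degree 1 to 3 vanish, and with them the excess for every choice of coefficients.\<close>

lemma three_distance_gegen_excess:
  fixes C :: "(real^22) set"
  assumes C: "spherical_code C" "card C = 2025" "inner_products C \<subseteq> {- 4/11, - 1/44, 7/22}"
  shows "gegen_excess c1 c2 c3 C = 0"
proof -
  have z: "cubic 0 0 0 1 t = 0" if "t \<in> {- 4/11, - 1/44, 7/22}" for t using that by (auto simp: cubic_def)
  have "x \<bullet> y \<in> {- 4/11, - 1/44, 7/22}" if "x \<in> C" "y \<in> C - {x}" for x y
    using C(3) that unfolding inner_products_def by blast
  then have "energy (cubic 0 0 0 1) C = 0" unfolding energy_def using z by (simp add: sum.neutral)
  then have "gegen_excess 0 0 1 C = 0" using cubic_energy[OF C(1,2), of 0 0 0 1] z by simp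
  then have "gegen_sum 1 C = 0 \<and> gegen_sum 2 C = 0 \<and> gegen_sum 3 C = 0"
    by (intro gegen_excess_nonneg(2)[OF C(1), of 0 0 1]) auto
  then show ?thesis by (simp add: gegen_excess_def)
qed

lemma energy_three_distance:
  fixes C :: "(real^22) set"
  assumes C: "spherical_code C" "card C = 2025" "inner_products C \<subseteq> {- 4/11, - 1/44, 7/22}"
  shows "energy h C = 2025 * (330 * h (- 4/11) + 1232 * h (- 1/44) + 462 * h (7/22))"
proof -
  \<comment> \<open>A constant sequence and \<open>d = 0\<close> serve here: the decomposition is an
    identity, and the remainder vanishes at the three nodes whatever the derivatives are.\<close>
  let ?D = "\<lambda>j::nat. h"
  have "remainder 0 ?D (x \<bullet> y) = 0" if "x \<in> C" "y \<in> C - {x}" for x y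
  proof -
    have "x \<bullet> y \<in> {- 4/11, - 1/44, 7/22}" using C(3) that unfolding inner_products_def by blast
    then show ?thesis by (auto simp: remainder_def)
  qed
  then have "energy (remainder 0 ?D) C = 0" unfolding energy_def by (simp add: sum.neutral)
  then show ?thesis
    using energy_decomposition[OF C(1,2), of ?D 0] three_distance_gegen_excess[OF C] by simp
qed

lemma energy_lower_bound:
  fixes C :: "(real^22) set"
  assumes T: "T = {- 4/11 <..< - 1/44} \<or> T = {- 1/44 <..< 7/22}"
    and h: "absolutely_monotone h"
    and C: "spherical_code C" "avoiding T C" "card C = 2025"
  shows "energy h C \<ge> 2025 * (330 * h (- 4/11) + 1232 * h (- 1/44) + 462 * h (7/22))"
    and "(\<forall>t\<in>{-1<..<1}. (deriv ^^ 4) h t > 0) \<Longrightarrow>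
      energy h C = 2025 * (330 * h (- 4/11) + 1232 * h (- 1/44) + 462 * h (7/22)) \<Longrightarrow>
      inner_products C \<subseteq> {- 4/11, - 1/44, 7/22} \<and> gegen_sum 1 C = 0 \<and> gegen_sum 2 C = 0 \<and> gegen_sum 3 C = 0"
proof -
  \<comment> \<open>The fourth node repeats the one of the three that is not an endpoint of
    \<open>T\<close>.\<close>
  define d :: real where "d = (if T = {- 4/11 <..< - 1/44} then 7/22 else - 4/11)"
  have T': "T = {- 4/11 <..< - 1/44} \<and> d = 7/22 \<or> T = {- 1/44 <..< 7/22} \<and> d = - 4/11"
    using T by (auto simp: d_def)
  then have d: "d \<in> {- 4/11, 7/22}" "d \<in> {-1<..<1}" by auto
  let ?D = "\<lambda>j. (deriv ^^ j) h"
  have D: "monotone_sequence ?D" using h by (rule monotone_sequence_deriv)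
  let ?g = "gegen_excess (newton_coeff 1 d ?D) (newton_coeff 2 d ?D) (newton_coeff 3 d ?D) C"
  have dec: "energy h C = 2025 * (330 * h (- 4/11) + 1232 * h (- 1/44) + 462 * h (7/22)) + ?g + energy (remainder d ?D) C"
    using energy_decomposition[OF C(1,3), of ?D d] by simp
  note coeff = newton_coeff_nonneg[OF D d(2)]
  have g: "?g \<ge> 0" by (intro gegen_excess_nonneg(1)[OF C(1)] coeff) auto
  note rem = energy_remainder_nonneg[OF T' D C(1,2)]
  show "energy h C \<ge> 2025 * (330 * h (- 4/11) + 1232 * h (- 1/44) + 462 * h (7/22))"
    using dec g rem(1) by linarith
  assume h4: "\<forall>t\<in>{-1<..<1}. (deriv ^^ 4) h t > 0"
    and "energy h C = 2025 * (330 * h (- 4/11) + 1232 * h (- 1/44) + 462 * h (7/22))"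
  then have zero: "?g = 0" "energy (remainder d ?D) C = 0" using dec g rem(1) by linarith+
  have "inner_products C \<subseteq> {- 4/11, - 1/44, 7/22}"
  proof
    fix t assume "t \<in> inner_products C"
    then obtain x y where xy: "x \<in> C" "y \<in> C" "x \<noteq> y" "t = x \<bullet> y" by (auto simp: inner_products_def)
    show "t \<in> {- 4/11, - 1/44, 7/22}" unfolding xy(4)
      by (rule remainder_eq_0D[OF d(1) D _ inner_in_range[OF C(1) xy(1-3)] rem(2)[OF zero(2) xy(1-3)]])
         (use h4 in blast)
  qed
  moreover have "gegen_sum 1 C = 0 \<and> gegen_sum 2 C = 0 \<and> gegen_sum 3 C = 0"
    by (rule gegen_excess_nonneg(2)[OF C(1) coeff coeff coeff _ zero(1)])
       (use newton_coeff_3_pos[OF D d(2)] h4 in auto)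
  ultimately show "inner_products C \<subseteq> {- 4/11, - 1/44, 7/22} \<and> gegen_sum 1 C = 0 \<and> gegen_sum 2 C = 0 \<and> gegen_sum 3 C = 0"
    by blast
qed

lemma gegen_sum_zero_consequences:
  fixes C :: "(real^22) set"
  assumes C: "spherical_code C" "card C = 2025" "inner_products C \<subseteq> {- 4/11, - 1/44, 7/22}"
    and zero: "gegen_sum 1 C = 0" "gegen_sum 2 C = 0" "gegen_sum 3 C = 0"
  shows "spherical_design 3 C" "inner_products C = {- 4/11, - 1/44, 7/22}"
    "has_distance_distribution C [330, 1232, 462]"
proof -
  have fin: "finite C" and sub: "C \<subseteq> sphere 0 1" using C by (auto simp: spherical_code_def)
  have ne: "C \<noteq> {}" using C(2) by auto
  have G: "(\<Sum>y\<in>C. gegenbauer 22 k (y \<bullet> u)) = 0" if "norm u = 1" "k \<in> {1, 2, 3}" for u k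
    using gegenbauer_sum_zero[OF fin sub that(1), of k] zero that(2) by (auto simp: gegen_sum_def)
  have m1: "(\<Sum>y\<in>C. y \<bullet> u) = 0" if "norm u = 1" for u
    using G[OF that, of 1] unfolding gegenbauer_values by simp
  have m2: "(\<Sum>y\<in>C. (y \<bullet> u)\<^sup>2) = 2025 / 22" if "norm u = 1" for u
    using G[OF that, of 2] unfolding gegenbauer_values sum_subtractf by (simp add: C(2))
  have m3: "(\<Sum>y\<in>C. (y \<bullet> u) ^ 3) = 0" if "norm u = 1" for u
    using G[OF that, of 3] unfolding gegenbauer_values sum_subtractf sum_distrib_left[symmetric]
    by (simp add: m1[OF that])
  show "spherical_design 3 C"
    by (rule spherical_design_3I[OF C(1) ne]) (simp_all add: m1 m2 m3 C(2))
  have counts: "card {y \<in> C. x \<bullet> y = - 4/11} = 330 \<and> card {y \<in> C. x \<bullet> y = - 1/44} = 1232 \<and> card {y \<in> C. x \<bullet> y = 7/22} = 462"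
    if x: "x \<in> C" for x
  proof -
    let ?n = "\<lambda>t. real (card {y \<in> C. x \<bullet> y = t})"
    have nx: "norm x = 1" using sub x by auto
    have "{y \<in> C. x \<bullet> y = 1} = {x}" using unit_inner_eq_1[OF nx] sub x nx by auto
    then have one: "?n 1 = 1" by simp
    have "(\<Sum>y\<in>C. g (x \<bullet> y)) = (\<Sum>t\<in>{- 4/11, - 1/44, 7/22, 1}. ?n t * g t)" for g
    proof (rule sum_by_values[OF fin])
      fix y assume y: "y \<in> C"
      show "x \<bullet> y \<in> {- 4/11, - 1/44, 7/22, 1}"
      proof (cases "y = x")
        case True then show ?thesis using nx by (simp add: norm_eq_1)
      next
        case False
        then have "x \<bullet> y \<in> inner_products C" using x y unfolding inner_products_def by blast
        then show ?thesis using C(3) by blast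
      qed
    qed simp
    then have sum: "(\<Sum>y\<in>C. g (x \<bullet> y)) = ?n (- 4/11) * g (- 4/11) + ?n (- 1/44) * g (- 1/44) + ?n (7/22) * g (7/22) + g 1" for g
      using one by simp
    \<comment> \<open>Moments of degree 0, 1, 2 after removing the term of \<open>x\<close> itself,
      which contributes 1 to each; the three equations determine the counts.\<close>
    have "?n (- 4/11) + ?n (- 1/44) + ?n (7/22) = 2024"
      using sum[of "\<lambda>_. 1"] C(2) by simp
    moreover have "- 4/11 * ?n (- 4/11) - 1/44 * ?n (- 1/44) + 7/22 * ?n (7/22) = - 1"
      using sum[of "\<lambda>t. t"] m1[OF nx] by (simp add: inner_commute[of x])
    moreover have "16/121 * ?n (- 4/11) + 1/1936 * ?n (- 1/44) + 49/484 * ?n (7/22) = 2025/22 - 1"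
      using sum[of "\<lambda>t. t\<^sup>2"] m2[OF nx] by (simp add: inner_commute[of x] power2_eq_square)
    ultimately have "?n (- 4/11) = 330 \<and> ?n (- 1/44) = 1232 \<and> ?n (7/22) = 462" by linarith
    then show ?thesis by auto
  qed
  show ip: "inner_products C = {- 4/11, - 1/44, 7/22}"
  proof
    obtain x where x: "x \<in> C" using ne by blast
    have nx: "x \<bullet> x = 1" using sub x by (auto simp: norm_eq_1[symmetric])
    have "t \<in> inner_products C" if c: "card {y \<in> C. x \<bullet> y = t} \<noteq> 0" and t: "t \<noteq> 1" for t
    proof -
      have "{y \<in> C. x \<bullet> y = t} \<noteq> {}" using c by (intro notI) simp
      then obtain y where "y \<in> C" "x \<bullet> y = t" by blast
      then show ?thesis using x nx t unfolding inner_products_def by blast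
    qed
    then show "{- 4/11, - 1/44, 7/22} \<subseteq> inner_products C" using counts[OF x] by auto
  qed (rule C(3))
  have "sorted_list_of_set {- 4/11, - 1/44, 7/22 :: real} = [- 4/11, - 1/44, 7/22]"
    using sorted_list_of_set_sort_remdups[of "[- 4/11, - 1/44, 7/22 :: real]"] by simp
  then show "has_distance_distribution C [330, 1232, 462]"
    unfolding has_distance_distribution_def ip using counts by simp
qed

theorem theorem7p9:
  fixes T :: "real set" and h :: "real \<Rightarrow> real"
  assumes T: "T = {- 4/11 <..< - 1/44} \<or> T = {- 1/44 <..< 7/22}"
    and h: "absolutely_monotone h"
    and h4: "\<forall>t\<in>{-1<..<1}. (deriv ^^ 4) h t > 0"
  shows
    "(\<forall>C :: (real^22) set. spherical_code C \<and> avoiding T C \<and> card C = 2025 \<longrightarrow>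
        energy h C \<ge> min_energy TYPE(22) h 2025 T) \<and>
     min_energy TYPE(22) h 2025 T = 2025 * (330 * h (- 4/11) + 1232 * h (- 1/44) + 462 * h (7/22)) \<and>
     (\<exists>C. is_C2025 C) \<and>
     (\<forall>C. is_C2025 C \<longrightarrow> card C = 2025 \<and> avoiding_universally_optimal T C) \<and>
     (\<forall>C :: (real^22) set. spherical_code C \<and> avoiding T C \<and> card C = 2025 \<and>
        energy h C = min_energy TYPE(22) h 2025 T \<longrightarrow>
        spherical_design 3 C \<and>
        inner_products C = {- 4/11, - 1/44, 7/22} \<and>
        has_distance_distribution C [330, 1232, 462])"
proof -
  let ?E = "\<lambda>h. 2025 * (330 * h (- 4/11) + 1232 * h (- 1/44) + 462 * h (7/22)) :: real"
  have avoid: "avoiding T C" if "is_C2025 C" for C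
    using is_C2025_properties(3)[OF that] T unfolding avoiding_def by auto
  have energy: "energy g C = ?E g" if "is_C2025 C" for g C
    by (rule energy_three_distance[OF is_C2025_properties[OF that]])
  obtain C0 where C0: "is_C2025 C0" using is_C2025_exists by blast
  \<comment> \<open>The value of \<open>LEAST\<close> is legitimate because the bound is attained:
    the code \<open>C0\<close> is a witness.\<close>
  have min: "min_energy TYPE(22) h 2025 T = ?E h"
    unfolding min_energy_def
  proof (rule Least_equality)
    show "\<exists>C :: (real^22) set. spherical_code C \<and> avoiding T C \<and> card C = 2025 \<and> ?E h = energy h C"
      using is_C2025_properties[OF C0] avoid[OF C0] energy[OF C0, of h] by metis
    fix e assume "\<exists>C :: (real^22) set. spherical_code C \<and> avoiding T C \<and> card C = 2025 \<and> e = energy h C"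
    then show "?E h \<le> e" using energy_lower_bound(1)[OF T h] by blast
  qed
  have opt: "avoiding_universally_optimal T C" if C: "is_C2025 C" for C
    unfolding avoiding_universally_optimal_def
    using is_C2025_properties[OF C] avoid[OF C] energy[OF C] energy_lower_bound(1)[OF T] by metis
  have eq: "spherical_design 3 C \<and> inner_products C = {- 4/11, - 1/44, 7/22} \<and> has_distance_distribution C [330, 1232, 462]"
    if C: "spherical_code C" "avoiding T C" "card C = 2025" "energy h C = ?E h" for C :: "(real^22) set"
    using gegen_sum_zero_consequences[OF C(1,3)] energy_lower_bound(2)[OF T h C(1-3) h4 C(4)] by blast
  show ?thesis
    unfolding min using energy_lower_bound(1)[OF T h] is_C2025_exists is_C2025_properties(2) opt eq by blast
qed

end
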